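(* Let $n\ge1$ and $N\in\mathbb{C}$. For any $f_2,f_4,\dots\in\mathbb{C}$ the maps $$s_k\mapsto s_k,\qquad \bar s_k\mapsto0,\qquad y_k\mapsto v_k,\qquad w_i\mapsto f_i\quad(i=2,4,\dots)$$ determine a homomorphism of the affine Brauer algebra $A(n,N)$ onto the degenerate affine Hecke algebra $H(n)$.
   Context: Brauer algebra. For $n\ge1$ let $\mathcal{G}(n)$ be the set of partitions of $\{1,\dots,n,\bar1,\dots,\bar n\}$ into pairs (graphs with $n$ edges). For $N\in\mathbb{C}$, $B(n,N)$ is the complex associative algebra with basis $b(\gamma)$, $\gamma\in\mathcal{G}(n)$, and product $b(\gamma)b(\gamma')=N^{q}b(\gamma\circ\gamma')$: identify the vertices $\bar1,\dots,\bar n$ of $\gamma$ with $1,\dots,n$ of $\gamma'$, let $q$ be the number of loops, remove the loops and replace the other components by single edges joining their terminal vertices to get $\gamma\circ\gamma'$. A permutation $s\in S(n)$ is identified with $b(\gamma)$, $\gamma$ having edges $\{s(m),\bar m\}$. $s_k$ is the transposition $(k,k+1)$, and $\bar s_k=b(\gamma)$ with $\gamma$ having edges $\{k,k+1\},\{\bar k,\overline{k+1}\}$ and $\{m,\bar m\}$ for $m\ne k,k+1$ ($1\le k\le n-1$); these generate $B(n,N)$. Affine Brauer algebra. $A(n,N)$ is the complex associative algebra generated by the algebra $B(n,N)$ together with pairwise commuting elements $y_1,\dots,y_n$ and central elements $w_1,w_2,\dots$ subject to the relations ($1\le k\le n-1$) $$s_ky_l=y_ls_k,\quad \bar s_ky_l=y_l\bar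 s_k\quad(l\ne k,k+1);$$ $$s_ky_k-y_{k+1}s_k=\bar s_k-1,\quad s_ky_{k+1}-y_ks_k=1-\bar s_k;$$ $$\bar s_k(y_k+y_{k+1})=0,\quad (y_k+y_{k+1})\bar s_k=0;\qquad \bar s_1y_1^i\bar s_1=w_i\bar s_1\quad(i=1,2,\dots);$$ and, with $w_0=N$, $\;-2w_i=w_{i-1}+\sum_{j=1}^{i}(-1)^jw_{i-j}w_{j-1}$ for $i=1,3,5,\dots$ (so that the $w_i$ with $i$ odd are polynomials in those with $i$ even). Degenerate affine Hecke algebra. $H(n)$ is the complex associative algebra generated by the group algebra $\mathbb{C}[S(n)]$ and pairwise commuting elements $v_1,\dots,v_n$ subject to $s_kv_l=v_ls_k$ for $l\ne k,k+1$, and $s_kv_k-v_{k+1}s_k=-1$, $s_kv_{k+1}-v_ks_k=1$, for $1\le k\le n-1$. *)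

theory Defs
  imports
    Complex_Main
    "HOL-Algebra.QuotRing"
    "HOL-Algebra.Module"
    "HOL-Algebra.Sym_Groups"
    "HOL-Library.Disjoint_Sets"
    "HOL-Library.Poly_Mapping"
begin

section \<open>Complex associative algebras\<close>

text \<open>
  Complex unital associative algebras are represented by the record
  \<^typ>\<open>(complex, 'a) module\<close>, that is, a ring record with a scalar multiplication
  (the locale \<^locale>\<open>algebra\<close> of the library requires commutativity).
\<close>

definition alg_hom ::
  "(complex, 'a, 'm) module_scheme \<Rightarrow> (complex, 'b, 'k) module_scheme \<Rightarrow> ('a \<Rightarrow> 'b) set"
  where "alg_hom A B =
    {h \<in> ring_hom A B. \<forall>c. \<forall>x \<in> carrier A. h (c \<odot>\<^bsub>A\<^esub> x) = c \<odot>\<^bsub>B\<^esub> h x}"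

abbreviation basis_elt :: "'i \<Rightarrow> ('i \<Rightarrow>\<^sub>0 complex)"
  where "basis_elt x \<equiv> Poly_Mapping.single x 1"

text \<open>
  The algebra with basis \<open>b x\<close>, \<open>x \<in> X\<close>, product \<open>b x * b y = c x y * b (m x y)\<close>
  (extended bilinearly) and unit \<open>b e\<close>.
\<close>

definition based_algebra ::
  "'i set \<Rightarrow> ('i \<Rightarrow> 'i \<Rightarrow> complex) \<Rightarrow> ('i \<Rightarrow> 'i \<Rightarrow> 'i) \<Rightarrow> 'i \<Rightarrow> (complex, 'i \<Rightarrow>\<^sub>0 complex) module"
  where "based_algebra X c m e =
    \<lparr> carrier = {p. Poly_Mapping.keys p \<subseteq> X},
      monoid.mult = (\<lambda>p q. \<Sum>x \<in> Poly_Mapping.keys p. \<Sum>y \<in> Poly_Mapping.keys q.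
                Poly_Mapping.single (m x y)
                  (Poly_Mapping.lookup p x * Poly_Mapping.lookup q y * c x y)),
      one = basis_elt e,
      zero = 0,
      add = (+),
      smult = (\<lambda>a. Poly_Mapping.map ((*) a)) \<rparr>"

definition free_algebra :: "'g set \<Rightarrow> (complex, 'g list \<Rightarrow>\<^sub>0 complex) module"
  where "free_algebra X = based_algebra (lists X) (\<lambda>_ _. 1) (@) []"

definition group_algebra :: "('g, 'm) monoid_scheme \<Rightarrow> (complex, 'g \<Rightarrow>\<^sub>0 complex) module"
  where "group_algebra G = based_algebra (carrier G) (\<lambda>_ _. 1) (\<lambda>x y. x \<otimes>\<^bsub>G\<^esub> y) \<one>\<^bsub>G\<^esub>"

abbreviation letter :: "'g \<Rightarrow> ('g list \<Rightarrow>\<^sub>0 complex)"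
  where "letter x \<equiv> basis_elt [x]"

text \<open>
  The quotient ring by a two-sided ideal, with the induced scalar multiplication written in
  the style of \<^const>\<open>rcoset_mult\<close>.
\<close>

definition quotient_algebra ::
  "(complex, 'a, 'm) module_scheme \<Rightarrow> 'a set \<Rightarrow> (complex, 'a set) module"
  where "quotient_algebra A I =
    \<lparr> carrier = carrier (A Quot I),
      monoid.mult = monoid.mult (A Quot I),
      one = one (A Quot I),
      zero = zero (A Quot I),
      add = add (A Quot I),
      smult = (\<lambda>c C. \<Union>x \<in> C. I +>\<^bsub>A\<^esub> (c \<odot>\<^bsub>A\<^esub> x)) \<rparr>"

text \<open>
  The algebra generated by a given algebra \<open>B\<close> together with further generators \<open>x \<in> X\<close>
  subject to relations: take the free algebra on the disjoint union of \<open>carrier B\<close> and \<open>X\<close>,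
  and divide by the two-sided ideal generated by the relations, together with those saying
  that \<^const>\<open>Inl\<close> induces a homomorphism of unital algebras from \<open>B\<close>.
  A relation \<open>u = v\<close> is given as a pair \<open>(u, v)\<close> of elements of the free algebra.
\<close>

definition adjoin_free ::
  "(complex, 'b, 'm) module_scheme \<Rightarrow> 'x set \<Rightarrow> (complex, ('b + 'x) list \<Rightarrow>\<^sub>0 complex) module"
  where "adjoin_free B X = free_algebra (Inl ` carrier B \<union> Inr ` X)"

definition coefficient_relations ::
  "(complex, 'b, 'm) module_scheme \<Rightarrow> 'x set \<Rightarrow>
    ((('b + 'x) list \<Rightarrow>\<^sub>0 complex) \<times> (('b + 'x) list \<Rightarrow>\<^sub>0 complex)) set"
  where "coefficient_relations B X = (let F = adjoin_free B X; \<iota> = (\<lambda>b. letter (Inl b)) in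
      {(\<iota> (a \<oplus>\<^bsub>B\<^esub> b), \<iota> a \<oplus>\<^bsub>F\<^esub> \<iota> b) | a b. a \<in> carrier B \<and> b \<in> carrier B}
    \<union> {(\<iota> (c \<odot>\<^bsub>B\<^esub> a), c \<odot>\<^bsub>F\<^esub> \<iota> a) | c a. a \<in> carrier B}
    \<union> {(\<iota> (a \<otimes>\<^bsub>B\<^esub> b), \<iota> a \<otimes>\<^bsub>F\<^esub> \<iota> b) | a b. a \<in> carrier B \<and> b \<in> carrier B}
    \<union> {(\<iota> \<one>\<^bsub>B\<^esub>, \<one>\<^bsub>F\<^esub>)})"

definition adjoin_ideal ::
  "(complex, 'b, 'm) module_scheme \<Rightarrow> 'x set \<Rightarrow>
    ((('b + 'x) list \<Rightarrow>\<^sub>0 complex) \<times> (('b + 'x) list \<Rightarrow>\<^sub>0 complex)) set \<Rightarrow>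
    (('b + 'x) list \<Rightarrow>\<^sub>0 complex) set"
  where "adjoin_ideal B X R =
    Idl\<^bsub>adjoin_free B X\<^esub>
      {u \<ominus>\<^bsub>adjoin_free B X\<^esub> v | u v. (u, v) \<in> coefficient_relations B X \<union> R}"

definition adjoin ::
  "(complex, 'b, 'm) module_scheme \<Rightarrow> 'x set \<Rightarrow>
    ((('b + 'x) list \<Rightarrow>\<^sub>0 complex) \<times> (('b + 'x) list \<Rightarrow>\<^sub>0 complex)) set \<Rightarrow>
    (complex, (('b + 'x) list \<Rightarrow>\<^sub>0 complex) set) module"
  where "adjoin B X R = quotient_algebra (adjoin_free B X) (adjoin_ideal B X R)"

definition adjoin_gen ::
  "(complex, 'b, 'm) module_scheme \<Rightarrow> 'x set \<Rightarrow>
    ((('b + 'x) list \<Rightarrow>\<^sub>0 complex) \<times> (('b + 'x) list \<Rightarrow>\<^sub>0 complex)) set \<Rightarrow>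
    'b + 'x \<Rightarrow> (('b + 'x) list \<Rightarrow>\<^sub>0 complex) set"
  where "adjoin_gen B X R g = adjoin_ideal B X R +>\<^bsub>adjoin_free B X\<^esub> letter g"


section \<open>The Brauer algebra\<close>

text \<open>\<open>Bot i\<close> is the vertex written as \<open>i\<close> with a bar.\<close>

datatype vertex = Top nat | Bot nat

type_synonym diagram = "vertex set set"

definition diagrams :: "nat \<Rightarrow> diagram set"
  where "diagrams n = {\<gamma>. partition_on (Top ` {1..n} \<union> Bot ` {1..n}) \<gamma> \<and> (\<forall>e \<in> \<gamma>. card e = 2)}"

text \<open>
  To compose \<open>\<gamma>\<close> and \<open>\<gamma>'\<close>, the bottom row of \<open>\<gamma>\<close> is identified with the top row of \<open>\<gamma>'\<close>;
  the result is the row of vertices \<open>Mid i\<close>.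
\<close>

datatype stack_vertex = Upper nat | Mid nat | Lower nat

fun stack_fst :: "vertex \<Rightarrow> stack_vertex"
  where "stack_fst (Top i) = Upper i" | "stack_fst (Bot i) = Mid i"

fun stack_snd :: "vertex \<Rightarrow> stack_vertex"
  where "stack_snd (Top i) = Mid i" | "stack_snd (Bot i) = Lower i"

fun stack_outer :: "vertex \<Rightarrow> stack_vertex"
  where "stack_outer (Top i) = Upper i" | "stack_outer (Bot i) = Lower i"

definition stack_components :: "nat \<Rightarrow> diagram \<Rightarrow> diagram \<Rightarrow> stack_vertex set set"
  where "stack_components n \<gamma> \<gamma>' =
    (Upper ` {1..n} \<union> Mid ` {1..n} \<union> Lower ` {1..n}) //
      {(u, v). {u, v} \<in> image stack_fst ` \<gamma> \<union> image stack_snd ` \<gamma>'}\<^sup>*"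

text \<open>
  In the stacked graph the middle vertices have degree 2 (counting multiplicities) and the
  other vertices have degree 1. So the loops are the components consisting of middle vertices
  only, and any other component is a path whose terminal vertices are its vertices in the
  outer rows.
\<close>

definition loops :: "nat \<Rightarrow> diagram \<Rightarrow> diagram \<Rightarrow> nat"
  where "loops n \<gamma> \<gamma>' = card {C \<in> stack_components n \<gamma> \<gamma>'. C \<subseteq> range Mid}"

definition diagram_comp :: "nat \<Rightarrow> diagram \<Rightarrow> diagram \<Rightarrow> diagram"
  where "diagram_comp n \<gamma> \<gamma>' =
    {stack_outer -` C | C. C \<in> stack_components n \<gamma> \<gamma>' \<and> \<not> C \<subseteq> range Mid}"

definition perm_diagram :: "nat \<Rightarrow> (nat \<Rightarrow> nat) \<Rightarrow> diagram"
  where "perm_diagram n s = {{Top (s m), Bot m} | m. m \<in> {1..n}}"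

definition cup_cap_diagram :: "nat \<Rightarrow> nat \<Rightarrow> diagram"
  where "cup_cap_diagram n k =
    {{Top k, Top (k + 1)}, {Bot k, Bot (k + 1)}} \<union> {{Top m, Bot m} | m. m \<in> {1..n} - {k, k + 1}}"

definition brauer_algebra :: "nat \<Rightarrow> complex \<Rightarrow> (complex, diagram \<Rightarrow>\<^sub>0 complex) module"
  where "brauer_algebra n N =
    based_algebra (diagrams n) (\<lambda>\<gamma> \<gamma>'. N ^ loops n \<gamma> \<gamma>') (diagram_comp n) (perm_diagram n id)"


section \<open>The affine Brauer algebra\<close>

datatype affine_gen = Y nat | W nat

definition affine_gens :: "nat \<Rightarrow> affine_gen set"
  where "affine_gens n = Y ` {1..n} \<union> W ` {1..}"

text \<open>
  The defining relations besides those of the Brauer algebra, for elements \<open>s k\<close>, \<open>sb k\<close>,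
  \<open>y k\<close>, \<open>w i\<close> of an algebra \<open>F\<close>.
\<close>

context
  fixes F :: "(complex, 'a, 'm) module_scheme" (structure)
begin

definition affine_brauer_relations ::
  "nat \<Rightarrow> (nat \<Rightarrow> 'a) \<Rightarrow> (nat \<Rightarrow> 'a) \<Rightarrow> (nat \<Rightarrow> 'a) \<Rightarrow> (nat \<Rightarrow> 'a) \<Rightarrow> ('a \<times> 'a) set"
  where "affine_brauer_relations n s sb y w =
      {(y k \<otimes> y l, y l \<otimes> y k) | k l. k \<in> {1..n} \<and> l \<in> {1..n}}
    \<union> {(w i \<otimes> a, a \<otimes> w i) | i a. 1 \<le> i \<and> a \<in> carrier F}
    \<union> {(s k \<otimes> y l, y l \<otimes> s k) | k l. 1 \<le> k \<and> k < n \<and> l \<in> {1..n} \<and> l \<noteq> k \<and> l \<noteq> k + 1}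
    \<union> {(sb k \<otimes> y l, y l \<otimes> sb k) | k l. 1 \<le> k \<and> k < n \<and> l \<in> {1..n} \<and> l \<noteq> k \<and> l \<noteq> k + 1}
    \<union> {(s k \<otimes> y k \<ominus> y (k + 1) \<otimes> s k, sb k \<ominus> \<one>) | k. 1 \<le> k \<and> k < n}
    \<union> {(s k \<otimes> y (k + 1) \<ominus> y k \<otimes> s k, \<one> \<ominus> sb k) | k. 1 \<le> k \<and> k < n}
    \<union> {(sb k \<otimes> (y k \<oplus> y (k + 1)), \<zero>) | k. 1 \<le> k \<and> k < n}
    \<union> {((y k \<oplus> y (k + 1)) \<otimes> sb k, \<zero>) | k. 1 \<le> k \<and> k < n}
    \<union> {(sb 1 \<otimes> y 1 [^] i \<otimes> sb 1, w i \<otimes> sb 1) | i::nat. 1 < n \<and> 1 \<le> i}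
    \<union> {((- 2) \<odot> w i, w (i - 1) \<oplus> (\<Oplus>j\<in>{1..i}. (- 1) ^ j \<odot> (w (i - j) \<otimes> w (j - 1)))) | i. odd i}"

definition affine_hecke_relations ::
  "nat \<Rightarrow> (nat \<Rightarrow> 'a) \<Rightarrow> (nat \<Rightarrow> 'a) \<Rightarrow> ('a \<times> 'a) set"
  where "affine_hecke_relations n s v =
      {(v k \<otimes> v l, v l \<otimes> v k) | k l. k \<in> {1..n} \<and> l \<in> {1..n}}
    \<union> {(s k \<otimes> v l, v l \<otimes> s k) | k l. 1 \<le> k \<and> k < n \<and> l \<in> {1..n} \<and> l \<noteq> k \<and> l \<noteq> k + 1}
    \<union> {(s k \<otimes> v k \<ominus> v (k + 1) \<otimes> s k, \<ominus> \<one>) | k. 1 \<le> k \<and> k < n}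
    \<union> {(s k \<otimes> v (k + 1) \<ominus> v k \<otimes> s k, \<one>) | k. 1 \<le> k \<and> k < n}"

end

definition brauer_s :: "nat \<Rightarrow> nat \<Rightarrow> diagram \<Rightarrow>\<^sub>0 complex"
  where "brauer_s n k = basis_elt (perm_diagram n (transpose k (k + 1)))"

definition brauer_sb :: "nat \<Rightarrow> nat \<Rightarrow> diagram \<Rightarrow>\<^sub>0 complex"
  where "brauer_sb n k = basis_elt (cup_cap_diagram n k)"

definition affine_brauer_rels ::
  "nat \<Rightarrow> complex \<Rightarrow>
    ((((diagram \<Rightarrow>\<^sub>0 complex) + affine_gen) list \<Rightarrow>\<^sub>0 complex) \<times>
     (((diagram \<Rightarrow>\<^sub>0 complex) + affine_gen) list \<Rightarrow>\<^sub>0 complex)) set"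
  where "affine_brauer_rels n N = (let F = adjoin_free (brauer_algebra n N) (affine_gens n) in
    affine_brauer_relations F n
      (\<lambda>k. letter (Inl (brauer_s n k)))
      (\<lambda>k. letter (Inl (brauer_sb n k)))
      (\<lambda>k. letter (Inr (Y k)))
      (\<lambda>i. if i = 0 then N \<odot>\<^bsub>F\<^esub> \<one>\<^bsub>F\<^esub> else letter (Inr (W i))))"

definition affine_brauer_algebra ::
  "nat \<Rightarrow> complex \<Rightarrow> (complex, (((diagram \<Rightarrow>\<^sub>0 complex) + affine_gen) list \<Rightarrow>\<^sub>0 complex) set) module"
  where "affine_brauer_algebra n N =
    adjoin (brauer_algebra n N) (affine_gens n) (affine_brauer_rels n N)"

definition affine_brauer_gen ::
  "nat \<Rightarrow> complex \<Rightarrow> (diagram \<Rightarrow>\<^sub>0 complex) + affine_gen \<Rightarrow>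
    (((diagram \<Rightarrow>\<^sub>0 complex) + affine_gen) list \<Rightarrow>\<^sub>0 complex) set"
  where "affine_brauer_gen n N =
    adjoin_gen (brauer_algebra n N) (affine_gens n) (affine_brauer_rels n N)"

abbreviation "ab_s n N k \<equiv> affine_brauer_gen n N (Inl (brauer_s n k))"
abbreviation "ab_sb n N k \<equiv> affine_brauer_gen n N (Inl (brauer_sb n k))"
abbreviation "ab_y n N k \<equiv> affine_brauer_gen n N (Inr (Y k))"
abbreviation "ab_w n N i \<equiv> affine_brauer_gen n N (Inr (W i))"


section \<open>The degenerate affine Hecke algebra\<close>

text \<open>The additional generator \<open>v\<^sub>k\<close> is indexed by the number \<open>k\<close> itself.\<close>

definition symmetric_s :: "nat \<Rightarrow> (nat \<Rightarrow> nat) \<Rightarrow>\<^sub>0 complex"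
  where "symmetric_s k = basis_elt (transpose k (k + 1))"

definition affine_hecke_rels ::
  "nat \<Rightarrow>
    (((((nat \<Rightarrow> nat) \<Rightarrow>\<^sub>0 complex) + nat) list \<Rightarrow>\<^sub>0 complex) \<times>
     ((((nat \<Rightarrow> nat) \<Rightarrow>\<^sub>0 complex) + nat) list \<Rightarrow>\<^sub>0 complex)) set"
  where "affine_hecke_rels n =
    affine_hecke_relations (adjoin_free (group_algebra (sym_group n)) {1..n}) n
      (\<lambda>k. letter (Inl (symmetric_s k)))
      (\<lambda>k. letter (Inr k))"

definition affine_hecke_algebra ::
  "nat \<Rightarrow> (complex, ((((nat \<Rightarrow> nat) \<Rightarrow>\<^sub>0 complex) + nat) list \<Rightarrow>\<^sub>0 complex) set) module"
  where "affine_hecke_algebra n =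
    adjoin (group_algebra (sym_group n)) {1..n} (affine_hecke_rels n)"

definition affine_hecke_gen ::
  "nat \<Rightarrow> ((nat \<Rightarrow> nat) \<Rightarrow>\<^sub>0 complex) + nat \<Rightarrow>
    ((((nat \<Rightarrow> nat) \<Rightarrow>\<^sub>0 complex) + nat) list \<Rightarrow>\<^sub>0 complex) set"
  where "affine_hecke_gen n =
    adjoin_gen (group_algebra (sym_group n)) {1..n} (affine_hecke_rels n)"

abbreviation "ah_s n k \<equiv> affine_hecke_gen n (Inl (symmetric_s k))"
abbreviation "ah_v n k \<equiv> affine_hecke_gen n (Inr k)"

text \<open>Only the values \<open>f 2, f 4, \<dots>\<close> of the parameter \<open>f\<close> matter.\<close>

definition prescribed_on_gens ::
  "nat \<Rightarrow> complex \<Rightarrow> (nat \<Rightarrow> complex) \<Rightarrow>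
    ((((diagram \<Rightarrow>\<^sub>0 complex) + affine_gen) list \<Rightarrow>\<^sub>0 complex) set \<Rightarrow>
     ((((nat \<Rightarrow> nat) \<Rightarrow>\<^sub>0 complex) + nat) list \<Rightarrow>\<^sub>0 complex) set) \<Rightarrow> bool"
  where "prescribed_on_gens n N f \<phi> \<longleftrightarrow>
    (\<forall>k. 1 \<le> k \<and> k < n \<longrightarrow> \<phi> (ab_s n N k) = ah_s n k) \<and>
    (\<forall>k. 1 \<le> k \<and> k < n \<longrightarrow> \<phi> (ab_sb n N k) = \<zero>\<^bsub>affine_hecke_algebra n\<^esub>) \<and>
    (\<forall>k \<in> {1..n}. \<phi> (ab_y n N k) = ah_v n k) \<and>
    (\<forall>i. even i \<and> 2 \<le> i \<longrightarrow>
      \<phi> (ab_w n N i) = f i \<odot>\<^bsub>affine_hecke_algebra n\<^esub> \<one>\<^bsub>affine_hecke_algebra n\<^esub>)"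

end

theory Submission
  imports Defs
begin

text \<open>
  If the \<open>\<bar>s\<^sub>k\<close> are set to \<open>0\<close> in the relations of \<open>A(n,N)\<close>, what remains are the relations of
  \<open>H(n)\<close>, with \<open>y\<^sub>k\<close> in place of \<open>v\<^sub>k\<close>, and the relations among the
  central elements \<open>w\<^sub>i\<close>. The latter express each \<open>w\<^sub>i\<close> with odd \<open>i\<close> by the preceding ones (the coefficient \<open>-2\<close> is invertible), so that scalars
  can be chosen freely for even \<open>i\<close> and are then forced for odd \<open>i\<close> (\<open>central_value\<close>).

  As both algebras are presented over an algebra of coefficients, namely \<open>B(n,N)\<close> and
  \<open>\<complex>[S(n)]\<close>, two facts about \<open>B(n,N)\<close> are needed besides the universal property of a presentation
  (\<open>presented_lift\<close>, \<open>presented_hom_unique\<close>, \<open>presented_surj\<close>).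
  First, sending a permutation diagram to its permutation and all other diagrams to \<open>0\<close> is a
  homomorphism \<open>B(n,N) \<rightarrow> \<complex>[S(n)]\<close> (\<open>brauer_to_group_alg_hom\<close>): products of permutation
  diagrams produce no loops, and a product with a factor that is not a permutation diagram is not a
  permutation diagram either. Secondly, a homomorphism that kills the \<open>\<bar>s\<^sub>k\<close> is determined by its values
  on the \<open>s\<^sub>k\<close> (\<open>brauer_hom_unique\<close>): adjacent transpositions generate \<open>S(n)\<close>, and every diagram
  that is not a permutation diagram is a product, without loops, in which \<open>\<bar>s\<^sub>1\<close> is a factor
  (\<open>horizontal_factor\<close>).

  For the defining ideal of \<open>A(n,N)\<close> to be generated by elements of the free algebra, the
  basis of \<open>B(n,N)\<close> must be closed under composition (\<open>diagram_comp_closed\<close>): a component of two stacked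
  diagrams that contains an outer vertex contains exactly two of them. This is derived
  from the action of the two involutions that exchange the ends of the edges of the
  two diagrams (\<open>involutions_orbit_ends\<close>). Associativity of \<open>B(n,N)\<close> is not used.
\<close>


section \<open>Complex associative algebras and their homomorphisms\<close>

text \<open>
  Unital associative algebras over the complex numbers. The scalars are those of the type
  \<^typ>\<open>complex\<close> and do not form a ring record, unlike in the locale \<^locale>\<open>module\<close>.
\<close>

locale complex_algebra = ring A for A :: "(complex, 'a, 'm) module_scheme" (structure) +
  assumes smult_closed [simp, intro]: "x \<in> carrier A \<Longrightarrow> c \<odot> x \<in> carrier A"
    and smult_l_distr: "x \<in> carrier A \<Longrightarrow> (c + d) \<odot> x = c \<odot> x \<oplus> d \<odot> x"
    and smult_r_distr: "x \<in> carrier A \<Longrightarrow> y \<in> carrier A \<Longrightarrow> c \<odot> (x \<oplus> y) = c \<odot> x \<oplus> c \<odot> y"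
    and smult_assoc: "x \<in> carrier A \<Longrightarrow> (c * d) \<odot> x = c \<odot> (d \<odot> x)"
    and smult_one: "x \<in> carrier A \<Longrightarrow> 1 \<odot> x = x"
    and smult_mult_left: "x \<in> carrier A \<Longrightarrow> y \<in> carrier A \<Longrightarrow> (c \<odot> x) \<otimes> y = c \<odot> (x \<otimes> y)"
    and smult_mult_right: "x \<in> carrier A \<Longrightarrow> y \<in> carrier A \<Longrightarrow> x \<otimes> (c \<odot> y) = c \<odot> (x \<otimes> y)"
begin

lemma smult_zero_left [simp]:
  assumes "x \<in> carrier A" shows "0 \<odot> x = \<zero>"
proof -
  have "0 \<odot> x \<oplus> 0 \<odot> x = 0 \<odot> x" using smult_l_distr[OF assms, of 0 0] by simp
  then show ?thesis using assms by (simp add: add.r_cancel_one')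
qed

lemma smult_zero_right [simp]: "c \<odot> \<zero> = \<zero>"
proof -
  have "c \<odot> \<zero> \<oplus> c \<odot> \<zero> = c \<odot> \<zero>" using smult_r_distr[of \<zero> \<zero> c] by simp
  then show ?thesis by (simp add: add.r_cancel_one')
qed

lemma minus_eq_zero_imp_eq:
  assumes "x \<in> carrier A" "y \<in> carrier A" "x \<ominus> y = \<zero>"
  shows "x = y"
proof -
  have "x = x \<ominus> y \<oplus> y" using assms(1,2) by (simp add: a_minus_def a_assoc l_neg)
  with assms show ?thesis by simp
qed

lemma smult_minus_one: "x \<in> carrier A \<Longrightarrow> (-1) \<odot> x = \<ominus> x"
  using smult_l_distr[of x "-1" 1] by (simp add: smult_one minus_equality)

lemma smult_eq_one_mult: "x \<in> carrier A \<Longrightarrow> c \<odot> x = (c \<odot> \<one>) \<otimes> x"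
  by (simp add: smult_mult_left)

lemma smult_cancel:
  assumes "c \<noteq> 0" "x \<in> carrier A" "y \<in> carrier A" "c \<odot> x = c \<odot> y"
  shows "x = y"
proof -
  have "(inverse c * c) \<odot> x = (inverse c * c) \<odot> y"
    using assms by (simp only: smult_assoc)
  with assms show ?thesis by (simp add: smult_one)
qed

lemma scalar_sum:
  "finite J \<Longrightarrow> (\<Oplus>j\<in>J. g j \<odot> \<one>) = (\<Sum>j\<in>J. g j) \<odot> \<one>"
  by (induction J rule: finite_induct) (auto simp: smult_l_distr)

end

lemma alg_homI:
  assumes "\<And>x. x \<in> carrier A \<Longrightarrow> h x \<in> carrier B"
    and "\<And>x y. x \<in> carrier A \<Longrightarrow> y \<in> carrier A \<Longrightarrow> h (x \<otimes>\<^bsub>A\<^esub> y) = h x \<otimes>\<^bsub>B\<^esub> h y"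
    and "\<And>x y. x \<in> carrier A \<Longrightarrow> y \<in> carrier A \<Longrightarrow> h (x \<oplus>\<^bsub>A\<^esub> y) = h x \<oplus>\<^bsub>B\<^esub> h y"
    and "h \<one>\<^bsub>A\<^esub> = \<one>\<^bsub>B\<^esub>"
    and "\<And>c x. x \<in> carrier A \<Longrightarrow> h (c \<odot>\<^bsub>A\<^esub> x) = c \<odot>\<^bsub>B\<^esub> h x"
  shows "h \<in> alg_hom A B"
  using assms by (auto simp: alg_hom_def ring_hom_def)

lemma alg_homD:
  assumes "h \<in> alg_hom A B"
  shows "x \<in> carrier A \<Longrightarrow> h x \<in> carrier B"
    and "x \<in> carrier A \<Longrightarrow> y \<in> carrier A \<Longrightarrow> h (x \<otimes>\<^bsub>A\<^esub> y) = h x \<otimes>\<^bsub>B\<^esub> h y"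
    and "x \<in> carrier A \<Longrightarrow> y \<in> carrier A \<Longrightarrow> h (x \<oplus>\<^bsub>A\<^esub> y) = h x \<oplus>\<^bsub>B\<^esub> h y"
    and "h \<one>\<^bsub>A\<^esub> = \<one>\<^bsub>B\<^esub>"
    and "x \<in> carrier A \<Longrightarrow> h (c \<odot>\<^bsub>A\<^esub> x) = c \<odot>\<^bsub>B\<^esub> h x"
  using assms by (auto simp: alg_hom_def ring_hom_def)

lemma alg_hom_comp:
  assumes "g \<in> alg_hom A B" "h \<in> alg_hom B C"
  shows "(\<lambda>x. h (g x)) \<in> alg_hom A C"
  by (rule alg_homI) (simp_all add: alg_homD[OF assms(1)] alg_homD[OF assms(2)])

context
  fixes A B h
  assumes A: "complex_algebra A" and B: "complex_algebra B" and h: "h \<in> alg_hom A B"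
begin

interpretation A: complex_algebra A by (rule A)
interpretation B: complex_algebra B by (rule B)

lemma alg_hom_ring_hom: "ring_hom_ring A B h"
  using h by (intro ring_hom_ringI2) (auto simp: alg_hom_def A.ring_axioms B.ring_axioms)

lemma alg_hom_zero: "h \<zero>\<^bsub>A\<^esub> = \<zero>\<^bsub>B\<^esub>"
  by (rule ring_hom_zero) (use h in \<open>auto simp: alg_hom_def A.ring_axioms B.ring_axioms\<close>)

lemma alg_hom_a_inv: "x \<in> carrier A \<Longrightarrow> h (\<ominus>\<^bsub>A\<^esub> x) = \<ominus>\<^bsub>B\<^esub> h x"
  using alg_homD[OF h] A.smult_minus_one[of x] B.smult_minus_one[of "h x"] by metis

lemma alg_hom_diff:
  "x \<in> carrier A \<Longrightarrow> y \<in> carrier A \<Longrightarrow> h (x \<ominus>\<^bsub>A\<^esub> y) = h x \<ominus>\<^bsub>B\<^esub> h y"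
  by (simp add: a_minus_def alg_homD[OF h] alg_hom_a_inv)

lemma alg_hom_pow:
  "x \<in> carrier A \<Longrightarrow> h (x [^]\<^bsub>A\<^esub> (k::nat)) = h x [^]\<^bsub>B\<^esub> k"
  by (induction k) (simp_all add: alg_homD[OF h])

lemma alg_hom_finsum:
  assumes "finite J" "\<And>j. j \<in> J \<Longrightarrow> u j \<in> carrier A"
  shows "h (finsum A u J) = (\<Oplus>\<^bsub>B\<^esub>j\<in>J. h (u j))"
  using assms
proof (induction J rule: finite_induct)
  case empty
  then show ?case by (simp add: alg_hom_zero)
next
  case (insert j J)
  then have "u \<in> J \<rightarrow> carrier A" "(\<lambda>j. h (u j)) \<in> J \<rightarrow> carrier B"
    by (auto simp: alg_homD[OF h])
  with insert show ?case
    by (simp add: alg_homD[OF h])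
qed

end


section \<open>Algebras with a basis\<close>

lemma lookup_scale [simp]:
  "Poly_Mapping.lookup (Poly_Mapping.map ((*) (a::complex)) p) k = a * Poly_Mapping.lookup p k"
  by (simp add: map.rep_eq when_def)

lemma keys_scale: "Poly_Mapping.keys (Poly_Mapping.map ((*) (a::complex)) p) \<subseteq> Poly_Mapping.keys p"
  by (auto simp: in_keys_iff)

lemma scale_single:
  "Poly_Mapping.map ((*) (a::complex)) (Poly_Mapping.single x b) = Poly_Mapping.single x (a * b)"
  by (rule poly_mapping_eqI) (simp add: lookup_single when_def)

lemma based_algebra_simps:
  "carrier (based_algebra X c m e) = {p. Poly_Mapping.keys p \<subseteq> X}"
  "one (based_algebra X c m e) = basis_elt e"
  "zero (based_algebra X c m e) = 0"
  "p \<oplus>\<^bsub>based_algebra X c m e\<^esub> q = p + q"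
  "a \<odot>\<^bsub>based_algebra X c m e\<^esub> p = Poly_Mapping.map ((*) a) p"
  by (simp_all add: based_algebra_def)

text \<open>
  In the sums defining a product, the supports may be replaced by larger finite sets. This is
  what makes bilinearity accessible.
\<close>

lemma based_mult_superset:
  assumes "finite S" "finite T" "Poly_Mapping.keys p \<subseteq> S" "Poly_Mapping.keys q \<subseteq> T"
  shows "p \<otimes>\<^bsub>based_algebra X c m e\<^esub> q =
    (\<Sum>x\<in>S. \<Sum>y\<in>T. Poly_Mapping.single (m x y)
      (Poly_Mapping.lookup p x * Poly_Mapping.lookup q y * c x y))"
proof -
  have "p \<otimes>\<^bsub>based_algebra X c m e\<^esub> q =
    (\<Sum>x\<in>Poly_Mapping.keys p. \<Sum>y\<in>Poly_Mapping.keys q. Poly_Mapping.single (m x y)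
      (Poly_Mapping.lookup p x * Poly_Mapping.lookup q y * c x y))"
    by (simp add: based_algebra_def)
  also have "\<dots> = (\<Sum>x\<in>Poly_Mapping.keys p. \<Sum>y\<in>T. Poly_Mapping.single (m x y)
      (Poly_Mapping.lookup p x * Poly_Mapping.lookup q y * c x y))"
    using assms by (intro sum.cong sum.mono_neutral_left refl) (auto simp: in_keys_iff)
  also have "\<dots> = (\<Sum>x\<in>S. \<Sum>y\<in>T. Poly_Mapping.single (m x y)
      (Poly_Mapping.lookup p x * Poly_Mapping.lookup q y * c x y))"
    using assms by (intro sum.mono_neutral_left) (auto simp: in_keys_iff)
  finally show ?thesis .
qed

lemma based_mult_single:
  "Poly_Mapping.single x a \<otimes>\<^bsub>based_algebra X c m e\<^esub> Poly_Mapping.single y b =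
    Poly_Mapping.single (m x y) (a * b * c x y)"
  by (subst based_mult_superset[of "{x}" "{y}"]) auto

lemma based_mult_add_left:
  "(p + p') \<otimes>\<^bsub>based_algebra X c m e\<^esub> q =
    p \<otimes>\<^bsub>based_algebra X c m e\<^esub> q + p' \<otimes>\<^bsub>based_algebra X c m e\<^esub> q"
proof -
  let ?S = "Poly_Mapping.keys p \<union> Poly_Mapping.keys p'"
  note [simp] = based_mult_superset[of ?S "Poly_Mapping.keys q"] keys_add
  show ?thesis
    by (simp add: lookup_add distrib_right single_add sum.distrib)
qed

lemma based_mult_add_right:
  "p \<otimes>\<^bsub>based_algebra X c m e\<^esub> (q + q') =
    p \<otimes>\<^bsub>based_algebra X c m e\<^esub> q + p \<otimes>\<^bsub>based_algebra X c m e\<^esub> q'"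
proof -
  let ?S = "Poly_Mapping.keys q \<union> Poly_Mapping.keys q'"
  note [simp] = based_mult_superset[of "Poly_Mapping.keys p" ?S] keys_add
  show ?thesis
    by (simp add: lookup_add distrib_right distrib_left single_add sum.distrib)
qed

lemma based_mult_zero [simp]:
  "0 \<otimes>\<^bsub>based_algebra X c m e\<^esub> q = 0" "p \<otimes>\<^bsub>based_algebra X c m e\<^esub> 0 = 0"
  by (simp_all add: based_algebra_def)

lemma based_mult_scale_left:
  "Poly_Mapping.map ((*) a) p \<otimes>\<^bsub>based_algebra X c m e\<^esub> q =
    Poly_Mapping.map ((*) a) (p \<otimes>\<^bsub>based_algebra X c m e\<^esub> q)"
  by (subst based_mult_superset[OF finite_keys finite_keys keys_scale order_refl],
      subst based_mult_superset[OF finite_keys finite_keys order_refl order_refl])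
     (rule poly_mapping_eqI,
      simp add: lookup_sum lookup_single when_def sum_distrib_left mult_ac if_distrib cong: if_cong)

lemma based_mult_scale_right:
  "p \<otimes>\<^bsub>based_algebra X c m e\<^esub> Poly_Mapping.map ((*) a) q =
    Poly_Mapping.map ((*) a) (p \<otimes>\<^bsub>based_algebra X c m e\<^esub> q)"
  by (subst based_mult_superset[OF finite_keys finite_keys order_refl keys_scale],
      subst based_mult_superset[OF finite_keys finite_keys order_refl order_refl])
     (rule poly_mapping_eqI,
      simp add: lookup_sum lookup_single when_def sum_distrib_left mult_ac if_distrib cong: if_cong)

lemma based_mult_closed:
  assumes "\<And>x y. x \<in> X \<Longrightarrow> y \<in> X \<Longrightarrow> m x y \<in> X"
    and "Poly_Mapping.keys p \<subseteq> X" "Poly_Mapping.keys q \<subseteq> X"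
  shows "Poly_Mapping.keys (p \<otimes>\<^bsub>based_algebra X c m e\<^esub> q) \<subseteq> X"
proof -
  have "p \<otimes>\<^bsub>based_algebra X c m e\<^esub> q =
    (\<Sum>x\<in>Poly_Mapping.keys p. \<Sum>y\<in>Poly_Mapping.keys q. Poly_Mapping.single (m x y)
      (Poly_Mapping.lookup p x * Poly_Mapping.lookup q y * c x y))"
    by (simp add: based_algebra_def)
  also have "Poly_Mapping.keys \<dots> \<subseteq> X"
    using assms by (force dest!: subsetD[OF keys_sum] split: if_splits)
  finally show ?thesis .
qed

text \<open>
  Every element with support in \<open>X\<close> is a sum of multiples of basis elements.
\<close>

lemma based_induct [consumes 1, case_names zero single add]:
  fixes p :: "'i \<Rightarrow>\<^sub>0 complex"
  assumes "Poly_Mapping.keys p \<subseteq> X" and "P 0"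
    and "\<And>x a. x \<in> X \<Longrightarrow> P (Poly_Mapping.single x a)"
    and "\<And>p q. Poly_Mapping.keys p \<subseteq> X \<Longrightarrow> Poly_Mapping.keys q \<subseteq> X \<Longrightarrow> P p \<Longrightarrow> P q \<Longrightarrow> P (p + q)"
  shows "P p"
proof -
  have *: "p = (\<Sum>x\<in>Poly_Mapping.keys p. Poly_Mapping.single x (Poly_Mapping.lookup p x))"
    by (rule poly_mapping_eqI) (auto simp: lookup_sum lookup_single when_def in_keys_iff)
  have "S \<subseteq> X \<Longrightarrow> P (\<Sum>x\<in>S. Poly_Mapping.single x (Poly_Mapping.lookup p x)) \<and>
      Poly_Mapping.keys (\<Sum>x\<in>S. Poly_Mapping.single x (Poly_Mapping.lookup p x)) \<subseteq> X"
    if "finite S" for S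
    using that
  proof (induction S rule: finite_induct)
    case empty
    then show ?case using assms(2) by simp
  next
    case (insert x S)
    then have "Poly_Mapping.keys (Poly_Mapping.single x (Poly_Mapping.lookup p x)) \<subseteq> X" by auto
    with insert show ?case
      by (auto intro!: assms(3,4) dest!: subsetD[OF keys_add])
  qed
  with assms(1) * show ?thesis by (metis finite_keys)
qed

text \<open>The structure constants are \<open>1\<close> here, so that only a monoid structure on \<open>X\<close> is needed.\<close>

lemma based_algebra_complex_algebra:
  assumes "e \<in> X" and "\<And>x y. x \<in> X \<Longrightarrow> y \<in> X \<Longrightarrow> m x y \<in> X"
    and "\<And>x y z. x \<in> X \<Longrightarrow> y \<in> X \<Longrightarrow> z \<in> X \<Longrightarrow> m (m x y) z = m x (m y z)"
    and "\<And>x. x \<in> X \<Longrightarrow> m e x = x" "\<And>x. x \<in> X \<Longrightarrow> m x e = x"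
  shows "complex_algebra (based_algebra X (\<lambda>_ _. 1) m e)" (is "complex_algebra ?A")
proof -
  note [simp] = based_algebra_simps
  have assoc: "p \<otimes>\<^bsub>?A\<^esub> q \<otimes>\<^bsub>?A\<^esub> r = p \<otimes>\<^bsub>?A\<^esub> (q \<otimes>\<^bsub>?A\<^esub> r)"
    if p: "Poly_Mapping.keys p \<subseteq> X" and q: "Poly_Mapping.keys q \<subseteq> X" and r: "Poly_Mapping.keys r \<subseteq> X" for p q r
    using p
  proof (induction p rule: based_induct)
    case (single x a)
    note x = this
    show ?case using q
    proof (induction q rule: based_induct)
      case (single y b)
      note y = this
      show ?case using r
      proof (induction r rule: based_induct)
        case (single z c)
        then show ?case using x y by (simp add: based_mult_single assms(3) mult.assoc)
      qed (simp_all add: based_mult_add_right)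
    qed (simp_all add: based_mult_add_right based_mult_add_left)
  qed (simp_all add: based_mult_add_left)
  have unit: "basis_elt e \<otimes>\<^bsub>?A\<^esub> p = p \<and> p \<otimes>\<^bsub>?A\<^esub> basis_elt e = p"
    if p: "Poly_Mapping.keys p \<subseteq> X" for p
    using p
  proof (induction p rule: based_induct)
    case (single x a)
    then show ?case using assms by (simp add: based_mult_single)
  qed (simp_all add: based_mult_add_left based_mult_add_right)
  have "abelian_group ?A"
  proof (rule abelian_groupI)
    fix p assume "p \<in> carrier ?A"
    then show "\<exists>q\<in>carrier ?A. q \<oplus>\<^bsub>?A\<^esub> p = \<zero>\<^bsub>?A\<^esub>"
      by (intro bexI[of _ "- p"]) auto
  qed (auto simp: add.assoc add.commute dest!: subsetD[OF keys_add])
  moreover have "Group.monoid ?A"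
    by (rule Group.monoid.intro) (use based_mult_closed[OF assms(2)] assms(1) assoc unit in auto)
  ultimately have "ring ?A"
    by (rule ringI) (simp_all add: based_mult_add_left based_mult_add_right)
  then show ?thesis
  proof (rule complex_algebra.intro, unfold_locales)
    show "c \<odot>\<^bsub>?A\<^esub> p \<in> carrier ?A" if "p \<in> carrier ?A" for c p
      using that by (auto dest!: subsetD[OF keys_scale])
  qed (simp_all add: based_mult_scale_left based_mult_scale_right,
       auto intro!: poly_mapping_eqI simp: lookup_add algebra_simps)
qed

lemma free_algebra_complex_algebra: "complex_algebra (free_algebra X)"
  unfolding free_algebra_def by (rule based_algebra_complex_algebra) auto


section \<open>Free algebras\<close>

text \<open>The value of a word in the algebra \<open>A\<close> when each letter \<open>x\<close> is replaced by \<open>g x\<close>.\<close>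

fun word_prod :: "('a, 'm) monoid_scheme \<Rightarrow> ('g \<Rightarrow> 'a) \<Rightarrow> 'g list \<Rightarrow> 'a"
  where "word_prod A g [] = \<one>\<^bsub>A\<^esub>"
  | "word_prod A g (x # w) = g x \<otimes>\<^bsub>A\<^esub> word_prod A g w"

text \<open>The linear extension of \<^const>\<open>word_prod\<close> to the free algebra.\<close>

definition free_lift :: "(complex, 'a, 'm) module_scheme \<Rightarrow> ('g \<Rightarrow> 'a) \<Rightarrow> ('g list \<Rightarrow>\<^sub>0 complex) \<Rightarrow> 'a"
  where "free_lift A g p =
    (\<Oplus>\<^bsub>A\<^esub>w\<in>Poly_Mapping.keys p. Poly_Mapping.lookup p w \<odot>\<^bsub>A\<^esub> word_prod A g w)"

lemma free_algebra_simps: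
  "carrier (free_algebra X) = {p. Poly_Mapping.keys p \<subseteq> lists X}"
  "one (free_algebra X) = basis_elt []"
  "zero (free_algebra X) = 0"
  "p \<oplus>\<^bsub>free_algebra X\<^esub> q = p + q"
  "a \<odot>\<^bsub>free_algebra X\<^esub> p = Poly_Mapping.map ((*) a) p"
  by (simp_all add: free_algebra_def based_algebra_simps)

lemma letter_closed: "x \<in> X \<Longrightarrow> letter x \<in> carrier (free_algebra X)"
  by (simp add: free_algebra_simps)

lemma free_algebra_induct [consumes 1, case_names zero one letter add smult]:
  assumes "p \<in> carrier (free_algebra X)" and "P \<zero>\<^bsub>free_algebra X\<^esub>" and "P \<one>\<^bsub>free_algebra X\<^esub>"
    and "\<And>x p. x \<in> X \<Longrightarrow> p \<in> carrier (free_algebra X) \<Longrightarrow> P p \<Longrightarrow> P (letter x \<otimes>\<^bsub>free_algebra X\<^esub> p)"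
    and "\<And>p q. p \<in> carrier (free_algebra X) \<Longrightarrow> q \<in> carrier (free_algebra X) \<Longrightarrow>
      P p \<Longrightarrow> P q \<Longrightarrow> P (p \<oplus>\<^bsub>free_algebra X\<^esub> q)"
    and "\<And>c p. p \<in> carrier (free_algebra X) \<Longrightarrow> P p \<Longrightarrow> P (c \<odot>\<^bsub>free_algebra X\<^esub> p)"
  shows "P p"
proof -
  from assms(1) have "Poly_Mapping.keys p \<subseteq> lists X"
    by (simp add: free_algebra_simps)
  then show ?thesis
  proof (induction p rule: based_induct)
    case zero
    then show ?case using assms(2) by (simp add: free_algebra_simps)
  next
    case (add p q)
    then show ?case using assms(5)[of p q] by (simp add: free_algebra_simps)
  next
    case (single w a)
    from single have "P (basis_elt w)"
    proof (induction w)
      case Nil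
      then show ?case using assms(3) by (simp add: free_algebra_simps)
    next
      case (Cons x w)
      then have "P (letter x \<otimes>\<^bsub>free_algebra X\<^esub> basis_elt w)"
        by (intro assms(4)) (auto simp: free_algebra_simps)
      then show ?case by (simp add: free_algebra_def based_mult_single)
    qed
    then have "P (a \<odot>\<^bsub>free_algebra X\<^esub> basis_elt w)"
      using single by (intro assms(6)) (auto simp: free_algebra_simps)
    then show ?case by (simp add: free_algebra_simps scale_single)
  qed
qed

context complex_algebra
begin

context
  fixes g :: "'g \<Rightarrow> 'a" and X
  assumes g: "g \<in> X \<rightarrow> carrier A"
begin

lemma word_prod_closed [simp]: "w \<in> lists X \<Longrightarrow> word_prod A g w \<in> carrier A"
  using g by (induction w) auto

lemma word_prod_append:
  "v \<in> lists X \<Longrightarrow> w \<in> lists X \<Longrightarrow>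
    word_prod A g (v @ w) = word_prod A g v \<otimes> word_prod A g w"
  by (induction v) (use g in \<open>auto simp: m_assoc Pi_iff\<close>)

lemma free_lift_superset:
  assumes "finite S" "Poly_Mapping.keys p \<subseteq> S" "S \<subseteq> lists X"
  shows "free_lift A g p = (\<Oplus>w\<in>S. Poly_Mapping.lookup p w \<odot> word_prod A g w)"
  unfolding free_lift_def using assms
  by (intro add.finprod_mono_neutral_cong_left) (auto simp: in_keys_iff subset_iff)

lemma free_lift_single:
  "w \<in> lists X \<Longrightarrow> free_lift A g (Poly_Mapping.single w a) = a \<odot> word_prod A g w"
  by (subst free_lift_superset[of "{w}"]) (auto simp: word_prod_closed)

lemma free_lift_add:
  assumes "Poly_Mapping.keys p \<subseteq> lists X" "Poly_Mapping.keys q \<subseteq> lists X"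
  shows "free_lift A g (p + q) = free_lift A g p \<oplus> free_lift A g q"
proof -
  let ?S = "Poly_Mapping.keys p \<union> Poly_Mapping.keys q"
  have S: "finite ?S" "?S \<subseteq> lists X" using assms by auto
  then have wS: "word_prod A g w \<in> carrier A" if "w \<in> ?S" for w
    using that word_prod_closed by blast
  then have wS: "word_prod A g w \<in> carrier A" if "w \<in> ?S" for w
    using that word_prod_closed by blast
  have "free_lift A g (p + q) = (\<Oplus>w\<in>?S. Poly_Mapping.lookup (p + q) w \<odot> word_prod A g w)"
    by (rule free_lift_superset) (use S keys_add[of p q] in auto)
  also have "\<dots> = (\<Oplus>w\<in>?S. Poly_Mapping.lookup p w \<odot> word_prod A g w
      \<oplus> Poly_Mapping.lookup q w \<odot> word_prod A g w)"
    using S wS by (intro finsum_cong') (auto simp: lookup_add smult_l_distr simp del: in_lists_conv_set Un_iff)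
  also have "\<dots> = (\<Oplus>w\<in>?S. Poly_Mapping.lookup p w \<odot> word_prod A g w)
      \<oplus> (\<Oplus>w\<in>?S. Poly_Mapping.lookup q w \<odot> word_prod A g w)"
    using S wS by (intro finsum_addf) (auto simp del: in_lists_conv_set Un_iff)
  also have "\<dots> = free_lift A g p \<oplus> free_lift A g q"
    using free_lift_superset[of ?S p] free_lift_superset[of ?S q] S by simp
  finally show ?thesis .
qed

lemma free_lift_zero [simp]: "free_lift A g 0 = \<zero>"
  by (simp add: free_lift_def)

lemma free_lift_closed:
  "Poly_Mapping.keys p \<subseteq> lists X \<Longrightarrow> free_lift A g p \<in> carrier A"
  unfolding free_lift_def by (intro finsum_closed) (blast intro: word_prod_closed smult_closed)

lemma free_lift_mult:
  assumes "Poly_Mapping.keys p \<subseteq> lists X" "Poly_Mapping.keys q \<subseteq> lists X"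
  shows "free_lift A g (p \<otimes>\<^bsub>free_algebra X\<^esub> q) = free_lift A g p \<otimes> free_lift A g q"
  using assms(1)
proof (induction p rule: based_induct)
  case zero
  then show ?case by (simp add: free_algebra_def free_lift_closed assms(2))
next
  case (add p p')
  have "Poly_Mapping.keys (r \<otimes>\<^bsub>free_algebra X\<^esub> q) \<subseteq> lists X"
    if "Poly_Mapping.keys r \<subseteq> lists X" for r
    using that assms(2) unfolding free_algebra_def by (intro based_mult_closed) auto
  with add assms(2) show ?case
    by (simp add: free_algebra_def based_mult_add_left free_lift_add free_lift_closed l_distr)
next
  case (single v a)
  note v = this
  show ?case using assms(2)
  proof (induction q rule: based_induct)
    case zero
    then show ?case using v by (simp add: free_algebra_def free_lift_closed)
  next
    case (add q q')
    have "Poly_Mapping.keys (Poly_Mapping.single v a \<otimes>\<^bsub>free_algebra X\<^esub> r) \<subseteq> lists X"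
      if "Poly_Mapping.keys r \<subseteq> lists X" for r
      using that v unfolding free_algebra_def by (intro based_mult_closed) auto
    with add v show ?case
      by (simp add: free_algebra_def based_mult_add_right free_lift_add free_lift_closed r_distr)
  next
    case (single w b)
    have "free_lift A g (Poly_Mapping.single v a \<otimes>\<^bsub>free_algebra X\<^esub> Poly_Mapping.single w b)
        = (a * b) \<odot> (word_prod A g v \<otimes> word_prod A g w)"
      using v single
      by (simp add: free_algebra_def based_mult_single free_lift_single word_prod_append)
    also have "\<dots> = (a \<odot> word_prod A g v) \<otimes> (b \<odot> word_prod A g w)"
      using v single by (simp add: smult_mult_left smult_mult_right mult.commute flip: smult_assoc)
    finally show ?case using v single by (simp only: free_lift_single)
  qed
qed

lemma free_lift_alg_hom: "free_lift A g \<in> alg_hom (free_algebra X) A"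
proof (rule alg_homI)
  fix c p assume "p \<in> carrier (free_algebra X)"
  then have p: "Poly_Mapping.keys p \<subseteq> lists X" by (simp add: free_algebra_simps)
  then show "free_lift A g (c \<odot>\<^bsub>free_algebra X\<^esub> p) = c \<odot> free_lift A g p"
    unfolding free_algebra_simps
  proof (induction p rule: based_induct)
    case (add p q)
    have "Poly_Mapping.map ((*) c) (p + q) = Poly_Mapping.map ((*) c) p + Poly_Mapping.map ((*) c) q"
      by (rule poly_mapping_eqI) (simp add: lookup_add distrib_left)
    moreover have "Poly_Mapping.keys (Poly_Mapping.map ((*) c) r) \<subseteq> lists X"
      if "Poly_Mapping.keys r \<subseteq> lists X" for r
      using that keys_scale[of c r] by simp
    ultimately show ?case
      using add by (simp add: free_lift_add smult_r_distr free_lift_closed)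
  next
    case (single w a)
    then show ?case by (simp add: scale_single free_lift_single smult_assoc word_prod_closed)
  next
    case zero
    have "Poly_Mapping.map ((*) c) 0 = (0 :: 'g list \<Rightarrow>\<^sub>0 complex)"
      by (rule poly_mapping_eqI) simp
    then show ?case by simp
  qed
qed (simp_all add: free_algebra_simps free_lift_closed free_lift_mult free_lift_add
      free_lift_single smult_one)

lemma free_lift_letter: "x \<in> X \<Longrightarrow> free_lift A g (letter x) = g x"
  using g by (simp add: free_lift_single smult_one Pi_iff)

end

end

lemma free_alg_hom_unique:
  assumes A: "complex_algebra A" and h: "h \<in> alg_hom (free_algebra X) A"
    and h': "h' \<in> alg_hom (free_algebra X) A" and eq: "\<And>x. x \<in> X \<Longrightarrow> h (letter x) = h' (letter x)"
    and p: "p \<in> carrier (free_algebra X)"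
  shows "h p = h' p"
  using p
  by (induction p rule: free_algebra_induct)
     (simp_all add: alg_homD[OF h] alg_homD[OF h'] eq letter_closed
       alg_hom_zero[OF free_algebra_complex_algebra A h]
       alg_hom_zero[OF free_algebra_complex_algebra A h'])


section \<open>Quotients and presentations\<close>

context complex_algebra
begin

context
  fixes I assumes I: "ideal I A"
begin

interpretation I: ideal I A by (rule I)

text \<open>An ideal of the ring is a subspace, since \<open>c \<odot> x = (c \<odot> \<one>) \<otimes> x\<close>.\<close>

lemma ideal_smult_closed: "x \<in> I \<Longrightarrow> c \<odot> x \<in> I"
  using smult_eq_one_mult[of x c] I.I_l_closed[of x "c \<odot> \<one>"] I.Icarr by simp

lemma coset_eqI:
  assumes "x \<in> carrier A" "y \<in> carrier A" "x \<ominus> y \<in> I"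
  shows "I +> x = I +> y"
  using assms quotient_eq_iff_same_a_r_cos[OF I, of x y] by simp

lemma coset_eqD:
  assumes "x \<in> carrier A" "y \<in> carrier A" "I +> x = I +> y"
  shows "x \<ominus> y \<in> I"
  using assms quotient_eq_iff_same_a_r_cos[OF I, of x y] by simp

lemma quotient_smult:
  assumes "x \<in> carrier A"
  shows "c \<odot>\<^bsub>quotient_algebra A I\<^esub> (I +> x) = I +> (c \<odot> x)"
proof -
  have *: "y \<in> carrier A \<and> I +> (c \<odot> y) = I +> (c \<odot> x)" if "y \<in> I +> x" for y
  proof -
    from that obtain i where i: "i \<in> I" "y = i \<oplus> x" by (auto simp: a_r_coset_def')
    then have i': "i \<in> carrier A" by (simp add: I.Icarr)
    have "c \<odot> y \<ominus> c \<odot> x = c \<odot> i"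
      using i i' assms by (simp add: smult_r_distr a_minus_def a_assoc r_neg)
    with i ideal_smult_closed[of i c] show ?thesis
      using i' assms coset_eqI[of "c \<odot> y" "c \<odot> x"] by simp
  qed
  have "x \<in> I +> x" using assms by (rule I.a_rcos_self)
  then have "(\<Union>y\<in>I +> x. I +> (c \<odot> y)) = I +> (c \<odot> x)"
    using * by blast
  then show ?thesis by (simp add: quotient_algebra_def)
qed

lemma quotient_carrier: "carrier (quotient_algebra A I) = (+>) I ` carrier A"
  by (auto simp: quotient_algebra_def FactRing_simps)

lemma quotient_simps:
  "x \<in> carrier A \<Longrightarrow> y \<in> carrier A \<Longrightarrow>
    (I +> x) \<otimes>\<^bsub>quotient_algebra A I\<^esub> (I +> y) = I +> (x \<otimes> y)"
  "x \<in> carrier A \<Longrightarrow> y \<in> carrier A \<Longrightarrow>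
    (I +> x) \<oplus>\<^bsub>quotient_algebra A I\<^esub> (I +> y) = I +> (x \<oplus> y)"
  "\<one>\<^bsub>quotient_algebra A I\<^esub> = I +> \<one>"
  by (simp_all add: quotient_algebra_def FactRing_def I.rcoset_mult_add I.a_rcos_sum)

lemma coset_alg_hom: "(+>) I \<in> alg_hom A (quotient_algebra A I)"
  by (rule alg_homI) (simp_all add: quotient_carrier quotient_simps quotient_smult)

lemma quotient_complex_algebra: "complex_algebra (quotient_algebra A I)"
proof -
  let ?Q = "quotient_algebra A I"
  interpret Q: ring "A Quot I" by (rule I.quotient_is_ring)
  have eqs: "carrier ?Q = carrier (A Quot I)" "monoid.mult ?Q = monoid.mult (A Quot I)"
    "one ?Q = one (A Quot I)" "zero ?Q = zero (A Quot I)" "add ?Q = add (A Quot I)"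
    by (simp_all add: quotient_algebra_def)
  have "abelian_group ?Q"
  proof (rule abelian_groupI, unfold eqs)
    fix x y z assume "x \<in> carrier (A Quot I)" "y \<in> carrier (A Quot I)" "z \<in> carrier (A Quot I)"
    then show "x \<oplus>\<^bsub>A Quot I\<^esub> y \<oplus>\<^bsub>A Quot I\<^esub> z = x \<oplus>\<^bsub>A Quot I\<^esub> (y \<oplus>\<^bsub>A Quot I\<^esub> z)"
      by (rule Q.a_assoc)
  next
    fix x y assume "x \<in> carrier (A Quot I)" "y \<in> carrier (A Quot I)"
    then show "x \<oplus>\<^bsub>A Quot I\<^esub> y = y \<oplus>\<^bsub>A Quot I\<^esub> x" by (rule Q.a_comm)
  next
    fix x assume "x \<in> carrier (A Quot I)"
    then show "\<exists>y\<in>carrier (A Quot I). y \<oplus>\<^bsub>A Quot I\<^esub> x = \<zero>\<^bsub>A Quot I\<^esub>"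
      using Q.a_inv_closed Q.l_neg by blast
  qed simp_all
  moreover have "Group.monoid ?Q"
    by (rule Group.monoid.intro) (simp_all add: eqs Q.m_assoc)
  ultimately have "ring ?Q"
    by (rule ringI) (simp_all add: eqs Q.l_distr Q.r_distr)
  then show ?thesis
    by (rule complex_algebra.intro, unfold_locales)
       (auto simp: quotient_carrier quotient_simps quotient_smult smult_one
         smult_l_distr smult_r_distr smult_assoc smult_mult_left smult_mult_right)
qed

lemma quotient_lift:
  assumes B: "complex_algebra B" and h: "h \<in> alg_hom A B" and ker: "\<And>x. x \<in> I \<Longrightarrow> h x = \<zero>\<^bsub>B\<^esub>"
  shows "\<exists>\<phi>\<in>alg_hom (quotient_algebra A I) B. \<forall>x\<in>carrier A. \<phi> (I +> x) = h x"
proof -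
  interpret B: complex_algebra B by (rule B)
  note alg = complex_algebra_axioms
  have eq: "h x = h y" if "x \<in> carrier A" "y \<in> carrier A" "I +> x = I +> y" for x y
  proof -
    have "h x \<ominus>\<^bsub>B\<^esub> h y = \<zero>\<^bsub>B\<^esub>"
      using ker[OF coset_eqD[OF that]] that(1,2) by (simp add: alg_hom_diff[OF alg B h])
    then show ?thesis by (rule B.minus_eq_zero_imp_eq[rotated 2]) (use that alg_homD(1)[OF h] in blast)+
  qed
  define \<phi> where "\<phi> C = h (SOME x. x \<in> carrier A \<and> I +> x = C)" for C
  have \<phi>: "\<phi> (I +> x) = h x" if "x \<in> carrier A" for x
    unfolding \<phi>_def by (rule someI2[of _ x]) (use that eq in blast)+
  have "\<phi> \<in> alg_hom (quotient_algebra A I) B"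
    by (rule alg_homI)
       (auto simp: quotient_carrier quotient_simps quotient_smult \<phi> alg_homD[OF h])
  with \<phi> show ?thesis by blast
qed

end

end

lemmas adjoin_free_induct [consumes 1, case_names zero one letter add smult] =
  free_algebra_induct[of _ "Inl ` carrier B \<union> Inr ` X"
    for B :: "(complex, 'b, 'm) module_scheme" and X, folded adjoin_free_def]

text \<open>
  The algebra \<open>adjoin B X R\<close> in a setting where its defining ideal is meaningful: all relations
  must lie in the free algebra \<open>F\<close>, because the ideal generated by a set that is not
  contained in the carrier is the universal set. For the relations that come from \<open>B\<close> this requires
  only that the carrier of \<open>B\<close> is closed under the operations.
\<close>

locale presentation =
  fixes B :: "(complex, 'b, 'm) module_scheme" and X :: "'x set"
    and R :: "((('b + 'x) list \<Rightarrow>\<^sub>0 complex) \<times> (('b + 'x) list \<Rightarrow>\<^sub>0 complex)) set"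
  assumes coefficients_closed:
      "\<And>a b. a \<in> carrier B \<Longrightarrow> b \<in> carrier B \<Longrightarrow> a \<oplus>\<^bsub>B\<^esub> b \<in> carrier B"
      "\<And>a b. a \<in> carrier B \<Longrightarrow> b \<in> carrier B \<Longrightarrow> a \<otimes>\<^bsub>B\<^esub> b \<in> carrier B"
      "\<And>c a. a \<in> carrier B \<Longrightarrow> c \<odot>\<^bsub>B\<^esub> a \<in> carrier B"
      "\<one>\<^bsub>B\<^esub> \<in> carrier B"
    and relations_closed: "R \<subseteq> carrier (adjoin_free B X) \<times> carrier (adjoin_free B X)"
begin

text \<open>\<open>F\<close> is the free algebra, \<open>P\<close> the presented algebra and \<open>quot\<close> the projection of \<open>F\<close> onto \<open>P\<close>.\<close>

abbreviation (input) "F \<equiv> adjoin_free B X"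
abbreviation (input) "P \<equiv> adjoin B X R"
abbreviation (input) "J \<equiv> adjoin_ideal B X R"
abbreviation (input) "rels \<equiv> coefficient_relations B X \<union> R"
abbreviation (input) "quot \<equiv> (+>\<^bsub>F\<^esub>) J"

lemma free_complex_algebra: "complex_algebra F"
  by (simp add: adjoin_free_def free_algebra_complex_algebra)

interpretation F: complex_algebra F by (rule free_complex_algebra)

lemma letters_closed:
  "b \<in> carrier B \<Longrightarrow> letter (Inl b) \<in> carrier F" "x \<in> X \<Longrightarrow> letter (Inr x) \<in> carrier F"
  by (auto simp: adjoin_free_def intro!: letter_closed)

lemma rels_closed: "rels \<subseteq> carrier F \<times> carrier F"
  using relations_closed
  by (auto simp: coefficient_relations_def Let_def coefficients_closed letters_closed)

lemma ideal_J: "ideal J F"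
  unfolding adjoin_ideal_def using rels_closed
  by (intro F.genideal_ideal) (auto intro!: F.minus_closed)

lemma presented_complex_algebra: "complex_algebra P"
  unfolding adjoin_def by (rule F.quotient_complex_algebra[OF ideal_J])

lemma quot_alg_hom: "quot \<in> alg_hom F P"
  unfolding adjoin_def by (rule F.coset_alg_hom[OF ideal_J])

lemma presented_carrier: "carrier P = quot ` carrier F"
  unfolding adjoin_def by (rule F.quotient_carrier[OF ideal_J])

lemma gen_eq: "adjoin_gen B X R g = quot (letter g)"
  by (simp add: adjoin_gen_def)

lemma gen_closed:
  "b \<in> carrier B \<Longrightarrow> adjoin_gen B X R (Inl b) \<in> carrier P"
  "x \<in> X \<Longrightarrow> adjoin_gen B X R (Inr x) \<in> carrier P"
  by (simp_all add: gen_eq presented_carrier letters_closed)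

text \<open>The defining relations hold in \<open>P\<close>.\<close>

lemma quot_rel:
  assumes "(u, v) \<in> rels" shows "quot u = quot v"
proof (rule F.coset_eqI[OF ideal_J])
  show uv: "u \<in> carrier F" "v \<in> carrier F" using assms rels_closed by auto
  have "{u \<ominus>\<^bsub>F\<^esub> v | u v. (u, v) \<in> rels} \<subseteq> J"
    unfolding adjoin_ideal_def using rels_closed by (intro F.genideal_self) auto
  with assms show "u \<ominus>\<^bsub>F\<^esub> v \<in> J" by blast
qed

text \<open>The universal property of \<open>P\<close>.\<close>

lemma presented_lift:
  assumes A: "complex_algebra A" and h: "h \<in> alg_hom F A"
    and rel: "\<And>u v. (u, v) \<in> rels \<Longrightarrow> h u = h v"
  shows "\<exists>\<phi>\<in>alg_hom P A. \<forall>p\<in>carrier F. \<phi> (quot p) = h p"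
  unfolding adjoin_def
proof (rule F.quotient_lift[OF ideal_J A h])
  interpret A: complex_algebra A by (rule A)
  have kernel_ideal: "ideal (a_kernel F A h) F"
    by (rule ring_hom_ring.kernel_is_ideal[OF alg_hom_ring_hom[OF free_complex_algebra A h]])
  have "J \<subseteq> a_kernel F A h"
    unfolding adjoin_ideal_def
  proof (rule F.genideal_minimal[OF kernel_ideal], rule subsetI)
    fix x assume "x \<in> {u \<ominus>\<^bsub>F\<^esub> v | u v. (u, v) \<in> rels}"
    then obtain u v where x: "x = u \<ominus>\<^bsub>F\<^esub> v" and uv: "(u, v) \<in> rels"
      by (elim CollectE exE conjE)
    have F: "u \<in> carrier F" "v \<in> carrier F" using subsetD[OF rels_closed uv] by simp_all
    have "h x = h u \<ominus>\<^bsub>A\<^esub> h v"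
      unfolding x by (rule alg_hom_diff[OF free_complex_algebra A h F])
    also have "\<dots> = \<zero>\<^bsub>A\<^esub>"
      unfolding rel[OF uv] using alg_homD(1)[OF h F(2)] by (simp add: a_minus_def A.r_neg)
    finally show "x \<in> a_kernel F A h"
      using F by (simp add: a_kernel_def' x)
  qed
  from subsetD[OF this] show "h x = \<zero>\<^bsub>A\<^esub>" if "x \<in> J" for x
    using that by (simp add: a_kernel_def')
qed

text \<open>
  The relations that come from \<open>B\<close> are respected as soon as the restriction to the letters
  from \<open>B\<close> is a homomorphism.
\<close>

lemma coefficient_relations_respected:
  assumes h: "h \<in> alg_hom F A" and h_coeff: "(\<lambda>b. h (letter (Inl b))) \<in> alg_hom B A"
    and uv: "(u, v) \<in> coefficient_relations B X"
  shows "h u = h v"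
  using uv unfolding coefficient_relations_def Let_def
  by (elim UnE CollectE exE conjE singletonE Pair_inject; hypsubst)
     (simp_all only: alg_homD[OF h] alg_homD[OF h_coeff] letters_closed)

lemma presented_hom_unique:
  assumes A: "complex_algebra A" and h: "h \<in> alg_hom P A" "h' \<in> alg_hom P A"
    and coeff: "\<And>b. b \<in> carrier B \<Longrightarrow> h (adjoin_gen B X R (Inl b)) = h' (adjoin_gen B X R (Inl b))"
    and gens: "\<And>x. x \<in> X \<Longrightarrow> h (adjoin_gen B X R (Inr x)) = h' (adjoin_gen B X R (Inr x))"
    and x: "x \<in> carrier P"
  shows "h x = h' x"
proof -
  from x obtain p where p: "p \<in> carrier F" "x = quot p" by (auto simp: presented_carrier)
  let ?h = "\<lambda>p. h (quot p)" and ?h' = "\<lambda>p. h' (quot p)"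
  have homs: "?h \<in> alg_hom F A" "?h' \<in> alg_hom F A"
    using alg_hom_comp[OF quot_alg_hom h(1)] alg_hom_comp[OF quot_alg_hom h(2)] .
  have letters: "?h (letter g) = ?h' (letter g)" if "g \<in> Inl ` carrier B \<union> Inr ` X" for g
    using that coeff[unfolded gen_eq] gens[unfolded gen_eq] by (elim UnE imageE) simp_all
  have "?h p = ?h' p"
    by (rule free_alg_hom_unique[OF A homs[unfolded adjoin_free_def] letters[unfolded adjoin_free_def]
          p(1)[unfolded adjoin_free_def], folded adjoin_free_def])
  with p show ?thesis by simp
qed

lemma coefficient_hom: "(\<lambda>b. adjoin_gen B X R (Inl b)) \<in> alg_hom B P"
proof (rule alg_homI)
  have rel: "quot u = quot v" if "(u, v) \<in> coefficient_relations B X" for u v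
    using quot_rel that by blast
  note simps = gen_eq alg_homD[OF quot_alg_hom] letters_closed
  show "adjoin_gen B X R (Inl (a \<otimes>\<^bsub>B\<^esub> b)) = adjoin_gen B X R (Inl a) \<otimes>\<^bsub>P\<^esub> adjoin_gen B X R (Inl b)"
    if "a \<in> carrier B" "b \<in> carrier B" for a b
  proof -
    have "(letter (Inl (a \<otimes>\<^bsub>B\<^esub> b)), letter (Inl a) \<otimes>\<^bsub>F\<^esub> letter (Inl b)) \<in> coefficient_relations B X"
      using that unfolding coefficient_relations_def Let_def by blast
    from rel[OF this] that show ?thesis by (simp add: simps)
  qed
  show "adjoin_gen B X R (Inl (a \<oplus>\<^bsub>B\<^esub> b)) = adjoin_gen B X R (Inl a) \<oplus>\<^bsub>P\<^esub> adjoin_gen B X R (Inl b)"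
    if "a \<in> carrier B" "b \<in> carrier B" for a b
  proof -
    have "(letter (Inl (a \<oplus>\<^bsub>B\<^esub> b)), letter (Inl a) \<oplus>\<^bsub>F\<^esub> letter (Inl b)) \<in> coefficient_relations B X"
      using that unfolding coefficient_relations_def Let_def by blast
    from rel[OF this] that show ?thesis by (simp add: simps)
  qed
  show "adjoin_gen B X R (Inl (c \<odot>\<^bsub>B\<^esub> a)) = c \<odot>\<^bsub>P\<^esub> adjoin_gen B X R (Inl a)"
    if "a \<in> carrier B" for c a
  proof -
    have "(letter (Inl (c \<odot>\<^bsub>B\<^esub> a)), c \<odot>\<^bsub>F\<^esub> letter (Inl a)) \<in> coefficient_relations B X"
      using that unfolding coefficient_relations_def Let_def by blast
    from rel[OF this] that show ?thesis by (simp add: simps)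
  qed
  have "(letter (Inl \<one>\<^bsub>B\<^esub>), \<one>\<^bsub>F\<^esub>) \<in> coefficient_relations B X"
    unfolding coefficient_relations_def Let_def by blast
  from rel[OF this] show "adjoin_gen B X R (Inl \<one>\<^bsub>B\<^esub>) = \<one>\<^bsub>P\<^esub>" by (simp add: simps)
qed (rule gen_closed)

text \<open>
  A homomorphism into \<open>P\<close> whose image contains the generators of \<open>P\<close> is surjective.
\<close>

lemma presented_surj:
  assumes A: "complex_algebra A" and h: "h \<in> alg_hom A P"
    and coeff: "\<And>b. b \<in> carrier B \<Longrightarrow> adjoin_gen B X R (Inl b) \<in> h ` carrier A"
    and gens: "\<And>x. x \<in> X \<Longrightarrow> adjoin_gen B X R (Inr x) \<in> h ` carrier A"
  shows "h ` carrier A = carrier P"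
proof
  interpret A: complex_algebra A by (rule A)
  interpret P: complex_algebra P by (rule presented_complex_algebra)
  show "h ` carrier A \<subseteq> carrier P" using alg_homD(1)[OF h] by auto
  have "quot p \<in> h ` carrier A" if "p \<in> carrier F" for p
    using that
  proof (induction p rule: adjoin_free_induct)
    case zero
    have "quot \<zero>\<^bsub>F\<^esub> = h \<zero>\<^bsub>A\<^esub>"
      by (simp add: alg_hom_zero[OF free_complex_algebra presented_complex_algebra quot_alg_hom]
          alg_hom_zero[OF A presented_complex_algebra h])
    then show ?case by auto
  next
    case one
    have "quot \<one>\<^bsub>F\<^esub> = h \<one>\<^bsub>A\<^esub>" by (simp add: alg_homD[OF quot_alg_hom] alg_homD[OF h])
    then show ?case by auto
  next
    case (letter x p)
    then obtain a b where a: "a \<in> carrier A" "quot (Poly_Mapping.single [x] 1) = h a"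
      and b: "b \<in> carrier A" "quot p = h b"
      using coeff gens unfolding gen_eq by blast
    have "letter x \<in> carrier F" using letter(1) letters_closed by auto
    then have "quot (letter x \<otimes>\<^bsub>F\<^esub> p) = h (a \<otimes>\<^bsub>A\<^esub> b)"
      using letter(2) a b by (simp add: alg_homD[OF quot_alg_hom] alg_homD[OF h])
    then show ?case using a b by auto
  next
    case (add p q)
    then obtain a b where a: "a \<in> carrier A" "quot p = h a" and b: "b \<in> carrier A" "quot q = h b"
      by blast
    then have "quot (p \<oplus>\<^bsub>F\<^esub> q) = h (a \<oplus>\<^bsub>A\<^esub> b)"
      using add(1,2) by (simp add: alg_homD[OF quot_alg_hom] alg_homD[OF h])
    then show ?case using a b by auto
  next
    case (smult c p)
    then obtain a where a: "a \<in> carrier A" "quot p = h a"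
      by blast
    then have "quot (c \<odot>\<^bsub>F\<^esub> p) = h (c \<odot>\<^bsub>A\<^esub> a)"
      using smult(1) by (simp add: alg_homD[OF quot_alg_hom] alg_homD[OF h])
    then show ?case using a by auto
  qed
  then show "carrier P \<subseteq> h ` carrier A" by (auto simp: presented_carrier)
qed

end


section \<open>Orbits of two involutions\<close>

text \<open>
  Let \<open>\<alpha>\<close> and \<open>\<beta>\<close> be involutions and \<open>\<rho> = \<beta> \<circ> \<alpha>\<close>. If \<open>\<beta> v = v\<close>, the orbit of \<open>v\<close> is the cycle
  \<open>c k = (\<rho> ^^ k) v\<close>, of some length \<open>m\<close>, on which \<open>\<beta>\<close> acts as \<open>k \<mapsto> m - k\<close> and \<open>\<alpha>\<close> as
  \<open>k \<mapsto> m - 1 - k\<close>, modulo \<open>m\<close>. Fixed points besides \<open>c 0 = v\<close> are the \<open>c k\<close> with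
  \<open>0 < k\<close> and \<open>2 * k = m\<close> or \<open>2 * k + 1 = m\<close>. As \<open>\<alpha> v \<noteq> v\<close> excludes \<open>m = 1\<close>, there is exactly
  one, namely \<open>c (m div 2)\<close>.
\<close>

lemma involutions_orbit_ends:
  fixes \<alpha> \<beta> :: "'a \<Rightarrow> 'a"
  assumes inv: "\<And>u. \<alpha> (\<alpha> u) = u" "\<And>u. \<beta> (\<beta> u) = u"
    and V: "finite V" "v \<in> V" "\<And>u. u \<in> V \<Longrightarrow> \<alpha> u \<in> V" "\<And>u. u \<in> V \<Longrightarrow> \<beta> u \<in> V"
    and v: "\<beta> v = v" "\<alpha> v \<noteq> v"
    and C: "v \<in> C" "\<And>u. u \<in> C \<Longrightarrow> \<alpha> u \<in> C" "\<And>u. u \<in> C \<Longrightarrow> \<beta> u \<in> C"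
    and C_least: "\<And>D. v \<in> D \<Longrightarrow> (\<And>u. u \<in> D \<Longrightarrow> \<alpha> u \<in> D \<and> \<beta> u \<in> D) \<Longrightarrow> C \<subseteq> D"
  shows "\<exists>w. w \<noteq> v \<and> {u \<in> C. \<alpha> u = u \<or> \<beta> u = u} = {v, w}"
proof -
  define \<rho> where "\<rho> = \<beta> \<circ> \<alpha>"
  define c where "c k = (\<rho> ^^ k) v" for k
  have c_0: "c 0 = v" and c_Suc: "c (Suc k) = \<beta> (\<alpha> (c k))" for k
    by (simp_all add: c_def \<rho>_def)
  have c_cancel: "c j = v" if "c (i + j) = c i" for i j
    using that
  proof (induction i)
    case (Suc i)
    then have "\<beta> (\<alpha> (c (i + j))) = \<beta> (\<alpha> (c i))" by (simp add: c_Suc)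
    then have "c (i + j) = c i" by (metis inv)
    then show ?case by (rule Suc.IH)
  qed (simp add: c_0)
  have "c k \<in> V" for k by (induction k) (simp_all add: c_0 c_Suc V)
  then have "\<not> inj c" using V(1) by (meson finite_imageD finite_subset image_subsetI infinite_UNIV_nat)
  then obtain i j where ij: "i < j" "c i = c j"
    by (metis injI linorder_neqE_nat)
  then have "0 < j - i \<and> c (j - i) = v" using c_cancel[of i "j - i"] by simp
  then have ex: "\<exists>m. 0 < m \<and> c m = v" by blast
  define m where "m = (LEAST m. 0 < m \<and> c m = v)"
  have m: "0 < m" "c m = v" using LeastI_ex[OF ex] unfolding m_def by auto
  have m_least: "c k \<noteq> v" if "0 < k" "k < m" for k
    using that not_less_Least[of k "\<lambda>m. 0 < m \<and> c m = v"] unfolding m_def by auto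
  have c_inj: "i = j" if "i < m" "j < m" "c i = c j" for i j
    using that
  proof (induction i j rule: linorder_wlog)
    case (le i j)
    then show ?case using c_cancel[of i "j - i"] m_least[of "j - i"] by fastforce
  qed simp
  have \<beta>_c: "\<beta> (c k) = c j" if "k + j = m" for k j
    using that
  proof (induction k arbitrary: j)
    case 0
    then show ?case by (simp add: c_0 v m)
  next
    case (Suc k)
    then have "\<beta> (c k) = \<beta> (\<alpha> (c j))" using Suc.IH[of "Suc j"] by (simp add: c_Suc)
    then show ?case unfolding c_Suc by (metis inv)
  qed
  have \<alpha>_c: "\<alpha> (c k) = c j" if "Suc (k + j) = m" for k j
    using \<beta>_c[of "Suc k" j] that by (simp add: c_Suc inv)
  have "C \<subseteq> c ` {..<m}"
  proof (rule C_least)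
    show "v \<in> c ` {..<m}" using m c_0 by (metis image_eqI lessThan_iff)
    fix u assume "u \<in> c ` {..<m}"
    then obtain k where k: "u = c k" "k < m" by auto
    have "\<alpha> u = c (m - Suc k)" using k \<alpha>_c[of k "m - Suc k"] by simp
    moreover have "\<beta> u = c (if k = 0 then 0 else m - k)"
      using k m \<beta>_c[of k "m - k"] by (simp add: c_0 v)
    ultimately show "\<alpha> u \<in> c ` {..<m} \<and> \<beta> u \<in> c ` {..<m}" using k m by simp
  qed
  moreover have "c k \<in> C" for k by (induction k) (simp_all add: c_0 c_Suc C)
  ultimately have C_eq: "C = c ` {..<m}" by auto
  have \<alpha>_fix: "\<alpha> (c k) = c k \<longleftrightarrow> 2 * k + 1 = m" if "k < m" for k
  proof -
    have "\<alpha> (c k) = c (m - Suc k)" using that \<alpha>_c[of k "m - Suc k"] by simp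
    then show ?thesis using c_inj[of "m - Suc k" k] that by fastforce
  qed
  have \<beta>_fix: "\<beta> (c k) = c k \<longleftrightarrow> k = 0 \<or> 2 * k = m" if "k < m" for k
  proof (cases "k = 0")
    case False
    have "\<beta> (c k) = c (m - k)" using that \<beta>_c[of k "m - k"] by simp
    then show ?thesis using c_inj[of "m - k" k] that False by fastforce
  qed (simp add: c_0 v)
  have "\<not> (\<alpha> (c 0) = c 0)" using v by (simp add: c_0)
  then have "m \<noteq> 1" using \<alpha>_fix[of 0] m by simp
  have half: "2 * k + 1 = m \<or> 2 * k = m \<longleftrightarrow> k = m div 2" for k :: nat by presburger
  have "{u \<in> C. \<alpha> u = u \<or> \<beta> u = u} = c ` {k. k < m \<and> (k = 0 \<or> 2 * k + 1 = m \<or> 2 * k = m)}"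
    unfolding C_eq using \<alpha>_fix \<beta>_fix by auto
  also have "{k. k < m \<and> (k = 0 \<or> 2 * k + 1 = m \<or> 2 * k = m)} = {0, m div 2}"
    unfolding half using m by auto
  finally have "{u \<in> C. \<alpha> u = u \<or> \<beta> u = u} = {v, c (m div 2)}" by (simp add: c_0)
  moreover have "c (m div 2) \<noteq> v" using m \<open>m \<noteq> 1\<close> by (intro m_least) auto
  ultimately show ?thesis by blast
qed

text \<open>
  For a set \<open>M\<close> of disjoint pairs, the involution that exchanges the two elements of each pair
  and fixes all elements outside \<open>\<Union> M\<close>.
\<close>

definition mate :: "'a set set \<Rightarrow> 'a \<Rightarrow> 'a"
  where "mate M u = (if u \<in> \<Union> M then SOME w. {u, w} \<in> M else u)"

context
  fixes M :: "'a set set"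
  assumes disj: "\<And>e e'. e \<in> M \<Longrightarrow> e' \<in> M \<Longrightarrow> e \<inter> e' \<noteq> {} \<Longrightarrow> e = e'"
    and pairs: "\<And>e. e \<in> M \<Longrightarrow> card e = 2"
begin

lemma mate_edge:
  assumes "u \<in> \<Union> M" shows "{u, mate M u} \<in> M" "mate M u \<noteq> u"
proof -
  obtain e where e: "e \<in> M" "u \<in> e" using assms by blast
  then obtain w where "e = {u, w}" using pairs[OF e(1)] by (auto simp: card_2_iff)
  with e have "\<exists>w. {u, w} \<in> M" by blast
  then show edge: "{u, mate M u} \<in> M" unfolding mate_def using assms by (auto intro: someI_ex)
  show "mate M u \<noteq> u" using pairs[OF edge] by auto
qed

lemma mate_eq:
  assumes "{u, w} \<in> M" shows "mate M u = w"
proof -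
  have "u \<in> \<Union> M" using assms by blast
  then have m: "{u, mate M u} \<in> M" "mate M u \<noteq> u" by (rule mate_edge)+
  then have "{u, w} = {u, mate M u}" using assms by (intro disj) auto
  with m(2) show ?thesis by (auto simp: doubleton_eq_iff)
qed

lemma mate_mate: "mate M (mate M u) = u"
proof (cases "u \<in> \<Union> M")
  case True
  then have "{mate M u, u} \<in> M" using mate_edge(1)[of u] by (simp add: insert_commute)
  then show ?thesis by (rule mate_eq)
qed (simp add: mate_def)

lemma mate_fixed_iff: "mate M u = u \<longleftrightarrow> u \<notin> \<Union> M"
  using mate_edge(2)[of u] by (auto simp: mate_def)

lemma edge_iff: "{u, w} \<in> M \<longleftrightarrow> w \<noteq> u \<and> w = mate M u"
proof (cases "u \<in> \<Union> M")
  case True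
  then show ?thesis using mate_edge[of u] mate_eq[of u w] by metis
next
  case False
  then have "{u, w} \<notin> M" by blast
  with False show ?thesis by (simp add: mate_def)
qed

end


section \<open>Composition of diagrams\<close>

text \<open>The vertices of the diagrams in \<^term>\<open>diagrams n\<close>.\<close>

definition vertices :: "nat \<Rightarrow> vertex set"
  where "vertices n = Top ` {1..n} \<union> Bot ` {1..n}"

text \<open>
  The vertices of the graph obtained by stacking two diagrams, and its adjacency relation, in
  terms of which \<^const>\<open>stack_components\<close> is defined.
\<close>

definition stack_vertices :: "nat \<Rightarrow> stack_vertex set"
  where "stack_vertices n = Upper ` {1..n} \<union> Mid ` {1..n} \<union> Lower ` {1..n}"

definition stack_edges :: "diagram \<Rightarrow> diagram \<Rightarrow> (stack_vertex \<times> stack_vertex) set"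
  where "stack_edges \<gamma> \<gamma>' = {(u, v). {u, v} \<in> image stack_fst ` \<gamma> \<union> image stack_snd ` \<gamma>'}"

lemma stack_components_eq:
  "stack_components n \<gamma> \<gamma>' = stack_vertices n // (stack_edges \<gamma> \<gamma>')\<^sup>*"
  by (simp add: stack_components_def stack_vertices_def stack_edges_def)

lemma stack_edges_rtrancl_sym: "(u, v) \<in> (stack_edges \<gamma> \<gamma>')\<^sup>* \<Longrightarrow> (v, u) \<in> (stack_edges \<gamma> \<gamma>')\<^sup>*"
  by (rule symD[OF sym_rtrancl]) (auto simp: sym_def stack_edges_def insert_commute)

lemma diagramsD:
  assumes "\<gamma> \<in> diagrams n"
  shows "\<Union> \<gamma> = vertices n"
    and "e \<in> \<gamma> \<Longrightarrow> e' \<in> \<gamma> \<Longrightarrow> e \<inter> e' \<noteq> {} \<Longrightarrow> e = e'"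
    and "e \<in> \<gamma> \<Longrightarrow> card e = 2"
proof -
  have p: "partition_on (vertices n) \<gamma>" and c: "\<forall>e\<in>\<gamma>. card e = 2"
    using assms by (auto simp: diagrams_def vertices_def)
  show "\<Union> \<gamma> = vertices n" using partition_onD1[OF p] by simp
  show "e \<in> \<gamma> \<Longrightarrow> e' \<in> \<gamma> \<Longrightarrow> e \<inter> e' \<noteq> {} \<Longrightarrow> e = e'"
    using partition_onD2[OF p] by (meson disjointD)
  show "e \<in> \<gamma> \<Longrightarrow> card e = 2" using c by blast
qed

lemma diagramsI:
  assumes "\<Union> \<gamma> = vertices n"
    and "\<And>e e'. e \<in> \<gamma> \<Longrightarrow> e' \<in> \<gamma> \<Longrightarrow> e \<inter> e' \<noteq> {} \<Longrightarrow> e = e'"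
    and "\<And>e. e \<in> \<gamma> \<Longrightarrow> card e = 2"
  shows "\<gamma> \<in> diagrams n"
  using assms by (force simp: diagrams_def partition_on_def vertices_def disjoint_def)

lemma inj_stack: "inj stack_fst" "inj stack_snd" "inj stack_outer"
proof -
  have "u = v" if "stack_fst u = stack_fst v" for u v using that by (cases u; cases v) auto
  moreover have "u = v" if "stack_snd u = stack_snd v" for u v using that by (cases u; cases v) auto
  moreover have "u = v" if "stack_outer u = stack_outer v" for u v using that by (cases u; cases v) auto
  ultimately show "inj stack_fst" "inj stack_snd" "inj stack_outer" by (auto intro: injI)
qed

lemma image_pairing:
  assumes "\<gamma> \<in> diagrams n" "inj f"
  shows "\<And>e e'. e \<in> image f ` \<gamma> \<Longrightarrow> e' \<in> image f ` \<gamma> \<Longrightarrow> e \<inter> e' \<noteq> {} \<Longrightarrow> e = e'"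
    and "\<And>e. e \<in> image f ` \<gamma> \<Longrightarrow> card e = 2"
    and "\<Union> (image f ` \<gamma>) = f ` vertices n"
proof -
  show "e = e'" if e: "e \<in> image f ` \<gamma>" "e' \<in> image f ` \<gamma>" "e \<inter> e' \<noteq> {}" for e e'
  proof -
    obtain d d' where d: "d \<in> \<gamma>" "d' \<in> \<gamma>" "e = f ` d" "e' = f ` d'" using e by blast
    then have "d \<inter> d' \<noteq> {}" using e(3) by (simp add: image_Int[OF assms(2), symmetric])
    with d show ?thesis using diagramsD(2)[OF assms(1)] by blast
  qed
  show "card e = 2" if "e \<in> image f ` \<gamma>" for e
    using that diagramsD(3)[OF assms(1)] assms(2)
    by (auto simp: card_image inj_on_subset)
  show "\<Union> (image f ` \<gamma>) = f ` vertices n"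
    using diagramsD(1)[OF assms(1)] by blast
qed

lemma stack_images:
  "stack_fst ` vertices n = Upper ` {1..n} \<union> Mid ` {1..n}"
  "stack_snd ` vertices n = Mid ` {1..n} \<union> Lower ` {1..n}"
  "stack_outer ` vertices n = Upper ` {1..n} \<union> Lower ` {1..n}"
  by (simp_all add: vertices_def image_Un image_image)

text \<open>
  The component of an outer vertex has exactly two outer vertices: it is an orbit of the
  involutions \<^term>\<open>mate (image stack_fst ` \<gamma>)\<close> and \<^term>\<open>mate (image stack_snd ` \<gamma>')\<close>. The first
  fixes the lower row and the second the upper row, while the middle vertices are moved by both.
\<close>

lemma component_ends:
  assumes \<gamma>: "\<gamma> \<in> diagrams n" "\<gamma>' \<in> diagrams n" and v: "v \<in> stack_outer ` vertices n"
  shows "\<exists>w. w \<noteq> v \<and> (stack_edges \<gamma> \<gamma>')\<^sup>* `` {v} \<inter> stack_outer ` vertices n = {v, w}"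
proof -
  define E where "E = stack_edges \<gamma> \<gamma>'"
  let ?M = "image stack_fst ` \<gamma>" and ?M' = "image stack_snd ` \<gamma>'"
  note M = image_pairing[OF \<gamma>(1) inj_stack(1)] and M' = image_pairing[OF \<gamma>(2) inj_stack(2)]
  define \<alpha> \<beta> where "\<alpha> = mate ?M" and "\<beta> = mate ?M'"
  have inv: "\<alpha> (\<alpha> u) = u" "\<beta> (\<beta> u) = u" for u
    unfolding \<alpha>_def \<beta>_def using mate_mate[OF M(1,2)] mate_mate[OF M'(1,2)] by blast+
  have fix\<alpha>: "\<alpha> u = u \<longleftrightarrow> u \<notin> Upper ` {1..n} \<union> Mid ` {1..n}" for u
    unfolding \<alpha>_def stack_images[symmetric] M(3)[symmetric] by (rule mate_fixed_iff[OF M(1,2)])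
  have fix\<beta>: "\<beta> u = u \<longleftrightarrow> u \<notin> Mid ` {1..n} \<union> Lower ` {1..n}" for u
    unfolding \<beta>_def stack_images[symmetric] M'(3)[symmetric] by (rule mate_fixed_iff[OF M'(1,2)])
  have E: "(u, w) \<in> E \<longleftrightarrow> w \<noteq> u \<and> (w = \<alpha> u \<or> w = \<beta> u)" for u w
  proof -
    have "{u, w} \<in> ?M \<longleftrightarrow> w \<noteq> u \<and> w = \<alpha> u"
      unfolding \<alpha>_def by (rule edge_iff[OF M(1,2)])
    moreover have "{u, w} \<in> ?M' \<longleftrightarrow> w \<noteq> u \<and> w = \<beta> u"
      unfolding \<beta>_def by (rule edge_iff[OF M'(1,2)])
    ultimately show ?thesis by (auto simp: E_def stack_edges_def)
  qed
  define V where "V = stack_vertices n"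
  have \<alpha>V: "\<alpha> u \<in> V" if "u \<in> V" for u
  proof (cases "\<alpha> u = u")
    case False
    have "\<alpha> (\<alpha> u) \<noteq> \<alpha> u" using False inv by metis
    then have "\<alpha> u \<in> Upper ` {1..n} \<union> Mid ` {1..n}" using fix\<alpha> by blast
    then show ?thesis by (auto simp: V_def stack_vertices_def)
  qed (use that in simp)
  have \<beta>V: "\<beta> u \<in> V" if "u \<in> V" for u
  proof (cases "\<beta> u = u")
    case False
    have "\<beta> (\<beta> u) \<noteq> \<beta> u" using False inv by metis
    then have "\<beta> u \<in> Mid ` {1..n} \<union> Lower ` {1..n}" using fix\<beta> by blast
    then show ?thesis by (auto simp: V_def stack_vertices_def)
  qed (use that in simp)
  have vV: "v \<in> V" and finV: "finite V" using v unfolding stack_images V_def stack_vertices_def by auto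
  define C where "C = E\<^sup>* `` {v}"
  have C: "\<alpha> u \<in> C" "\<beta> u \<in> C" if "u \<in> C" for u
  proof -
    have "(v, u) \<in> E\<^sup>*" using that by (simp add: C_def)
    moreover have "(u, \<alpha> u) \<in> E\<^sup>*" by (cases "\<alpha> u = u") (simp_all add: E r_into_rtrancl)
    moreover have "(u, \<beta> u) \<in> E\<^sup>*" by (cases "\<beta> u = u") (simp_all add: E r_into_rtrancl)
    ultimately show "\<alpha> u \<in> C" "\<beta> u \<in> C" unfolding C_def by (auto intro: rtrancl_trans)
  qed
  have vC: "v \<in> C" by (simp add: C_def)
  have least: "C \<subseteq> D" if D: "v \<in> D" "\<And>u. u \<in> D \<Longrightarrow> \<alpha> u \<in> D \<and> \<beta> u \<in> D" for D
  proof
    fix u assume "u \<in> C"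
    then have "(v, u) \<in> E\<^sup>*" by (simp add: C_def)
    then show "u \<in> D" by (induction rule: rtrancl_induct) (use D E in auto)
  qed
  have CV: "C \<subseteq> V" using vV \<alpha>V \<beta>V by (intro least) blast+
  have ends: "{u \<in> C. \<alpha> u = u \<or> \<beta> u = u} = C \<inter> stack_outer ` vertices n"
    unfolding stack_images fix\<alpha> fix\<beta> using CV unfolding V_def stack_vertices_def by auto
  have "\<exists>w. w \<noteq> v \<and> {u \<in> C. \<alpha> u = u \<or> \<beta> u = u} = {v, w}"
  proof (cases "\<beta> v = v")
    case True
    then have "\<alpha> v \<noteq> v" using v unfolding fix\<alpha> fix\<beta> stack_images by auto
    with True show ?thesis
      using involutions_orbit_ends[of \<alpha> \<beta> V v C, OF inv finV vV \<alpha>V \<beta>V _ _ vC C least] by blast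
  next
    case False
    then have "\<alpha> v = v" using v unfolding fix\<alpha> fix\<beta> stack_images by auto
    moreover have "C \<subseteq> D" if "v \<in> D" "\<And>u. u \<in> D \<Longrightarrow> \<beta> u \<in> D \<and> \<alpha> u \<in> D" for D
      using that by (intro least) blast+
    ultimately have "\<exists>w. w \<noteq> v \<and> {u \<in> C. \<beta> u = u \<or> \<alpha> u = u} = {v, w}"
      using involutions_orbit_ends[of \<beta> \<alpha> V v C, OF inv(2,1) finV vV \<beta>V \<alpha>V _ False vC C(2,1)] by blast
    then show ?thesis by (simp only: disj_commute)
  qed
  then show ?thesis unfolding ends by (simp add: C_def E_def)
qed


lemma stack_edges_closed:
  assumes "\<gamma> \<in> diagrams n" "\<gamma>' \<in> diagrams n" "(u, v) \<in> stack_edges \<gamma> \<gamma>'"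
  shows "v \<in> stack_vertices n"
proof -
  have "{u, v} \<in> image stack_fst ` \<gamma> \<or> {u, v} \<in> image stack_snd ` \<gamma>'"
    using assms(3) by (simp add: stack_edges_def)
  then have "v \<in> \<Union> (image stack_fst ` \<gamma>) \<or> v \<in> \<Union> (image stack_snd ` \<gamma>')"
    by (meson UnionI insertCI)
  then have "v \<in> stack_fst ` vertices n \<or> v \<in> stack_snd ` vertices n"
    by (simp only: image_pairing(3)[OF assms(1) inj_stack(1)] image_pairing(3)[OF assms(2) inj_stack(2)])
  then show ?thesis unfolding stack_images stack_vertices_def by (elim disjE) simp_all
qed

lemma component_subset:
  assumes "\<gamma> \<in> diagrams n" "\<gamma>' \<in> diagrams n" "u \<in> stack_vertices n"
  shows "(stack_edges \<gamma> \<gamma>')\<^sup>* `` {u} \<subseteq> stack_vertices n"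
proof
  fix v assume "v \<in> (stack_edges \<gamma> \<gamma>')\<^sup>* `` {u}"
  then have "(u, v) \<in> (stack_edges \<gamma> \<gamma>')\<^sup>*" by simp
  then show "v \<in> stack_vertices n"
    by (induction rule: rtrancl_induct) (use assms stack_edges_closed in blast)+
qed

lemma component_eq:
  assumes "v \<in> (stack_edges \<gamma> \<gamma>')\<^sup>* `` {u}"
  shows "(stack_edges \<gamma> \<gamma>')\<^sup>* `` {v} = (stack_edges \<gamma> \<gamma>')\<^sup>* `` {u}"
  using assms stack_edges_rtrancl_sym[of u v] by (auto intro: rtrancl_trans)

lemma outer_in_stack: "stack_outer u \<in> stack_vertices n \<longleftrightarrow> u \<in> vertices n"
  by (cases u) (auto simp: stack_vertices_def vertices_def)

lemma mid_or_outer: "u \<in> stack_vertices n \<Longrightarrow> u \<in> range Mid \<or> u \<in> stack_outer ` vertices n"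
  unfolding stack_images by (auto simp: stack_vertices_def)

lemma outer_not_mid: "stack_outer u \<notin> range Mid"
  by (cases u) auto

text \<open>The edges of \<open>\<gamma> \<circ> \<gamma>'\<close> are the traces of the components of outer vertices.\<close>

lemma diagram_comp_eq:
  assumes "\<gamma> \<in> diagrams n" "\<gamma>' \<in> diagrams n"
  shows "diagram_comp n \<gamma> \<gamma>' =
    (\<lambda>u. stack_outer -` ((stack_edges \<gamma> \<gamma>')\<^sup>* `` {stack_outer u})) ` vertices n" (is "_ = ?D ` _")
proof
  show "diagram_comp n \<gamma> \<gamma>' \<subseteq> ?D ` vertices n"
  proof
    fix e assume "e \<in> diagram_comp n \<gamma> \<gamma>'"
    then obtain x where x: "x \<in> stack_vertices n" "e = stack_outer -` ((stack_edges \<gamma> \<gamma>')\<^sup>* `` {x})"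
      and "\<not> (stack_edges \<gamma> \<gamma>')\<^sup>* `` {x} \<subseteq> range Mid"
      unfolding diagram_comp_def stack_components_eq by (auto elim!: quotientE)
    then obtain v where v: "v \<in> (stack_edges \<gamma> \<gamma>')\<^sup>* `` {x}" "v \<notin> range Mid" by blast
    then have "v \<in> stack_outer ` vertices n"
      using component_subset[OF assms x(1)] mid_or_outer by blast
    then obtain u where "u \<in> vertices n" "v = stack_outer u" by blast
    with component_eq[OF v(1)] x show "e \<in> ?D ` vertices n" by auto
  qed
  show "?D ` vertices n \<subseteq> diagram_comp n \<gamma> \<gamma>'"
  proof (rule image_subsetI)
    fix u assume u: "u \<in> vertices n"
    let ?C = "(stack_edges \<gamma> \<gamma>')\<^sup>* `` {stack_outer u}"
    have "?C \<in> stack_components n \<gamma> \<gamma>'"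
      unfolding stack_components_eq using u by (intro quotientI) (simp add: outer_in_stack)
    moreover have "\<not> ?C \<subseteq> range Mid" using outer_not_mid[of u] by blast
    ultimately show "?D u \<in> diagram_comp n \<gamma> \<gamma>'" unfolding diagram_comp_def by blast
  qed
qed

lemma diagram_comp_closed:
  assumes "\<gamma> \<in> diagrams n" "\<gamma>' \<in> diagrams n"
  shows "diagram_comp n \<gamma> \<gamma>' \<in> diagrams n"
proof (rule diagramsI)
  let ?C = "\<lambda>u. (stack_edges \<gamma> \<gamma>')\<^sup>* `` {stack_outer u}"
  have sub: "stack_outer -` ?C u \<subseteq> vertices n" if "u \<in> vertices n" for u
    using component_subset[OF assms] that outer_in_stack by blast
  show "\<Union> (diagram_comp n \<gamma> \<gamma>') = vertices n"
    unfolding diagram_comp_eq[OF assms] using sub by auto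
  show "e = e'" if e: "e \<in> diagram_comp n \<gamma> \<gamma>'" "e' \<in> diagram_comp n \<gamma> \<gamma>'" "e \<inter> e' \<noteq> {}" for e e'
  proof -
    obtain u where u1: "e = stack_outer -` ?C u"
      using e(1) unfolding diagram_comp_eq[OF assms] by (rule imageE)
    obtain u' where u2: "e' = stack_outer -` ?C u'"
      using e(2) unfolding diagram_comp_eq[OF assms] by (rule imageE)
    note u = u1 u2
    with e(3) obtain w where w: "stack_outer w \<in> ?C u" "stack_outer w \<in> ?C u'" by blast
    show ?thesis unfolding u component_eq[OF w(1), symmetric] component_eq[OF w(2), symmetric] ..
  qed
  show "card e = 2" if e: "e \<in> diagram_comp n \<gamma> \<gamma>'" for e
  proof -
    obtain u where u: "u \<in> vertices n" "e = stack_outer -` ?C u"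
      using e unfolding diagram_comp_eq[OF assms] by blast
    obtain w where w: "w \<noteq> stack_outer u" "?C u \<inter> stack_outer ` vertices n = {stack_outer u, w}"
      using component_ends[OF assms, of "stack_outer u"] u by blast
    then obtain w' where w': "w = stack_outer w'" by blast
    have "stack_outer ` e = ?C u \<inter> stack_outer ` vertices n"
      using sub[OF u(1)] unfolding u(2) by blast
    then have "card (stack_outer ` e) = 2" unfolding w(2) using w(1) by simp
    then show ?thesis using inj_stack(3) by (metis card_image inj_on_subset subset_UNIV)
  qed
qed

text \<open>
  A criterion for \<open>\<gamma> \<circ> \<gamma>' = \<delta>\<close> without loops. Suppose that \<open>\<phi>\<close> retracts the stacked vertices to the
  outer ones and maps each edge into an edge of \<open>\<delta>\<close>. Then a component is mapped into a single
  edge of \<open>\<delta>\<close>. If moreover each vertex is connected with its image, and the ends of each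
  edge of \<open>\<delta>\<close> are connected, then the components are the preimages of the edges of \<open>\<delta>\<close>.
\<close>

lemma diagram_comp_retraction:
  fixes \<phi> :: "stack_vertex \<Rightarrow> vertex"
  assumes \<gamma>: "\<gamma> \<in> diagrams n" "\<gamma>' \<in> diagrams n" and \<delta>: "\<delta> \<in> diagrams n"
    and range: "\<And>u. u \<in> stack_vertices n \<Longrightarrow> \<phi> u \<in> vertices n"
    and retract: "\<And>u. u \<in> vertices n \<Longrightarrow> \<phi> (stack_outer u) = u"
    and fst_edge: "\<And>e. e \<in> \<gamma> \<Longrightarrow> \<exists>d\<in>\<delta>. \<phi> ` stack_fst ` e \<subseteq> d"
    and snd_edge: "\<And>e. e \<in> \<gamma>' \<Longrightarrow> \<exists>d\<in>\<delta>. \<phi> ` stack_snd ` e \<subseteq> d"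
    and fibre: "\<And>u. u \<in> stack_vertices n \<Longrightarrow> (u, stack_outer (\<phi> u)) \<in> (stack_edges \<gamma> \<gamma>')\<^sup>*"
    and joined: "\<And>a b. {a, b} \<in> \<delta> \<Longrightarrow> (stack_outer a, stack_outer b) \<in> (stack_edges \<gamma> \<gamma>')\<^sup>*"
  shows "diagram_comp n \<gamma> \<gamma>' = \<delta>" "loops n \<gamma> \<gamma>' = 0"
proof -
  let ?R = "(stack_edges \<gamma> \<gamma>')\<^sup>*"
  have edge: "\<exists>d\<in>\<delta>. \<phi> u \<in> d \<and> \<phi> v \<in> d" if "(u, v) \<in> stack_edges \<gamma> \<gamma>'" for u v
  proof -
    from that consider e where "e \<in> \<gamma>" "{u, v} = stack_fst ` e" | e where "e \<in> \<gamma>'" "{u, v} = stack_snd ` e"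
      unfolding stack_edges_def by blast
    then obtain d where "d \<in> \<delta>" "\<phi> ` {u, v} \<subseteq> d"
      using fst_edge snd_edge by cases metis+
    then show ?thesis by auto
  qed
  have path: "\<phi> v \<in> d" if "(u, v) \<in> ?R" "\<phi> u \<in> d" "d \<in> \<delta>" for u v d
    using that
  proof (induction rule: rtrancl_induct)
    case (step v w)
    obtain d' where d': "d' \<in> \<delta>" "\<phi> v \<in> d'" "\<phi> w \<in> d'" using edge[OF step(2)] by blast
    moreover have "\<phi> v \<in> d" using step by blast
    ultimately have "d' = d" using diagramsD(2)[OF \<delta>] \<open>d \<in> \<delta>\<close> by blast
    with d' show ?case by simp
  qed
  have comp: "stack_outer -` (?R `` {stack_outer u}) = d" if d: "d \<in> \<delta>" "u \<in> d" for u d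
  proof
    have u: "u \<in> vertices n" using d diagramsD(1)[OF \<delta>] by blast
    show "stack_outer -` (?R `` {stack_outer u}) \<subseteq> d"
    proof
      fix v assume v: "v \<in> stack_outer -` (?R `` {stack_outer u})"
      have "stack_outer v \<in> stack_vertices n"
        using v u component_subset[OF \<gamma>, of "stack_outer u"] by (auto simp: outer_in_stack)
      then have "v \<in> vertices n" by (simp add: outer_in_stack)
      then show "v \<in> d" using path[of "stack_outer u" "stack_outer v" d] v u d by (simp add: retract)
    qed
    show "d \<subseteq> stack_outer -` (?R `` {stack_outer u})"
    proof
      fix v assume v: "v \<in> d"
      show "v \<in> stack_outer -` (?R `` {stack_outer u})"
      proof (cases "v = u")
        case False
        then have "d = {u, v}" using d v diagramsD(3)[OF \<delta> d(1)] by (auto simp: card_2_iff)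
        then show ?thesis using joined[of u v] d by simp
      qed simp
    qed
  qed
  show "diagram_comp n \<gamma> \<gamma>' = \<delta>"
  proof
    show "diagram_comp n \<gamma> \<gamma>' \<subseteq> \<delta>"
      unfolding diagram_comp_eq[OF \<gamma>] using comp diagramsD(1)[OF \<delta>] by blast
    show "\<delta> \<subseteq> diagram_comp n \<gamma> \<gamma>'"
    proof
      fix d assume d: "d \<in> \<delta>"
      then obtain u where u: "u \<in> d" using diagramsD(3)[OF \<delta> d] by fastforce
      then have "u \<in> vertices n" using d diagramsD(1)[OF \<delta>] by blast
      with comp[OF d u] show "d \<in> diagram_comp n \<gamma> \<gamma>'" unfolding diagram_comp_eq[OF \<gamma>] by blast
    qed
  qed
  have "\<not> C \<subseteq> range Mid" if C: "C \<in> stack_components n \<gamma> \<gamma>'" for C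
  proof -
    obtain u where u: "u \<in> stack_vertices n" "C = ?R `` {u}"
      using C unfolding stack_components_eq by (auto elim!: quotientE)
    then have "stack_outer (\<phi> u) \<in> C" using fibre by simp
    then show ?thesis using outer_not_mid by blast
  qed
  then have "{C \<in> stack_components n \<gamma> \<gamma>'. C \<subseteq> range Mid} = {}" by blast
  then show "loops n \<gamma> \<gamma>' = 0" by (simp only: loops_def card.empty)
qed


section \<open>Permutation diagrams\<close>

lemma perm_diagram_image: "perm_diagram n s = (\<lambda>m. {Top (s m), Bot m}) ` {1..n}"
  unfolding perm_diagram_def by auto

lemma perm_diagram_in_diagrams:
  assumes "s permutes {1..n}" shows "perm_diagram n s \<in> diagrams n"
proof (rule diagramsI)
  have "s ` {1..n} = {1..n}" using assms by (rule permutes_image)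
  then have "(\<lambda>m. Top (s m)) ` {1..n} = Top ` {1..n}" by (metis image_image)
  moreover have "\<Union> (perm_diagram n s) = (\<lambda>m. Top (s m)) ` {1..n} \<union> Bot ` {1..n}"
    unfolding perm_diagram_image by blast
  ultimately show "\<Union> (perm_diagram n s) = vertices n" by (simp add: vertices_def)
  show "e = e'" if "e \<in> perm_diagram n s" "e' \<in> perm_diagram n s" "e \<inter> e' \<noteq> {}" for e e'
    using that injD[OF permutes_inj[OF assms]] unfolding perm_diagram_image by auto
  show "card e = 2" if "e \<in> perm_diagram n s" for e
    using that unfolding perm_diagram_image by auto
qed

lemma perm_diagram_inj:
  assumes "s permutes {1..n}" "t permutes {1..n}" "perm_diagram n s = perm_diagram n t"
  shows "s = t"
proof
  fix m show "s m = t m"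
  proof (cases "m \<in> {1..n}")
    case True
    then have "{Top (s m), Bot m} \<in> perm_diagram n s"
      unfolding perm_diagram_image by blast
    then have "{Top (s m), Bot m} \<in> perm_diagram n t" by (simp only: assms(3))
    then show ?thesis unfolding perm_diagram_image by (auto simp: doubleton_eq_iff)
  next
    case False
    then show ?thesis using assms(1,2) by (simp add: permutes_not_in)
  qed
qed

text \<open>
  Renaming of the upper vertices by \<open>s\<close>. It acts on a diagram \<open>\<gamma>\<close> by taking the images of the
  edges.
\<close>

fun rename_top :: "(nat \<Rightarrow> nat) \<Rightarrow> vertex \<Rightarrow> vertex"
  where "rename_top s (Top i) = Top (s i)" | "rename_top s (Bot i) = Bot i"

lemma inj_rename_top: "inj s \<Longrightarrow> inj (rename_top s)"
proof (rule injI)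
  fix u v assume "inj s" "rename_top s u = rename_top s v"
  then show "u = v" by (cases u; cases v) (auto dest: injD)
qed

lemma rename_top_in_diagrams:
  assumes s: "s permutes {1..n}" and \<gamma>: "\<gamma> \<in> diagrams n"
  shows "image (rename_top s) ` \<gamma> \<in> diagrams n"
proof -
  note p = image_pairing[OF \<gamma> inj_rename_top[OF permutes_inj[OF s]]]
  have "rename_top s ` vertices n = Top ` s ` {1..n} \<union> Bot ` {1..n}"
    by (simp add: vertices_def image_Un image_image)
  also have "\<dots> = vertices n" by (simp only: permutes_image[OF s] vertices_def)
  finally show ?thesis using p by (intro diagramsI) simp_all
qed

text \<open>
  Multiplying by a permutation diagram from the left renames the upper vertices. The retraction
  sends a middle vertex to the upper vertex joined to it.
\<close>

lemma perm_diagram_comp: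
  assumes s: "s permutes {1..n}" and \<gamma>: "\<gamma> \<in> diagrams n"
  shows "diagram_comp n (perm_diagram n s) \<gamma> = image (rename_top s) ` \<gamma>"
    and "loops n (perm_diagram n s) \<gamma> = 0"
proof -
  define \<phi> where "\<phi> u = (case u of Upper i \<Rightarrow> Top i | Mid i \<Rightarrow> Top (s i) | Lower i \<Rightarrow> Bot i)" for u
  let ?E = "stack_edges (perm_diagram n s) \<gamma>" and ?\<delta> = "image (rename_top s) ` \<gamma>"
  have s_in: "s i \<in> {1..n}" if "i \<in> {1..n}" for i using permutes_in_image[OF s] that by blast
  have \<phi>_snd: "\<phi> (stack_snd u) = rename_top s u" for u by (cases u) (simp_all add: \<phi>_def)
  have \<phi>_outer: "\<phi> (stack_outer u) = u" for u by (cases u) (simp_all add: \<phi>_def)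
  have mid: "(Mid i, Upper (s i)) \<in> ?E" if "i \<in> {1..n}" for i
  proof -
    have "stack_fst ` {Top (s i), Bot i} \<in> image stack_fst ` perm_diagram n s"
      using that unfolding perm_diagram_image by blast
    then show ?thesis by (simp add: stack_edges_def insert_commute)
  qed
  have fibre: "(u, stack_outer (\<phi> u)) \<in> ?E\<^sup>*" if "u \<in> stack_vertices n" for u
    using that mid by (cases u) (auto simp: \<phi>_def stack_vertices_def)
  have snd_in: "stack_snd u \<in> stack_vertices n" if "u \<in> vertices n" for u
    using that by (auto simp: vertices_def stack_vertices_def)
  note \<delta> = rename_top_in_diagrams[OF s \<gamma>]
  have range: "\<phi> u \<in> vertices n" if "u \<in> stack_vertices n" for u
    using that s_in by (auto simp: \<phi>_def stack_vertices_def vertices_def)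
  have fst_edge: "\<exists>d\<in>?\<delta>. \<phi> ` stack_fst ` e \<subseteq> d" if e: "e \<in> perm_diagram n s" for e
  proof -
    obtain m where m: "m \<in> {1..n}" "e = {Top (s m), Bot m}"
      using e unfolding perm_diagram_image by blast
    then have "Top (s m) \<in> vertices n" using s_in by (auto simp: vertices_def)
    then obtain d where "d \<in> ?\<delta>" "Top (s m) \<in> d" using diagramsD(1)[OF \<delta>] by blast
    with m show ?thesis by (intro bexI[of _ d]) (auto simp: \<phi>_def)
  qed
  have snd_edge: "\<exists>d\<in>?\<delta>. \<phi> ` stack_snd ` e \<subseteq> d" if "e \<in> \<gamma>" for e
    using that by (intro bexI[of _ "rename_top s ` e"]) (auto simp: \<phi>_snd)
  have joined: "(stack_outer a, stack_outer b) \<in> ?E\<^sup>*" if ab: "{a, b} \<in> ?\<delta>" for a b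
  proof -
    obtain e where e: "e \<in> \<gamma>" "{a, b} = rename_top s ` e" using ab by blast
    then obtain x y where xy: "x \<in> e" "y \<in> e" "a = rename_top s x" "b = rename_top s y" by blast
    have "(stack_snd x, stack_snd y) \<in> ?E\<^sup>*"
    proof (cases "x = y")
      case False
      then have "e = {x, y}" using xy(1,2) diagramsD(3)[OF \<gamma> e(1)] by (auto simp: card_2_iff)
      then have "stack_snd ` {x, y} \<in> image stack_snd ` \<gamma>" using e by blast
      then show ?thesis by (intro r_into_rtrancl) (simp add: stack_edges_def)
    qed simp
    moreover have "x \<in> vertices n" "y \<in> vertices n" using xy e(1) diagramsD(1)[OF \<gamma>] by blast+
    then have "(stack_snd x, stack_outer a) \<in> ?E\<^sup>*" "(stack_snd y, stack_outer b) \<in> ?E\<^sup>*"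
      using fibre[OF snd_in] xy(3,4) by (simp_all add: \<phi>_snd)
    ultimately show ?thesis using stack_edges_rtrancl_sym by (meson rtrancl_trans)
  qed
  show "diagram_comp n (perm_diagram n s) \<gamma> = ?\<delta>"
    by (rule diagram_comp_retraction[where \<phi> = \<phi>, OF perm_diagram_in_diagrams[OF s] \<gamma> \<delta> range \<phi>_outer
          fst_edge snd_edge fibre joined])
  show "loops n (perm_diagram n s) \<gamma> = 0"
    by (rule diagram_comp_retraction[where \<phi> = \<phi>, OF perm_diagram_in_diagrams[OF s] \<gamma> \<delta> range \<phi>_outer
          fst_edge snd_edge fibre joined])
qed

lemma rename_top_perm_diagram:
  "image (rename_top s) ` perm_diagram n t = perm_diagram n (s \<circ> t)"
  by (simp add: perm_diagram_image image_image)

lemma perm_diagram_comp_perm: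
  assumes "s permutes {1..n}" "t permutes {1..n}"
  shows "diagram_comp n (perm_diagram n s) (perm_diagram n t) = perm_diagram n (s \<circ> t)"
  by (simp add: perm_diagram_comp(1)[OF assms(1) perm_diagram_in_diagrams[OF assms(2)]]
      rename_top_perm_diagram)


section \<open>Diagrams with horizontal edges\<close>

lemma diagram_edge:
  assumes "\<gamma> \<in> diagrams n" "u \<in> vertices n"
  obtains w where "{u, w} \<in> \<gamma>" "w \<noteq> u" "w \<in> vertices n"
proof -
  obtain e where e: "e \<in> \<gamma>" "u \<in> e" using assms diagramsD(1) by blast
  have "card e = 2" using diagramsD(3)[OF assms(1) e(1)] .
  then obtain w where w: "e = {u, w}" "w \<noteq> u" using e(2) by (auto simp: card_2_iff)
  have "w \<in> vertices n" using diagramsD(1)[OF assms(1)] e(1) w(1) by blast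
  with e w show ?thesis using that by blast
qed

lemma diagrams_subset_eq:
  assumes "\<gamma> \<in> diagrams n" "\<gamma>' \<in> diagrams n" "\<gamma> \<subseteq> \<gamma>'"
  shows "\<gamma> = \<gamma>'"
proof
  show "\<gamma>' \<subseteq> \<gamma>"
  proof
    fix e assume e: "e \<in> \<gamma>'"
    obtain u where u: "u \<in> e" using diagramsD(3)[OF assms(2) e] by fastforce
    then have "u \<in> \<Union> \<gamma>" using e diagramsD(1)[OF assms(1)] diagramsD(1)[OF assms(2)] by blast
    then obtain d where d: "d \<in> \<gamma>" "u \<in> d" by blast
    have "e = d" using diagramsD(2)[OF assms(2) e, of d] d u assms(3) by blast
    with d show "e \<in> \<gamma>" by simp
  qed
qed (rule assms(3))

lemma top_edge_not_perm: "{Top a, Top b} \<notin> perm_diagram n s"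
  unfolding perm_diagram_image by (auto simp: doubleton_eq_iff)

text \<open>
  A diagram without horizontal edges in the lower row is a permutation diagram; if it has one,
  then it has one in the upper row as well, because the rows have the same size.
\<close>

lemma diagram_cases:
  assumes \<gamma>: "\<gamma> \<in> diagrams n"
  obtains (perm) s where "s permutes {1..n}" "\<gamma> = perm_diagram n s"
  | (horizontal) a b c d where "{Top a, Top b} \<in> \<gamma>" "{Bot c, Bot d} \<in> \<gamma>"
proof (cases "\<exists>c d. {Bot c, Bot d} \<in> \<gamma>")
  case False
  have "\<exists>j\<in>{1..n}. {Top j, Bot m} \<in> \<gamma>" if m: "m \<in> {1..n}" for m
  proof -
    have "Bot m \<in> vertices n" using m by (simp add: vertices_def)
    then obtain w where w: "{Bot m, w} \<in> \<gamma>" "w \<in> vertices n" using diagram_edge[OF \<gamma>] by metis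
    with False obtain j where "w = Top j" by (cases w) auto
    with w show ?thesis by (intro bexI[of _ j]) (auto simp: vertices_def insert_commute)
  qed
  then obtain s0 where s0: "\<And>m. m \<in> {1..n} \<Longrightarrow> s0 m \<in> {1..n} \<and> {Top (s0 m), Bot m} \<in> \<gamma>" by metis
  define s where "s m = (if m \<in> {1..n} then s0 m else m)" for m
  have s: "s m \<in> {1..n}" "{Top (s m), Bot m} \<in> \<gamma>" if "m \<in> {1..n}" for m
    using s0[OF that] that by (simp_all add: s_def)
  have "inj_on s {1..n}"
  proof (rule inj_onI)
    fix l m assume "l \<in> {1..n}" "m \<in> {1..n}" "s l = s m"
    then have "{Top (s m), Bot l} = {Top (s m), Bot m}"
      using s(2)[of l] s(2)[of m] by (intro diagramsD(2)[OF \<gamma>]) auto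
    then show "l = m" by (auto simp: doubleton_eq_iff)
  qed
  moreover have "s ` {1..n} \<subseteq> {1..n}" using s(1) by blast
  ultimately have "bij_betw s {1..n} {1..n}"
    by (simp add: bij_betw_def endo_inj_surj)
  then have perm: "s permutes {1..n}" by (rule bij_imp_permutes) (auto simp: s_def)
  have "perm_diagram n s \<subseteq> \<gamma>" unfolding perm_diagram_image using s(2) by blast
  then have "perm_diagram n s = \<gamma>" by (rule diagrams_subset_eq[OF perm_diagram_in_diagrams[OF perm] \<gamma>])
  then show ?thesis using that(1)[OF perm] by simp
next
  case True
  then obtain c d where cd: "{Bot c, Bot d} \<in> \<gamma>" by blast
  have "\<exists>a b. {Top a, Top b} \<in> \<gamma>"
  proof (rule ccontr)
    assume no: "\<not> ?thesis"
    have "\<exists>j\<in>{1..n}. {Top m, Bot j} \<in> \<gamma>" if m: "m \<in> {1..n}" for m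
    proof -
      have "Top m \<in> vertices n" using m by (simp add: vertices_def)
      then obtain w where w: "{Top m, w} \<in> \<gamma>" "w \<in> vertices n" using diagram_edge[OF \<gamma>] by metis
      with no obtain j where "w = Bot j" by (cases w) auto
      with w show ?thesis by (intro bexI[of _ j]) (auto simp: vertices_def)
    qed
    then obtain t where t: "\<And>m. m \<in> {1..n} \<Longrightarrow> t m \<in> {1..n}"
      "\<And>m. m \<in> {1..n} \<Longrightarrow> {Top m, Bot (t m)} \<in> \<gamma>" by metis
    have "inj_on t {1..n}"
    proof (rule inj_onI)
      fix l m assume "l \<in> {1..n}" "m \<in> {1..n}" "t l = t m"
      then have "{Top l, Bot (t m)} = {Top m, Bot (t m)}"
        using t(2)[of l] t(2)[of m] by (intro diagramsD(2)[OF \<gamma>]) auto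
      then show "l = m" by (auto simp: doubleton_eq_iff)
    qed
    moreover have "t ` {1..n} \<subseteq> {1..n}" using t(1) by blast
    ultimately have surj: "t ` {1..n} = {1..n}" by (simp add: endo_inj_surj)
    have "Bot c \<in> vertices n" using cd diagramsD(1)[OF \<gamma>] by blast
    then have "c \<in> t ` {1..n}" unfolding surj by (auto simp: vertices_def)
    then obtain m where m: "m \<in> {1..n}" "c = t m" by blast
    then have "{Bot c, Bot d} = {Top m, Bot c}"
      using t(2)[OF m(1)] cd by (intro diagramsD(2)[OF \<gamma>]) auto
    then show False by (auto simp: doubleton_eq_iff)
  qed
  then show ?thesis using that(2) cd by blast
qed

text \<open>An edge in the upper row of the left factor is a whole component of the stacked graph.\<close>

lemma top_edge_comp:
  assumes \<gamma>: "\<gamma> \<in> diagrams n" "\<gamma>' \<in> diagrams n" and e: "{Top a, Top b} \<in> \<gamma>"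
  shows "{Top a, Top b} \<in> diagram_comp n \<gamma> \<gamma>'"
proof -
  let ?E = "stack_edges \<gamma> \<gamma>'"
  have ab: "Top a \<in> vertices n" using diagramsD(1)[OF \<gamma>(1)] e by blast
  have step: "v \<in> {Upper a, Upper b}" if "u \<in> {Upper a, Upper b}" "(u, v) \<in> ?E" for u v
  proof -
    from that(2) consider d where "d \<in> \<gamma>" "{u, v} = stack_fst ` d" | d where "d \<in> \<gamma>'" "{u, v} = stack_snd ` d"
      unfolding stack_edges_def by blast
    then show ?thesis
    proof cases
      case 1
      have "u \<in> stack_fst ` d \<inter> stack_fst ` {Top a, Top b}" using 1(2) that(1) by auto
      then have "d \<inter> {Top a, Top b} \<noteq> {}" unfolding image_Int[OF inj_stack(1), symmetric] by blast
      then have "d = {Top a, Top b}" by (rule diagramsD(2)[OF \<gamma>(1) 1(1) e])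
      with 1 show ?thesis by (auto simp: doubleton_eq_iff)
    next
      case 2
      have "u \<in> stack_snd ` d" using 2 by blast
      then obtain w where "u = stack_snd w" by blast
      with that(1) show ?thesis by (cases w) auto
    qed
  qed
  have "stack_fst ` {Top a, Top b} \<in> image stack_fst ` \<gamma>" using e by blast
  then have "(Upper a, Upper b) \<in> ?E" by (simp add: stack_edges_def)
  then have "?E\<^sup>* `` {Upper a} = {Upper a, Upper b}"
  proof (intro equalityI subsetI)
    fix v assume "v \<in> ?E\<^sup>* `` {Upper a}"
    then have "(Upper a, v) \<in> ?E\<^sup>*" by simp
    then show "v \<in> {Upper a, Upper b}"
      by (induction rule: rtrancl_induct) (use step in blast)+
  qed auto
  moreover have "stack_outer -` {Upper a, Upper b} = {Top a, Top b}"
  proof (rule Set.set_eqI)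
    show "u \<in> stack_outer -` {Upper a, Upper b} \<longleftrightarrow> u \<in> {Top a, Top b}" for u by (cases u) auto
  qed
  ultimately have "{Top a, Top b} = stack_outer -` (?E\<^sup>* `` {stack_outer (Top a)})" by simp
  then show ?thesis unfolding diagram_comp_eq[OF \<gamma>] using ab by blast
qed

lemma cup_cap_in_diagrams:
  assumes "1 \<le> k" "k < n" shows "cup_cap_diagram n k \<in> diagrams n"
proof (rule diagramsI)
  have eq: "cup_cap_diagram n k = {{Top k, Top (k + 1)}, {Bot k, Bot (k + 1)}} \<union>
    (\<lambda>m. {Top m, Bot m}) ` ({1..n} - {k, k + 1})"
    unfolding cup_cap_diagram_def by auto
  show "\<Union> (cup_cap_diagram n k) = vertices n"
    unfolding eq vertices_def using assms by auto
  show "e = e'" if "e \<in> cup_cap_diagram n k" "e' \<in> cup_cap_diagram n k" "e \<inter> e' \<noteq> {}" for e e'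
    using that unfolding eq by auto
  show "card e = 2" if "e \<in> cup_cap_diagram n k" for e
    using that unfolding eq by auto
qed

text \<open>
  A diagram with the edge \<open>{k, k + 1}\<close> in the upper row factors through \<open>cup_cap_diagram n k\<close>:
  in the right factor, the edge \<open>{k, k + 1}\<close> and an edge \<open>{c, d}\<close> of the lower row
  are replaced by two vertical edges. No loop arises.
\<close>

lemma cup_cap_factor:
  assumes k: "1 \<le> k" "k < n" and \<gamma>: "\<gamma> \<in> diagrams n"
    and top: "{Top k, Top (k + 1)} \<in> \<gamma>" and bot: "{Bot c, Bot d} \<in> \<gamma>"
  shows "\<exists>\<gamma>'\<in>diagrams n. diagram_comp n (cup_cap_diagram n k) \<gamma>' = \<gamma> \<and> loops n (cup_cap_diagram n k) \<gamma>' = 0"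
proof -
  define \<gamma>0 where "\<gamma>0 = \<gamma> - {{Top k, Top (k + 1)}, {Bot c, Bot d}}"
  define \<gamma>' where "\<gamma>' = insert {Top k, Bot c} (insert {Top (k + 1), Bot d} \<gamma>0)"
  have "c \<noteq> d" using diagramsD(3)[OF \<gamma> bot] by auto
  have avoid: "Top k \<notin> e" "Top (k + 1) \<notin> e" "Bot c \<notin> e" "Bot d \<notin> e" if "e \<in> \<gamma>0" for e
    using that diagramsD(2)[OF \<gamma> top, of e] diagramsD(2)[OF \<gamma> bot, of e] unfolding \<gamma>0_def by auto
  have \<gamma>_eq: "\<gamma> = insert {Top k, Top (k + 1)} (insert {Bot c, Bot d} \<gamma>0)"
    using top bot unfolding \<gamma>0_def by blast
  have \<gamma>': "\<gamma>' \<in> diagrams n"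
  proof (rule diagramsI)
    have "\<Union> \<gamma>' = \<Union> \<gamma>" unfolding \<gamma>_eq \<gamma>'_def by auto
    then show "\<Union> \<gamma>' = vertices n" using diagramsD(1)[OF \<gamma>] by simp
    have disj0: "e = e'" if "e \<in> \<gamma>0" "e' \<in> \<gamma>0" "e \<inter> e' \<noteq> {}" for e e'
      using that diagramsD(2)[OF \<gamma>] unfolding \<gamma>0_def by blast
    show "e = e'" if "e \<in> \<gamma>'" "e' \<in> \<gamma>'" "e \<inter> e' \<noteq> {}" for e e'
      using that avoid[of e] avoid[of e'] disj0[of e e'] \<open>c \<noteq> d\<close> unfolding \<gamma>'_def
      by (elim insertE) (simp_all; blast)+
    show "card e = 2" if "e \<in> \<gamma>'" for e
      using that diagramsD(3)[OF \<gamma>, of e] unfolding \<gamma>'_def \<gamma>0_def by auto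
  qed
  \<comment> \<open>The middle vertices \<open>k\<close> and \<open>k + 1\<close> belong to the path from \<open>c\<close> to \<open>d\<close> in the lower row.\<close>
  define \<phi> where "\<phi> u = (case u of Upper i \<Rightarrow> Top i | Lower i \<Rightarrow> Bot i
    | Mid i \<Rightarrow> if i = k then Bot c else if i = k + 1 then Bot d else Top i)" for u
  let ?u = "cup_cap_diagram n k"
  let ?E = "stack_edges ?u \<gamma>'"
  have \<phi>_outer: "\<phi> (stack_outer u) = u" for u by (cases u) (simp_all add: \<phi>_def)
  have \<phi>_snd: "\<phi> (stack_snd u) = u" if "u \<noteq> Top k" "u \<noteq> Top (k + 1)" for u
    using that by (cases u) (simp_all add: \<phi>_def)
  have cd: "Bot c \<in> vertices n" "Bot d \<in> vertices n" using bot diagramsD(1)[OF \<gamma>] by blast+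
  have range: "\<phi> u \<in> vertices n" if "u \<in> stack_vertices n" for u
    using that cd by (auto simp: \<phi>_def stack_vertices_def vertices_def)
  have fst_edge: "\<exists>d\<in>\<gamma>. \<phi> ` stack_fst ` e \<subseteq> d" if "e \<in> ?u" for e
  proof -
    from that consider "e = {Top k, Top (k + 1)}" | "e = {Bot k, Bot (k + 1)}"
      | m where "m \<in> {1..n} - {k, k + 1}" "e = {Top m, Bot m}"
      unfolding cup_cap_diagram_def by blast
    then show ?thesis
    proof cases
      case 1
      then show ?thesis using top by (intro bexI[of _ "{Top k, Top (k + 1)}"]) (auto simp: \<phi>_def)
    next
      case 2
      then show ?thesis using bot by (intro bexI[of _ "{Bot c, Bot d}"]) (auto simp: \<phi>_def)
    next
      case 3
      then have "Top m \<in> \<Union> \<gamma>" unfolding diagramsD(1)[OF \<gamma>] by (simp add: vertices_def)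
      then obtain d where "d \<in> \<gamma>" "Top m \<in> d" by blast
      with 3 show ?thesis by (intro bexI[of _ d]) (auto simp: \<phi>_def)
    qed
  qed
  have snd_edge: "\<exists>d\<in>\<gamma>. \<phi> ` stack_snd ` e \<subseteq> d" if "e \<in> \<gamma>'" for e
  proof -
    from that consider "e = {Top k, Bot c}" | "e = {Top (k + 1), Bot d}" | "e \<in> \<gamma>0"
      unfolding \<gamma>'_def by blast
    then show ?thesis
    proof cases
      case 3
      have "\<phi> (stack_snd x) = x" if "x \<in> e" for x
        using \<phi>_snd[of x] avoid[OF 3] that by blast
      then have "\<phi> ` stack_snd ` e \<subseteq> e" by auto
      moreover have "e \<in> \<gamma>" using 3 unfolding \<gamma>0_def by blast
      ultimately show ?thesis by blast
    qed (use bot in \<open>auto simp: \<phi>_def intro!: bexI[of _ "{Bot c, Bot d}"]\<close>)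
  qed
  have fst_rel: "(stack_fst x, stack_fst y) \<in> ?E\<^sup>*" if "{x, y} \<in> ?u" for x y
  proof -
    have "stack_fst ` {x, y} \<in> image stack_fst ` ?u" using that by blast
    then show ?thesis by (intro r_into_rtrancl) (simp add: stack_edges_def)
  qed
  have snd_rel: "(stack_snd x, stack_snd y) \<in> ?E\<^sup>*" if "{x, y} \<in> \<gamma>'" for x y
  proof -
    have "stack_snd ` {x, y} \<in> image stack_snd ` \<gamma>'" using that by blast
    then show ?thesis by (intro r_into_rtrancl) (simp add: stack_edges_def)
  qed
  have mid_lower: "(Mid k, Lower c) \<in> ?E\<^sup>*" "(Mid (k + 1), Lower d) \<in> ?E\<^sup>*"
    using snd_rel[of "Top k" "Bot c"] snd_rel[of "Top (k + 1)" "Bot d"] unfolding \<gamma>'_def by simp_all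
  have mid_upper: "(Mid m, Upper m) \<in> ?E\<^sup>*" if "m \<in> {1..n} - {k, k + 1}" for m
  proof -
    have "{Top m, Bot m} \<in> ?u" using that unfolding cup_cap_diagram_def by blast
    then show ?thesis using fst_rel[of "Bot m" "Top m"] by (simp add: insert_commute)
  qed
  have fibre: "(u, stack_outer (\<phi> u)) \<in> ?E\<^sup>*" if "u \<in> stack_vertices n" for u
  proof (cases u)
    case (Mid m)
    then have "m \<in> {1..n}" using that by (auto simp: stack_vertices_def)
    then show ?thesis using Mid mid_lower mid_upper[of m] by (simp add: \<phi>_def)
  qed (simp_all add: \<phi>_def)
  have joined: "(stack_outer a, stack_outer b) \<in> ?E\<^sup>*" if ab: "{a, b} \<in> \<gamma>" for a b
  proof -
    from ab consider "{a, b} = {Top k, Top (k + 1)}" | "{a, b} = {Bot c, Bot d}" | "{a, b} \<in> \<gamma>0"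
      unfolding \<gamma>_eq by blast
    then show ?thesis
    proof cases
      case 1
      have "{Top k, Top (k + 1)} \<in> ?u" unfolding cup_cap_diagram_def by blast
      then have "(Upper k, Upper (k + 1)) \<in> ?E\<^sup>*" using fst_rel[of "Top k" "Top (k + 1)"] by simp
      then show ?thesis using 1 stack_edges_rtrancl_sym by (auto simp: doubleton_eq_iff)
    next
      case 2
      have "{Bot k, Bot (k + 1)} \<in> ?u" unfolding cup_cap_diagram_def by blast
      then have "(Mid k, Mid (k + 1)) \<in> ?E\<^sup>*" using fst_rel[of "Bot k" "Bot (k + 1)"] by simp
      then have "(Lower c, Lower d) \<in> ?E\<^sup>*"
        using mid_lower stack_edges_rtrancl_sym by (meson rtrancl_trans)
      then show ?thesis using 2 stack_edges_rtrancl_sym by (auto simp: doubleton_eq_iff)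
    next
      case 3
      have ab': "\<phi> (stack_snd a) = a" "\<phi> (stack_snd b) = b"
        using \<phi>_snd[of a] \<phi>_snd[of b] avoid(1,2)[OF 3] by auto
      have "a \<in> vertices n" "b \<in> vertices n" using ab diagramsD(1)[OF \<gamma>] by blast+
      then have "stack_snd a \<in> stack_vertices n" "stack_snd b \<in> stack_vertices n"
        by (auto simp: vertices_def stack_vertices_def)
      then have "(stack_snd a, stack_outer a) \<in> ?E\<^sup>*" "(stack_snd b, stack_outer b) \<in> ?E\<^sup>*"
        using fibre[of "stack_snd a"] fibre[of "stack_snd b"] by (simp_all add: ab')
      moreover have "(stack_snd a, stack_snd b) \<in> ?E\<^sup>*"
        using 3 by (intro snd_rel) (simp add: \<gamma>'_def)
      ultimately show ?thesis using stack_edges_rtrancl_sym by (meson rtrancl_trans)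
    qed
  qed
  note retraction = diagram_comp_retraction[where \<phi> = \<phi>, OF cup_cap_in_diagrams[OF k] \<gamma>' \<gamma> range \<phi>_outer
      fst_edge snd_edge fibre joined]
  have "diagram_comp n ?u \<gamma>' = \<gamma>" by (rule retraction)
  moreover have "loops n ?u \<gamma>' = 0" by (rule retraction)
  ultimately show ?thesis using \<gamma>' by blast
qed

text \<open>
  Renaming the upper vertices moves an edge in the upper row to \<open>{1, 2}\<close>. So a
  diagram with horizontal edges is a product, without loops, of a permutation diagram,
  \<open>cup_cap_diagram n 1\<close> and a third diagram.
\<close>

lemma horizontal_factor:
  assumes \<gamma>: "\<gamma> \<in> diagrams n" and top: "{Top a, Top b} \<in> \<gamma>" and bot: "{Bot c, Bot d} \<in> \<gamma>"
  shows "1 < n \<and> (\<exists>s \<gamma>1 \<gamma>2. s permutes {1..n} \<and> \<gamma>1 \<in> diagrams n \<and> \<gamma>2 \<in> diagrams n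
    \<and> diagram_comp n (perm_diagram n s) \<gamma>1 = \<gamma> \<and> loops n (perm_diagram n s) \<gamma>1 = 0
    \<and> diagram_comp n (cup_cap_diagram n 1) \<gamma>2 = \<gamma>1 \<and> loops n (cup_cap_diagram n 1) \<gamma>2 = 0)"
proof -
  have ab: "a \<noteq> b" "a \<in> {1..n}" "b \<in> {1..n}"
  proof -
    show "a \<noteq> b" using diagramsD(3)[OF \<gamma> top] by auto
    have "Top a \<in> vertices n" "Top b \<in> vertices n" using top diagramsD(1)[OF \<gamma>] by blast+
    then show "a \<in> {1..n}" "b \<in> {1..n}" by (auto simp: vertices_def)
  qed
  then have n: "1 < n" by auto
  \<comment> \<open>A permutation that takes \<open>a\<close> to \<open>1\<close> and \<open>b\<close> to \<open>2\<close>.\<close>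
  define b' where "b' = transpose 1 a b"
  define t where "t = transpose 2 b' \<circ> transpose 1 a"
  have b': "b' \<in> {1..n}" "b' \<noteq> 1" using ab n by (auto simp: b'_def transpose_def)
  have t: "t permutes {1..n}" "t a = 1" "t b = 2"
    using ab n b' unfolding t_def
    by (auto intro!: permutes_compose permutes_swap_id simp: transpose_def b'_def)
  define s where "s = inv' t"
  have s: "s permutes {1..n}" unfolding s_def using t(1) by (rule permutes_inv)
  have ts: "s \<circ> t = id" unfolding s_def using t(1) by (rule permutes_inv_o)
  define \<gamma>1 where "\<gamma>1 = image (rename_top t) ` \<gamma>"
  have \<gamma>1: "\<gamma>1 \<in> diagrams n" unfolding \<gamma>1_def by (rule rename_top_in_diagrams[OF t(1) \<gamma>])
  have "rename_top t ` {Top a, Top b} \<in> \<gamma>1" "rename_top t ` {Bot c, Bot d} \<in> \<gamma>1"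
    unfolding \<gamma>1_def using top bot by blast+
  then have e: "{Top 1, Top (1 + 1)} \<in> \<gamma>1" "{Bot c, Bot d} \<in> \<gamma>1" by (simp_all add: t numeral_2_eq_2)
  have "rename_top s (rename_top t u) = u" for u
    using fun_cong[OF ts] by (cases u) simp_all
  then have "image (rename_top s) ` \<gamma>1 = \<gamma>" unfolding \<gamma>1_def by (simp add: image_image)
  then show ?thesis
    using cup_cap_factor[OF order_refl n \<gamma>1 e] perm_diagram_comp[OF s \<gamma>1] s \<gamma>1 n by auto
qed


section \<open>The Brauer algebra and the group algebra\<close>

lemma brauer_algebra_simps:
  "carrier (brauer_algebra n N) = {p. Poly_Mapping.keys p \<subseteq> diagrams n}"
  "one (brauer_algebra n N) = basis_elt (perm_diagram n id)"
  "p \<oplus>\<^bsub>brauer_algebra n N\<^esub> q = p + q"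
  "a \<odot>\<^bsub>brauer_algebra n N\<^esub> p = Poly_Mapping.map ((*) a) p"
  by (simp_all add: brauer_algebra_def based_algebra_simps)

lemma brauer_algebra_closed:
  "p \<in> carrier (brauer_algebra n N) \<Longrightarrow> q \<in> carrier (brauer_algebra n N) \<Longrightarrow>
    p \<oplus>\<^bsub>brauer_algebra n N\<^esub> q \<in> carrier (brauer_algebra n N)"
  "p \<in> carrier (brauer_algebra n N) \<Longrightarrow> q \<in> carrier (brauer_algebra n N) \<Longrightarrow>
    p \<otimes>\<^bsub>brauer_algebra n N\<^esub> q \<in> carrier (brauer_algebra n N)"
  "p \<in> carrier (brauer_algebra n N) \<Longrightarrow> a \<odot>\<^bsub>brauer_algebra n N\<^esub> p \<in> carrier (brauer_algebra n N)"
  "\<one>\<^bsub>brauer_algebra n N\<^esub> \<in> carrier (brauer_algebra n N)"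
proof -
  show "p \<oplus>\<^bsub>brauer_algebra n N\<^esub> q \<in> carrier (brauer_algebra n N)"
    if "p \<in> carrier (brauer_algebra n N)" "q \<in> carrier (brauer_algebra n N)"
    using that keys_add[of p q] by (auto simp: brauer_algebra_simps)
  show "p \<otimes>\<^bsub>brauer_algebra n N\<^esub> q \<in> carrier (brauer_algebra n N)"
    if "p \<in> carrier (brauer_algebra n N)" "q \<in> carrier (brauer_algebra n N)"
    using that based_mult_closed[of "diagrams n" "diagram_comp n" p q] diagram_comp_closed
    by (simp add: brauer_algebra_simps) (simp add: brauer_algebra_def)
  show "a \<odot>\<^bsub>brauer_algebra n N\<^esub> p \<in> carrier (brauer_algebra n N)"
    if "p \<in> carrier (brauer_algebra n N)"
    using that keys_scale[of a p] by (auto simp: brauer_algebra_simps)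
  show "\<one>\<^bsub>brauer_algebra n N\<^esub> \<in> carrier (brauer_algebra n N)"
    by (simp add: brauer_algebra_simps perm_diagram_in_diagrams permutes_id)
qed

lemma brauer_mult_single:
  "Poly_Mapping.single \<gamma> a \<otimes>\<^bsub>brauer_algebra n N\<^esub> Poly_Mapping.single \<gamma>' b =
    Poly_Mapping.single (diagram_comp n \<gamma> \<gamma>') (a * b * N ^ loops n \<gamma> \<gamma>')"
  by (simp add: brauer_algebra_def based_mult_single)

lemma adjacent_transposition_permutes:
  "1 \<le> k \<Longrightarrow> k < n \<Longrightarrow> transpose k (k + 1) permutes {1..n::nat}"
  by (intro permutes_swap_id) auto

lemma brauer_s_closed: "1 \<le> k \<Longrightarrow> k < n \<Longrightarrow> brauer_s n k \<in> carrier (brauer_algebra n N)"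
  by (simp add: brauer_algebra_simps brauer_s_def perm_diagram_in_diagrams
      adjacent_transposition_permutes del: One_nat_def)

lemma brauer_sb_closed: "1 \<le> k \<Longrightarrow> k < n \<Longrightarrow> brauer_sb n k \<in> carrier (brauer_algebra n N)"
  by (simp add: brauer_algebra_simps brauer_sb_def cup_cap_in_diagrams del: One_nat_def)

lemma group_algebra_simps:
  "carrier (group_algebra (sym_group n)) = {p. Poly_Mapping.keys p \<subseteq> {s. s permutes {1..n}}}"
  "one (group_algebra (sym_group n)) = basis_elt id"
  "zero (group_algebra (sym_group n)) = 0"
  "p \<oplus>\<^bsub>group_algebra (sym_group n)\<^esub> q = p + q"
  "a \<odot>\<^bsub>group_algebra (sym_group n)\<^esub> p = Poly_Mapping.map ((*) a) p"
  by (simp_all add: group_algebra_def based_algebra_simps sym_group_def)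

lemma group_algebra_mult_single:
  "Poly_Mapping.single s a \<otimes>\<^bsub>group_algebra (sym_group n)\<^esub> Poly_Mapping.single t b =
    Poly_Mapping.single (s \<circ> t) (a * b)"
  by (simp add: group_algebra_def based_mult_single sym_group_def)

lemma group_algebra_complex_algebra: "complex_algebra (group_algebra (sym_group n))"
proof -
  interpret group "sym_group n" by (rule sym_group_is_group)
  show ?thesis
    unfolding group_algebra_def by (rule based_algebra_complex_algebra) (simp_all add: m_assoc)
qed

text \<open>
  Adjacent transpositions generate the symmetric group. The transposition \<open>(a, b + 1)\<close> is the
  conjugate of \<open>(a, b)\<close> by \<open>(b, b + 1)\<close>.
\<close>

lemma permutes_adjacent_induct [consumes 1, case_names id adjacent comp]:
  fixes s :: "nat \<Rightarrow> nat"
  assumes s: "s permutes {1..n}" and id: "P id"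
    and adj: "\<And>k. 1 \<le> k \<Longrightarrow> k < n \<Longrightarrow> P (transpose k (k + 1))"
    and comp: "\<And>s t. s permutes {1..n} \<Longrightarrow> t permutes {1..n} \<Longrightarrow> P s \<Longrightarrow> P t \<Longrightarrow> P (s \<circ> t)"
  shows "P s"
proof -
  have step: "P (transpose a (a + Suc d))" if "1 \<le> a" "a + Suc d \<le> n" for a d
    using that
  proof (induction d)
    case 0
    then show ?case using adj[of a] by simp
  next
    case (Suc d)
    let ?b = "a + Suc d"
    have eq: "transpose a (a + Suc (Suc d)) =
        transpose ?b (?b + 1) \<circ> (transpose a ?b \<circ> transpose ?b (?b + 1))"
      by (auto simp: fun_eq_iff transpose_def)
    have p: "transpose ?b (?b + 1) permutes {1..n}" "transpose a ?b permutes {1..n}"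
      using Suc.prems by (auto intro!: permutes_swap_id)
    then have pp: "transpose a ?b \<circ> transpose ?b (?b + 1) permutes {1..n}"
      by (intro permutes_compose)
    have "P (transpose ?b (?b + 1))" using Suc.prems by (intro adj) auto
    moreover have "P (transpose a ?b)" using Suc by simp
    ultimately show ?case unfolding eq using comp p pp by blast
  qed
  have less: "P (transpose a b)" if "1 \<le> a" "a < b" "b \<le> n" for a b
    using step[of a "b - a - 1"] that by simp
  have transp: "P (transpose a b)" if "a \<in> {1..n}" "b \<in> {1..n}" "a \<noteq> b" for a b
    using less[of a b] less[of b a] that by (cases a b rule: linorder_cases) (auto simp: transpose_commute)
  show ?thesis
    using s finite_atLeastAtMost id
  proof (induction s rule: permutes_induct)
    case (swap a b p)
    then show ?case by (intro comp permutes_swap_id transp) auto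
  qed
qed

lemma brauer_hom_basis_comp:
  assumes h: "h \<in> alg_hom (brauer_algebra n N) A"
    and \<gamma>: "\<gamma> \<in> diagrams n" "\<gamma>' \<in> diagrams n" "loops n \<gamma> \<gamma>' = 0"
  shows "h (basis_elt (diagram_comp n \<gamma> \<gamma>')) = h (basis_elt \<gamma>) \<otimes>\<^bsub>A\<^esub> h (basis_elt \<gamma>')"
proof -
  have "basis_elt (diagram_comp n \<gamma> \<gamma>') = basis_elt \<gamma> \<otimes>\<^bsub>brauer_algebra n N\<^esub> basis_elt \<gamma>'"
    using \<gamma>(3) by (simp add: brauer_mult_single)
  moreover have "basis_elt \<gamma> \<in> carrier (brauer_algebra n N)" "basis_elt \<gamma>' \<in> carrier (brauer_algebra n N)"
    using \<gamma> by (simp_all add: brauer_algebra_simps)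
  ultimately show ?thesis by (simp only: alg_homD(2)[OF h])
qed

text \<open>
  As the factorisation of a diagram with horizontal edges has no loops, the value of \<open>N\<close> does not
  matter: such a diagram lies in the ideal generated by \<open>\<bar>s\<^sub>1\<close> even if \<open>N = 0\<close>.
\<close>

lemma brauer_hom_kills_horizontal:
  assumes A: "complex_algebra A" and h: "h \<in> alg_hom (brauer_algebra n N) A"
    and sb: "1 < n \<Longrightarrow> h (brauer_sb n 1) = \<zero>\<^bsub>A\<^esub>"
    and \<gamma>: "\<gamma> \<in> diagrams n" and edges: "{Top a, Top b} \<in> \<gamma>" "{Bot c, Bot d} \<in> \<gamma>"
  shows "h (basis_elt \<gamma>) = \<zero>\<^bsub>A\<^esub>"
proof -
  interpret A: complex_algebra A by (rule A)
  obtain s \<gamma>1 \<gamma>2 where n: "1 < n" and d: "s permutes {1..n}" "\<gamma>1 \<in> diagrams n" "\<gamma>2 \<in> diagrams n"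
    and c: "diagram_comp n (perm_diagram n s) \<gamma>1 = \<gamma>" "loops n (perm_diagram n s) \<gamma>1 = 0"
      "diagram_comp n (cup_cap_diagram n 1) \<gamma>2 = \<gamma>1" "loops n (cup_cap_diagram n 1) \<gamma>2 = 0"
    using horizontal_factor[OF \<gamma> edges] by blast
  have closed: "h (basis_elt \<delta>) \<in> carrier A" if "\<delta> \<in> diagrams n" for \<delta>
    using that alg_homD(1)[OF h] by (simp add: brauer_algebra_simps)
  have "h (basis_elt \<gamma>1) = h (basis_elt (cup_cap_diagram n 1)) \<otimes>\<^bsub>A\<^esub> h (basis_elt \<gamma>2)"
    using brauer_hom_basis_comp[OF h cup_cap_in_diagrams[OF order_refl n] d(3) c(4)] c(3) by simp
  also have "\<dots> = \<zero>\<^bsub>A\<^esub>"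
    using sb[OF n] closed[OF d(3)] by (simp add: brauer_sb_def)
  finally have "h (basis_elt \<gamma>1) = \<zero>\<^bsub>A\<^esub>" .
  then show ?thesis
    using brauer_hom_basis_comp[OF h perm_diagram_in_diagrams[OF d(1)] d(2) c(2)] c(1)
      closed[OF perm_diagram_in_diagrams[OF d(1)]] by simp
qed

text \<open>A homomorphism that kills \<open>\<bar>s\<^sub>1\<close> is determined by the images of the \<open>s\<^sub>k\<close>.\<close>

lemma brauer_hom_unique:
  assumes A: "complex_algebra A"
    and h: "h \<in> alg_hom (brauer_algebra n N) A" and h': "h' \<in> alg_hom (brauer_algebra n N) A"
    and s: "\<And>k. 1 \<le> k \<Longrightarrow> k < n \<Longrightarrow> h (brauer_s n k) = h' (brauer_s n k)"
    and sb: "1 < n \<Longrightarrow> h (brauer_sb n 1) = \<zero>\<^bsub>A\<^esub>" "1 < n \<Longrightarrow> h' (brauer_sb n 1) = \<zero>\<^bsub>A\<^esub>"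
    and b: "b \<in> carrier (brauer_algebra n N)"
  shows "h b = h' b"
proof -
  interpret A: complex_algebra A by (rule A)
  have perm_eq: "h (basis_elt (perm_diagram n s)) = h' (basis_elt (perm_diagram n s))" if "s permutes {1..n}" for s
    using that
  proof (induction s rule: permutes_adjacent_induct)
    case id
    show ?case using alg_homD(4)[OF h] alg_homD(4)[OF h'] by (simp only: brauer_algebra_simps)
  next
    case (adjacent k)
    then show ?case using s by (simp add: brauer_s_def)
  next
    case (comp s t)
    then have "h (basis_elt (perm_diagram n (s \<circ> t))) = h' (basis_elt (perm_diagram n (s \<circ> t)))"
      using brauer_hom_basis_comp[OF h, of "perm_diagram n s" "perm_diagram n t"]
        brauer_hom_basis_comp[OF h', of "perm_diagram n s" "perm_diagram n t"]
      by (simp add: perm_diagram_comp(2) perm_diagram_comp_perm perm_diagram_in_diagrams)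
    then show ?case by (simp only: comp_def)
  qed
  have basis_eq: "h (basis_elt \<gamma>) = h' (basis_elt \<gamma>)" if \<gamma>: "\<gamma> \<in> diagrams n" for \<gamma>
    using \<gamma>
  proof (cases rule: diagram_cases)
    case (perm s)
    then show ?thesis using perm_eq by simp
  next
    case (horizontal a b c d)
    show ?thesis
      using brauer_hom_kills_horizontal[OF A h sb(1) \<gamma> horizontal]
        brauer_hom_kills_horizontal[OF A h' sb(2) \<gamma> horizontal] by simp
  qed
  have hom_zero: "g 0 = \<zero>\<^bsub>A\<^esub>" if g: "g \<in> alg_hom (brauer_algebra n N) A" for g
  proof -
    have "Poly_Mapping.map ((*) 0) 0 = (0 :: diagram \<Rightarrow>\<^sub>0 complex)" by (rule poly_mapping_eqI) simp
    then have "g 0 = 0 \<odot>\<^bsub>A\<^esub> g 0"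
      using alg_homD(5)[OF g, of 0 0] by (simp add: brauer_algebra_simps)
    then show "g 0 = \<zero>\<^bsub>A\<^esub>"
      using alg_homD(1)[OF g, of 0] by (simp add: brauer_algebra_simps)
  qed
  have hom_single: "g (Poly_Mapping.single \<gamma> a) = a \<odot>\<^bsub>A\<^esub> g (basis_elt \<gamma>)"
    if g: "g \<in> alg_hom (brauer_algebra n N) A" and \<gamma>: "\<gamma> \<in> diagrams n" for g \<gamma> a
    using alg_homD(5)[OF g, of "basis_elt \<gamma>" a] \<gamma> by (simp add: brauer_algebra_simps scale_single)
  have hom_add: "g (p + q) = g p \<oplus>\<^bsub>A\<^esub> g q"
    if g: "g \<in> alg_hom (brauer_algebra n N) A"
      and pq: "Poly_Mapping.keys p \<subseteq> diagrams n" "Poly_Mapping.keys q \<subseteq> diagrams n" for g p q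
    using alg_homD(3)[OF g, of p q] pq by (simp add: brauer_algebra_simps)
  from b have "Poly_Mapping.keys b \<subseteq> diagrams n" by (simp add: brauer_algebra_simps)
  then show ?thesis
  proof (induction b rule: based_induct)
    case zero
    show ?case by (simp only: hom_zero[OF h] hom_zero[OF h'])
  next
    case (single \<gamma> a)
    then show ?case
      by (simp only: hom_single[OF h, of \<gamma> a] hom_single[OF h', of \<gamma> a] basis_eq)
  next
    case (add p q)
    then show ?case by (simp only: hom_add[OF h] hom_add[OF h'])
  qed
qed

text \<open>
  The homomorphism of the Brauer algebra onto the group algebra that maps a permutation diagram
  to the permutation and the other diagrams to \<open>0\<close>.
\<close>

definition brauer_to_group :: "nat \<Rightarrow> (diagram \<Rightarrow>\<^sub>0 complex) \<Rightarrow> ((nat \<Rightarrow> nat) \<Rightarrow>\<^sub>0 complex)"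
  where "brauer_to_group n p =
    (\<Sum>s | s permutes {1..n}. Poly_Mapping.single s (Poly_Mapping.lookup p (perm_diagram n s)))"

lemma lookup_brauer_to_group:
  "Poly_Mapping.lookup (brauer_to_group n p) s =
    (if s permutes {1..n} then Poly_Mapping.lookup p (perm_diagram n s) else 0)"
  by (simp add: brauer_to_group_def lookup_sum lookup_single when_def finite_permutations)

lemma brauer_to_group_add:
  "brauer_to_group n (p + q) = brauer_to_group n p + brauer_to_group n q"
  by (rule poly_mapping_eqI) (simp add: lookup_brauer_to_group lookup_add)

lemma brauer_to_group_scale:
  "brauer_to_group n (Poly_Mapping.map ((*) a) p) = Poly_Mapping.map ((*) a) (brauer_to_group n p)"
  by (rule poly_mapping_eqI) (simp add: lookup_brauer_to_group)

lemma brauer_to_group_zero: "brauer_to_group n 0 = 0"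
  by (rule poly_mapping_eqI) (simp add: lookup_brauer_to_group)

lemma brauer_to_group_perm:
  assumes "s permutes {1..n}"
  shows "brauer_to_group n (Poly_Mapping.single (perm_diagram n s) a) = Poly_Mapping.single s a"
  by (rule poly_mapping_eqI)
     (use assms perm_diagram_inj in \<open>auto simp: lookup_brauer_to_group lookup_single when_def\<close>)

lemma brauer_to_group_horizontal:
  assumes "{Top i, Top j} \<in> \<gamma>"
  shows "brauer_to_group n (Poly_Mapping.single \<gamma> a) = 0"
  by (rule poly_mapping_eqI)
     (use assms top_edge_not_perm in \<open>auto simp: lookup_brauer_to_group lookup_single when_def\<close>)

lemma brauer_to_group_mult_single:
  assumes \<gamma>: "\<gamma> \<in> diagrams n" "\<gamma>' \<in> diagrams n"
  shows "brauer_to_group n (Poly_Mapping.single \<gamma> a \<otimes>\<^bsub>brauer_algebra n N\<^esub> Poly_Mapping.single \<gamma>' b) =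
    brauer_to_group n (Poly_Mapping.single \<gamma> a) \<otimes>\<^bsub>group_algebra (sym_group n)\<^esub>
    brauer_to_group n (Poly_Mapping.single \<gamma>' b)"
  using \<gamma>(1)
proof (cases rule: diagram_cases)
  case (horizontal i j c d)
  then show ?thesis
    using top_edge_comp[OF \<gamma> horizontal(1)]
    by (simp add: brauer_mult_single brauer_to_group_horizontal group_algebra_def)
next
  case s: (perm s)
  show ?thesis using \<gamma>(2)
  proof (cases rule: diagram_cases)
    case (perm t)
    then show ?thesis using s
      by (simp add: brauer_mult_single perm_diagram_comp(2)[OF s(1) \<gamma>(2)[unfolded perm(2)]]
          perm_diagram_comp_perm brauer_to_group_perm group_algebra_mult_single permutes_compose)
  next
    case (horizontal i j c d)
    have "rename_top s ` {Top i, Top j} \<in> diagram_comp n \<gamma> \<gamma>'"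
      unfolding s(2) perm_diagram_comp(1)[OF s(1) \<gamma>(2)] using horizontal(1) by blast
    then show ?thesis
      using horizontal(1)
      by (simp add: brauer_mult_single brauer_to_group_horizontal group_algebra_def)
  qed
qed

lemma brauer_to_group_alg_hom:
  "brauer_to_group n \<in> alg_hom (brauer_algebra n N) (group_algebra (sym_group n))"
proof (rule alg_homI)
  let ?B = "brauer_algebra n N" and ?G = "group_algebra (sym_group n)"
  show "brauer_to_group n p \<in> carrier ?G" for p
    by (auto simp: group_algebra_simps in_keys_iff lookup_brauer_to_group split: if_splits)
  show "brauer_to_group n (p \<otimes>\<^bsub>?B\<^esub> q) = brauer_to_group n p \<otimes>\<^bsub>?G\<^esub> brauer_to_group n q"
    if "p \<in> carrier ?B" "q \<in> carrier ?B" for p q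
  proof -
    from that have p: "Poly_Mapping.keys p \<subseteq> diagrams n" and q: "Poly_Mapping.keys q \<subseteq> diagrams n"
      by (simp_all add: brauer_algebra_simps)
    show ?thesis using p
    proof (induction p rule: based_induct)
      case zero
      show ?case by (simp add: brauer_to_group_zero brauer_algebra_def group_algebra_def)
    next
      case (add p p')
      then show ?case
        by (simp add: brauer_to_group_add brauer_algebra_def group_algebra_def based_mult_add_left)
    next
      case (single \<gamma> a)
      note \<gamma> = this
      show ?case using q
      proof (induction q rule: based_induct)
        case zero
        show ?case by (simp add: brauer_to_group_zero brauer_algebra_def group_algebra_def)
      next
        case (add q q')
        then show ?case
          by (simp add: brauer_to_group_add brauer_algebra_def group_algebra_def based_mult_add_right)
      next
        case (single \<gamma>' b)
        with \<gamma> show ?case by (rule brauer_to_group_mult_single)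
      qed
    qed
  qed
  show "brauer_to_group n \<one>\<^bsub>?B\<^esub> = \<one>\<^bsub>?G\<^esub>"
    unfolding brauer_algebra_simps group_algebra_simps by (rule brauer_to_group_perm[OF permutes_id])
qed (simp_all add: brauer_algebra_simps group_algebra_simps brauer_to_group_add brauer_to_group_scale)

lemma brauer_to_group_s: "1 \<le> k \<Longrightarrow> k < n \<Longrightarrow> brauer_to_group n (brauer_s n k) = symmetric_s k"
  unfolding brauer_s_def symmetric_s_def
  by (intro brauer_to_group_perm adjacent_transposition_permutes)

lemma brauer_to_group_sb: "brauer_to_group n (brauer_sb n k) = 0"
  unfolding brauer_sb_def
  by (rule brauer_to_group_horizontal[of k "k + 1"]) (simp add: cup_cap_diagram_def)

lemma brauer_to_group_surj:
  assumes "b \<in> carrier (group_algebra (sym_group n))"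
  shows "\<exists>p\<in>carrier (brauer_algebra n N). brauer_to_group n p = b"
proof -
  from assms have "Poly_Mapping.keys b \<subseteq> {s. s permutes {1..n}}" by (simp add: group_algebra_simps)
  then show ?thesis
  proof (induction b rule: based_induct)
    case zero
    show ?case by (intro bexI[of _ 0]) (simp_all add: brauer_to_group_zero brauer_algebra_simps)
  next
    case (single s a)
    then show ?case
      by (intro bexI[of _ "Poly_Mapping.single (perm_diagram n s) a"])
         (simp_all add: brauer_to_group_perm brauer_algebra_simps perm_diagram_in_diagrams)
  next
    case (add p q)
    then obtain p' q' where "p' \<in> carrier (brauer_algebra n N)" "q' \<in> carrier (brauer_algebra n N)"
      "brauer_to_group n p' = p" "brauer_to_group n q' = q" by blast
    then show ?case
      using brauer_algebra_closed(1)[of p' n N q']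
      by (intro bexI[of _ "p' + q'"]) (simp_all add: brauer_to_group_add brauer_algebra_simps)
  qed
qed


section \<open>The two presentations\<close>

context
  fixes F :: "(complex, 'a, 'm) module_scheme" (structure) and n :: nat
begin

lemma affine_brauer_relations_cases [consumes 1]:
  assumes "(u, v) \<in> affine_brauer_relations F n s sb y w"
    and "\<And>k l. k \<in> {1..n} \<Longrightarrow> l \<in> {1..n} \<Longrightarrow> Q (y k \<otimes> y l) (y l \<otimes> y k)"
    and "\<And>i a. 1 \<le> i \<Longrightarrow> a \<in> carrier F \<Longrightarrow> Q (w i \<otimes> a) (a \<otimes> w i)"
    and "\<And>k l. 1 \<le> k \<Longrightarrow> k < n \<Longrightarrow> l \<in> {1..n} \<Longrightarrow> l \<noteq> k \<Longrightarrow> l \<noteq> k + 1 \<Longrightarrow> Q (s k \<otimes> y l) (y l \<otimes> s k)"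
    and "\<And>k l. 1 \<le> k \<Longrightarrow> k < n \<Longrightarrow> l \<in> {1..n} \<Longrightarrow> l \<noteq> k \<Longrightarrow> l \<noteq> k + 1 \<Longrightarrow> Q (sb k \<otimes> y l) (y l \<otimes> sb k)"
    and "\<And>k. 1 \<le> k \<Longrightarrow> k < n \<Longrightarrow> Q (s k \<otimes> y k \<ominus> y (k + 1) \<otimes> s k) (sb k \<ominus> \<one>)"
    and "\<And>k. 1 \<le> k \<Longrightarrow> k < n \<Longrightarrow> Q (s k \<otimes> y (k + 1) \<ominus> y k \<otimes> s k) (\<one> \<ominus> sb k)"
    and "\<And>k. 1 \<le> k \<Longrightarrow> k < n \<Longrightarrow> Q (sb k \<otimes> (y k \<oplus> y (k + 1))) \<zero>"
    and "\<And>k. 1 \<le> k \<Longrightarrow> k < n \<Longrightarrow> Q ((y k \<oplus> y (k + 1)) \<otimes> sb k) \<zero>"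
    and "\<And>i::nat. 1 < n \<Longrightarrow> 1 \<le> i \<Longrightarrow> Q (sb 1 \<otimes> y 1 [^] i \<otimes> sb 1) (w i \<otimes> sb 1)"
    and "\<And>i. odd i \<Longrightarrow> Q ((- 2) \<odot> w i) (w (i - 1) \<oplus> (\<Oplus>j\<in>{1..i}. (- 1) ^ j \<odot> (w (i - j) \<otimes> w (j - 1))))"
  shows "Q u v"
  using assms(1) unfolding affine_brauer_relations_def
  by (elim UnE CollectE exE conjE Pair_inject; hypsubst)
     (rule assms(2-); assumption)+

lemma affine_hecke_relations_cases [consumes 1]:
  assumes "(u, v) \<in> affine_hecke_relations F n s y"
    and "\<And>k l. k \<in> {1..n} \<Longrightarrow> l \<in> {1..n} \<Longrightarrow> Q (y k \<otimes> y l) (y l \<otimes> y k)"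
    and "\<And>k l. 1 \<le> k \<Longrightarrow> k < n \<Longrightarrow> l \<in> {1..n} \<Longrightarrow> l \<noteq> k \<Longrightarrow> l \<noteq> k + 1 \<Longrightarrow> Q (s k \<otimes> y l) (y l \<otimes> s k)"
    and "\<And>k. 1 \<le> k \<Longrightarrow> k < n \<Longrightarrow> Q (s k \<otimes> y k \<ominus> y (k + 1) \<otimes> s k) (\<ominus> \<one>)"
    and "\<And>k. 1 \<le> k \<Longrightarrow> k < n \<Longrightarrow> Q (s k \<otimes> y (k + 1) \<ominus> y k \<otimes> s k) \<one>"
  shows "Q u v"
  using assms(1) unfolding affine_hecke_relations_def
  by (elim UnE CollectE exE conjE Pair_inject; hypsubst)
     (rule assms(2-); assumption)+

end


lemma affine_brauer_presentation:
  "presentation (brauer_algebra n N) (affine_gens n) (affine_brauer_rels n N)"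
proof
  define F where "F = adjoin_free (brauer_algebra n N) (affine_gens n)"
  define w where "w i = (if i = 0 then N \<odot>\<^bsub>F\<^esub> \<one>\<^bsub>F\<^esub> else letter (Inr (W i)))" for i
  interpret F: complex_algebra F
    unfolding F_def adjoin_free_def by (rule free_algebra_complex_algebra)
  have letters: "letter (Inl b) \<in> carrier F" if "b \<in> carrier (brauer_algebra n N)" for b
    using that unfolding F_def adjoin_free_def by (intro letter_closed) blast
  have gens: "letter (Inr x) \<in> carrier F" if "x \<in> affine_gens n" for x
    using that unfolding F_def adjoin_free_def by (intro letter_closed) blast
  have s: "letter (Inl (brauer_s n k)) \<in> carrier F" "letter (Inl (brauer_sb n k)) \<in> carrier F"
    if "1 \<le> k" "k < n" for k
    using that by (auto intro!: letters brauer_s_closed brauer_sb_closed)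
  have y: "letter (Inr (Y k)) \<in> carrier F" if "k \<in> {1..n}" for k
    using that by (intro gens) (simp add: affine_gens_def)
  have w: "w i \<in> carrier F" for i
    unfolding w_def by (auto intro!: gens simp: affine_gens_def)
  have "u \<in> carrier F \<and> v \<in> carrier F" if "(u, v) \<in> affine_brauer_rels n N" for u v
  proof -
    have "(u, v) \<in> affine_brauer_relations F n (\<lambda>k. letter (Inl (brauer_s n k)))
      (\<lambda>k. letter (Inl (brauer_sb n k))) (\<lambda>k. letter (Inr (Y k))) w"
      using that unfolding affine_brauer_rels_def Let_def F_def w_def .
    then show ?thesis
      by (rule affine_brauer_relations_cases)
         (use s y w in \<open>auto intro!: F.minus_closed F.finsum_closed\<close>)
  qed
  then show "affine_brauer_rels n N \<subseteq> carrier (adjoin_free (brauer_algebra n N) (affine_gens n)) \<times>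
      carrier (adjoin_free (brauer_algebra n N) (affine_gens n))"
    unfolding F_def by auto
qed (rule brauer_algebra_closed; assumption)+

lemma symmetric_s_closed: "1 \<le> k \<Longrightarrow> k < n \<Longrightarrow> symmetric_s k \<in> carrier (group_algebra (sym_group n))"
  using adjacent_transposition_permutes[of k n] by (simp add: group_algebra_simps symmetric_s_def)

lemma affine_hecke_presentation:
  "presentation (group_algebra (sym_group n)) {1..n} (affine_hecke_rels n)"
proof
  define F where "F = adjoin_free (group_algebra (sym_group n)) {1..n}"
  interpret F: complex_algebra F
    unfolding F_def adjoin_free_def by (rule free_algebra_complex_algebra)
  have s: "letter (Inl (symmetric_s k)) \<in> carrier F" if "1 \<le> k" "k < n" for k
    using symmetric_s_closed[OF that] unfolding F_def adjoin_free_def by (intro letter_closed) blast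
  have v: "letter (Inr k) \<in> carrier F" if "k \<in> {1..n}" for k
    using that unfolding F_def adjoin_free_def by (intro letter_closed) blast
  have "u \<in> carrier F \<and> v \<in> carrier F" if "(u, v) \<in> affine_hecke_rels n" for u v
  proof -
    have "(u, v) \<in> affine_hecke_relations F n (\<lambda>k. letter (Inl (symmetric_s k))) (\<lambda>k. letter (Inr k))"
      using that unfolding affine_hecke_rels_def F_def .
    then show ?thesis
      by (rule affine_hecke_relations_cases)
         (use s v in \<open>auto intro!: F.minus_closed\<close>)
  qed
  then show "affine_hecke_rels n \<subseteq> carrier (adjoin_free (group_algebra (sym_group n)) {1..n}) \<times>
      carrier (adjoin_free (group_algebra (sym_group n)) {1..n})"
    unfolding F_def by auto
  interpret G: complex_algebra "group_algebra (sym_group n)" by (rule group_algebra_complex_algebra)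
  show "a \<oplus>\<^bsub>group_algebra (sym_group n)\<^esub> b \<in> carrier (group_algebra (sym_group n))"
    if "a \<in> carrier (group_algebra (sym_group n))" "b \<in> carrier (group_algebra (sym_group n))" for a b
    using that by (rule G.a_closed)
  show "a \<otimes>\<^bsub>group_algebra (sym_group n)\<^esub> b \<in> carrier (group_algebra (sym_group n))"
    if "a \<in> carrier (group_algebra (sym_group n))" "b \<in> carrier (group_algebra (sym_group n))" for a b
    using that by (rule G.m_closed)
  show "c \<odot>\<^bsub>group_algebra (sym_group n)\<^esub> a \<in> carrier (group_algebra (sym_group n))"
    if "a \<in> carrier (group_algebra (sym_group n))" for c a
    using that by (rule G.smult_closed)
  show "\<one>\<^bsub>group_algebra (sym_group n)\<^esub> \<in> carrier (group_algebra (sym_group n))"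
    by (rule G.one_closed)
qed

lemma affine_hecke_complex_algebra: "complex_algebra (affine_hecke_algebra n)"
  unfolding affine_hecke_algebra_def
  by (rule presentation.presented_complex_algebra[OF affine_hecke_presentation])

lemma affine_brauer_complex_algebra: "complex_algebra (affine_brauer_algebra n N)"
  unfolding affine_brauer_algebra_def
  by (rule presentation.presented_complex_algebra[OF affine_brauer_presentation])

lemma affine_hecke_coefficient_hom:
  "(\<lambda>b. affine_hecke_gen n (Inl b)) \<in> alg_hom (group_algebra (sym_group n)) (affine_hecke_algebra n)"
  unfolding affine_hecke_algebra_def affine_hecke_gen_def
  by (rule presentation.coefficient_hom[OF affine_hecke_presentation])

lemma affine_brauer_coefficient_hom:
  "(\<lambda>b. affine_brauer_gen n N (Inl b)) \<in> alg_hom (brauer_algebra n N) (affine_brauer_algebra n N)"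
  unfolding affine_brauer_algebra_def affine_brauer_gen_def
  by (rule presentation.coefficient_hom[OF affine_brauer_presentation])

lemma ah_v_closed: "k \<in> {1..n} \<Longrightarrow> ah_v n k \<in> carrier (affine_hecke_algebra n)"
  unfolding affine_hecke_algebra_def affine_hecke_gen_def
  by (rule presentation.gen_closed(2)[OF affine_hecke_presentation])

lemma affine_hecke_relations_hold:
  fixes n defines "H \<equiv> affine_hecke_algebra n"
  shows "k \<in> {1..n} \<Longrightarrow> l \<in> {1..n} \<Longrightarrow> ah_v n k \<otimes>\<^bsub>H\<^esub> ah_v n l = ah_v n l \<otimes>\<^bsub>H\<^esub> ah_v n k"
    and "1 \<le> k \<Longrightarrow> k < n \<Longrightarrow> l \<in> {1..n} \<Longrightarrow> l \<noteq> k \<Longrightarrow> l \<noteq> k + 1 \<Longrightarrow>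
      ah_s n k \<otimes>\<^bsub>H\<^esub> ah_v n l = ah_v n l \<otimes>\<^bsub>H\<^esub> ah_s n k"
    and "1 \<le> k \<Longrightarrow> k < n \<Longrightarrow>
      ah_s n k \<otimes>\<^bsub>H\<^esub> ah_v n k \<ominus>\<^bsub>H\<^esub> ah_v n (k + 1) \<otimes>\<^bsub>H\<^esub> ah_s n k = \<ominus>\<^bsub>H\<^esub> \<one>\<^bsub>H\<^esub>"
    and "1 \<le> k \<Longrightarrow> k < n \<Longrightarrow>
      ah_s n k \<otimes>\<^bsub>H\<^esub> ah_v n (k + 1) \<ominus>\<^bsub>H\<^esub> ah_v n k \<otimes>\<^bsub>H\<^esub> ah_s n k = \<one>\<^bsub>H\<^esub>"
proof -
  interpret P: presentation "group_algebra (sym_group n)" "{1..n}" "affine_hecke_rels n"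
    by (rule affine_hecke_presentation)
  define F where "F = adjoin_free (group_algebra (sym_group n)) {1..n}"
  define q where "q = (+>\<^bsub>F\<^esub>) (adjoin_ideal (group_algebra (sym_group n)) {1..n} (affine_hecke_rels n))"
  interpret F: complex_algebra F
    unfolding F_def by (rule P.free_complex_algebra)
  have H: "complex_algebra H" unfolding H_def by (rule affine_hecke_complex_algebra)
  have q: "q \<in> alg_hom F H"
    unfolding q_def F_def H_def affine_hecke_algebra_def by (rule P.quot_alg_hom)
  have gen: "affine_hecke_gen n g = q (letter g)" for g
    unfolding affine_hecke_gen_def q_def F_def by (rule P.gen_eq)
  have rel: "q u = q v" if "(u, v) \<in> affine_hecke_relations F n (\<lambda>k. letter (Inl (symmetric_s k))) (\<lambda>k. letter (Inr k))" for u v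
  proof -
    have "(u, v) \<in> affine_hecke_rels n" using that unfolding affine_hecke_rels_def F_def .
    then show ?thesis unfolding q_def F_def by (intro P.quot_rel) blast
  qed
  note rel' = rel[unfolded affine_hecke_relations_def]
  have s: "letter (Inl (symmetric_s k)) \<in> carrier F" if "1 \<le> k" "k < n" for k
    unfolding F_def by (rule P.letters_closed(1)[OF symmetric_s_closed[OF that]])
  have v: "letter (Inr k) \<in> carrier F" if "k \<in> {1..n}" for k
    unfolding F_def by (rule P.letters_closed(2)[OF that])
  note homs = alg_homD[OF q] alg_hom_diff[OF F.complex_algebra_axioms H q]
    alg_hom_a_inv[OF F.complex_algebra_axioms H q]
  show "ah_v n k \<otimes>\<^bsub>H\<^esub> ah_v n l = ah_v n l \<otimes>\<^bsub>H\<^esub> ah_v n k" if "k \<in> {1..n}" "l \<in> {1..n}"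
  proof -
    have "q (letter (Inr k) \<otimes>\<^bsub>F\<^esub> letter (Inr l)) = q (letter (Inr l) \<otimes>\<^bsub>F\<^esub> letter (Inr k))"
      by (rule rel') (use that in blast)
    then show ?thesis by (simp only: gen homs v that)
  qed
  show "ah_s n k \<otimes>\<^bsub>H\<^esub> ah_v n l = ah_v n l \<otimes>\<^bsub>H\<^esub> ah_s n k"
    if "1 \<le> k" "k < n" "l \<in> {1..n}" "l \<noteq> k" "l \<noteq> k + 1"
  proof -
    have "q (letter (Inl (symmetric_s k)) \<otimes>\<^bsub>F\<^esub> letter (Inr l)) = q (letter (Inr l) \<otimes>\<^bsub>F\<^esub> letter (Inl (symmetric_s k)))"
      by (rule rel') (use that in blast)
    then show ?thesis by (simp only: gen homs s v that)
  qed
  show "ah_s n k \<otimes>\<^bsub>H\<^esub> ah_v n k \<ominus>\<^bsub>H\<^esub> ah_v n (k + 1) \<otimes>\<^bsub>H\<^esub> ah_s n k = \<ominus>\<^bsub>H\<^esub> \<one>\<^bsub>H\<^esub>"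
    if k: "1 \<le> k" "k < n"
  proof -
    have k': "k \<in> {1..n}" "k + 1 \<in> {1..n}" using k by auto
    have "q (letter (Inl (symmetric_s k)) \<otimes>\<^bsub>F\<^esub> letter (Inr k) \<ominus>\<^bsub>F\<^esub> letter (Inr (k + 1)) \<otimes>\<^bsub>F\<^esub> letter (Inl (symmetric_s k)))
        = q (\<ominus>\<^bsub>F\<^esub> \<one>\<^bsub>F\<^esub>)"
      by (rule rel') (use k in blast)
    then show ?thesis by (simp only: gen homs s v k k' F.m_closed F.one_closed)
  qed
  show "ah_s n k \<otimes>\<^bsub>H\<^esub> ah_v n (k + 1) \<ominus>\<^bsub>H\<^esub> ah_v n k \<otimes>\<^bsub>H\<^esub> ah_s n k = \<one>\<^bsub>H\<^esub>"
    if k: "1 \<le> k" "k < n"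
  proof -
    have k': "k \<in> {1..n}" "k + 1 \<in> {1..n}" using k by auto
    have "q (letter (Inl (symmetric_s k)) \<otimes>\<^bsub>F\<^esub> letter (Inr (k + 1)) \<ominus>\<^bsub>F\<^esub> letter (Inr k) \<otimes>\<^bsub>F\<^esub> letter (Inl (symmetric_s k)))
        = q \<one>\<^bsub>F\<^esub>"
      by (rule rel') (use k in blast)
    then show ?thesis by (simp only: gen homs s v k k' F.m_closed)
  qed
qed


section \<open>Existence\<close>

text \<open>
  The scalars to which the \<open>w\<^sub>i\<close> must be sent: \<open>N\<close> for \<open>i = 0\<close>, the prescribed values for even
  \<open>i > 0\<close>, and those forced by the relation for \<open>w\<^sub>i\<close> when \<open>i\<close> is odd.
\<close>

function central_value :: "complex \<Rightarrow> (nat \<Rightarrow> complex) \<Rightarrow> nat \<Rightarrow> complex"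
  where "central_value N f i =
    (if i = 0 then N else if even i then f i
     else - (central_value N f (i - 1)
       + (\<Sum>j\<in>{1..i}. (- 1) ^ j * (central_value N f (i - j) * central_value N f (j - 1)))) / 2)"
  by auto
termination by (relation "measure (\<lambda>(N, f, i). i)") auto

declare central_value.simps [simp del]

lemma central_value_relation:
  "odd i \<Longrightarrow> - 2 * central_value N f i = central_value N f (i - 1)
    + (\<Sum>j\<in>{1..i}. (- 1) ^ j * (central_value N f (i - j) * central_value N f (j - 1)))"
  by (subst (1) central_value.simps) (auto simp: field_simps)

text \<open>
  The assignment on generators, with \<^const>\<open>brauer_to_group\<close> on the coefficients, extends to the
  free algebra and respects the relations: those involving the \<open>\<bar>s\<^sub>k\<close> become trivial or turn into
  the relations of the degenerate affine Hecke algebra.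
\<close>

lemma affine_brauer_to_hecke_exists:
  shows "\<exists>\<phi>\<in>alg_hom (affine_brauer_algebra n N) (affine_hecke_algebra n).
    (\<forall>b\<in>carrier (brauer_algebra n N).
      \<phi> (affine_brauer_gen n N (Inl b)) = affine_hecke_gen n (Inl (brauer_to_group n b))) \<and>
    (\<forall>k\<in>{1..n}. \<phi> (ab_y n N k) = ah_v n k) \<and>
    (\<forall>i\<ge>1. \<phi> (ab_w n N i) =
      central_value N f i \<odot>\<^bsub>affine_hecke_algebra n\<^esub> \<one>\<^bsub>affine_hecke_algebra n\<^esub>)"
proof -
  define H where "H = affine_hecke_algebra n"
  have H: "complex_algebra H" unfolding H_def by (rule affine_hecke_complex_algebra)
  interpret H: complex_algebra H by (rule H)
  let ?B = "brauer_algebra n N"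
  interpret P: presentation ?B "affine_gens n" "affine_brauer_rels n N"
    by (rule affine_brauer_presentation)
  define F where "F = adjoin_free ?B (affine_gens n)"
  have F: "complex_algebra F" unfolding F_def by (rule P.free_complex_algebra)
  interpret F: complex_algebra F by (rule F)
  define c where "c = central_value N f"
  define g where "g = case_sum (\<lambda>b. affine_hecke_gen n (Inl (brauer_to_group n b)))
    (\<lambda>x. case x of Y k \<Rightarrow> ah_v n k | W i \<Rightarrow> c i \<odot>\<^bsub>H\<^esub> \<one>\<^bsub>H\<^esub>)"
  let ?coeff = "\<lambda>b. affine_hecke_gen n (Inl (brauer_to_group n b))"
  have coeff: "?coeff \<in> alg_hom ?B H"
    unfolding H_def by (rule alg_hom_comp[OF brauer_to_group_alg_hom affine_hecke_coefficient_hom])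
  have g: "g \<in> Inl ` carrier ?B \<union> Inr ` affine_gens n \<rightarrow> carrier H"
    using alg_homD(1)[OF coeff] ah_v_closed[of _ n, folded H_def]
    by (auto simp: g_def affine_gens_def)
  define h where "h = free_lift H g"
  have h: "h \<in> alg_hom F H"
    unfolding h_def F_def adjoin_free_def by (rule H.free_lift_alg_hom[OF g])
  have h_coeff: "h (letter (Inl b)) = ?coeff b" if "b \<in> carrier ?B" for b
    unfolding h_def using H.free_lift_letter[OF g, of "Inl b"] that by (simp add: g_def)
  have h_gen: "h (letter (Inr x)) = g (Inr x)" if "x \<in> affine_gens n" for x
    unfolding h_def using H.free_lift_letter[OF g, of "Inr x"] that by simp
  define w where "w i = (if i = 0 then N \<odot>\<^bsub>F\<^esub> \<one>\<^bsub>F\<^esub> else letter (Inr (W i)))" for i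
  have closed_b: "letter (Inl b) \<in> carrier F" if "b \<in> carrier ?B" for b
    unfolding F_def by (rule P.letters_closed(1)[OF that])
  have closed_s: "letter (Inl (brauer_s n k)) \<in> carrier F" "letter (Inl (brauer_sb n k)) \<in> carrier F"
    if "1 \<le> k" "k < n" for k
    using that by (auto intro!: closed_b brauer_s_closed brauer_sb_closed)
  have closed_y: "letter (Inr (Y k)) \<in> carrier F" if "k \<in> {1..n}" for k
    unfolding F_def using that by (intro P.letters_closed(2)) (simp add: affine_gens_def)
  have "W i \<in> affine_gens n" if "i \<noteq> 0" for i using that by (simp add: affine_gens_def)
  then have closed_w: "w i \<in> carrier F" for i
    unfolding w_def using P.letters_closed(2)[folded F_def] by simp
  have h_s: "h (letter (Inl (brauer_s n k))) = ah_s n k" if "1 \<le> k" "k < n" for k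
    using h_coeff[OF brauer_s_closed[OF that]] brauer_to_group_s[OF that] by simp
  have gen_zero: "affine_hecke_gen n (Inl 0) = \<zero>\<^bsub>H\<^esub>"
    using alg_hom_zero[OF group_algebra_complex_algebra H affine_hecke_coefficient_hom[of n, folded H_def]]
    by (simp add: group_algebra_simps)
  have h_sb: "h (letter (Inl (brauer_sb n k))) = \<zero>\<^bsub>H\<^esub>" if "1 \<le> k" "k < n" for k
    using h_coeff[OF brauer_sb_closed[OF that]] by (simp add: brauer_to_group_sb gen_zero)
  have h_y: "h (letter (Inr (Y k))) = ah_v n k" if "k \<in> {1..n}" for k
    using h_gen[of "Y k"] that by (simp add: g_def affine_gens_def)
  have h_w: "h (w i) = c i \<odot>\<^bsub>H\<^esub> \<one>\<^bsub>H\<^esub>" for i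
  proof (cases "i = 0")
    case True
    then show ?thesis
      by (simp add: w_def alg_homD[OF h] c_def central_value.simps[of N f 0])
  next
    case False
    then show ?thesis using h_gen[of "W i"] by (simp add: w_def g_def affine_gens_def)
  qed
  have V: "ah_v n k \<in> carrier H" if "k \<in> {1..n}" for k
    using ah_v_closed[OF that] by (simp add: H_def)
  note homs = alg_homD[OF h] alg_hom_diff[OF F H h] alg_hom_zero[OF F H h] alg_hom_pow[OF F H h]
  note images = h_s h_sb h_y h_w
  note closed = closed_s closed_y closed_w
  note hecke = affine_hecke_relations_hold[of _ n, folded H_def]
  have scalar_mult: "(a \<odot>\<^bsub>H\<^esub> \<one>\<^bsub>H\<^esub>) \<otimes>\<^bsub>H\<^esub> (b \<odot>\<^bsub>H\<^esub> \<one>\<^bsub>H\<^esub>) = (a * b) \<odot>\<^bsub>H\<^esub> \<one>\<^bsub>H\<^esub>" for a b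
    by (simp add: H.smult_mult_left H.smult_assoc)
  have rel: "h u = h v" if "(u, v) \<in> affine_brauer_rels n N" for u v
  proof -
    have "(u, v) \<in> affine_brauer_relations F n (\<lambda>k. letter (Inl (brauer_s n k)))
      (\<lambda>k. letter (Inl (brauer_sb n k))) (\<lambda>k. letter (Inr (Y k))) w"
      using that unfolding affine_brauer_rels_def Let_def F_def w_def .
    then show ?thesis
    proof (rule affine_brauer_relations_cases, goal_cases)
      case (1 k l)
      then show ?case by (simp add: homs images closed hecke(1))
    next
      case (2 i a)
      then show ?case
        by (simp add: homs images closed H.smult_mult_left H.smult_mult_right)
    next
      case (3 k l)
      then show ?case using hecke(2)[of k l] by (simp add: homs images closed)
    next
      case (4 k l)
      then show ?case by (simp add: homs images closed V)
    next
      case (5 k)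
      then have k: "k \<in> {1..n}" "k + 1 \<in> {1..n}" by auto
      have "h (letter (Inl (brauer_sb n k)) \<ominus>\<^bsub>F\<^esub> \<one>\<^bsub>F\<^esub>) = \<ominus>\<^bsub>H\<^esub> \<one>\<^bsub>H\<^esub>"
        using 5 by (simp add: homs images closed) (simp add: a_minus_def)
      moreover have "h (letter (Inl (brauer_s n k)) \<otimes>\<^bsub>F\<^esub> letter (Inr (Y k)) \<ominus>\<^bsub>F\<^esub>
          letter (Inr (Y (k + 1))) \<otimes>\<^bsub>F\<^esub> letter (Inl (brauer_s n k))) = \<ominus>\<^bsub>H\<^esub> \<one>\<^bsub>H\<^esub>"
        using hecke(3)[OF 5] by (simp only: homs images closed 5 k F.m_closed)
      ultimately show ?case by simp
    next
      case (6 k)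
      then have k: "k \<in> {1..n}" "k + 1 \<in> {1..n}" by auto
      have "h (\<one>\<^bsub>F\<^esub> \<ominus>\<^bsub>F\<^esub> letter (Inl (brauer_sb n k))) = \<one>\<^bsub>H\<^esub>"
        using 6 by (simp add: homs images closed) (simp add: a_minus_def)
      moreover have "h (letter (Inl (brauer_s n k)) \<otimes>\<^bsub>F\<^esub> letter (Inr (Y (k + 1))) \<ominus>\<^bsub>F\<^esub>
          letter (Inr (Y k)) \<otimes>\<^bsub>F\<^esub> letter (Inl (brauer_s n k))) = \<one>\<^bsub>H\<^esub>"
        using hecke(4)[OF 6] by (simp only: homs images closed 6 k F.m_closed)
      ultimately show ?case by simp
    next
      case (7 k)
      then show ?case by (simp add: homs images closed V)
    next
      case (8 k)
      then show ?case by (simp add: homs images closed V)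
    next
      case (9 i)
      then have n: "1 \<le> (1::nat)" "1 < n" "1 \<in> {1..n}" by auto
      have "h (letter (Inl (brauer_sb n 1)) \<otimes>\<^bsub>F\<^esub> letter (Inr (Y 1)) [^]\<^bsub>F\<^esub> i \<otimes>\<^bsub>F\<^esub> letter (Inl (brauer_sb n 1)))
          = \<zero>\<^bsub>H\<^esub> \<otimes>\<^bsub>H\<^esub> ah_v n 1 [^]\<^bsub>H\<^esub> i \<otimes>\<^bsub>H\<^esub> \<zero>\<^bsub>H\<^esub>"
        by (simp only: homs images closed n F.m_closed F.nat_pow_closed)
      also have "\<dots> = \<zero>\<^bsub>H\<^esub>" using V[OF n(3)] by simp
      also have "\<dots> = h (w i \<otimes>\<^bsub>F\<^esub> letter (Inl (brauer_sb n 1)))"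
        using n by (simp add: homs images closed del: One_nat_def)
      finally show ?case .
    next
      case (10 i)
      \<comment> \<open>Both sides are multiples of \<open>\<one>\<close>, and the scalars satisfy the recursion for odd \<open>i\<close>.\<close>
      have "h ((- 2) \<odot>\<^bsub>F\<^esub> w i) = (- 2 * c i) \<odot>\<^bsub>H\<^esub> \<one>\<^bsub>H\<^esub>"
        by (simp only: homs images closed H.smult_assoc H.one_closed)
      also have "\<dots> = c (i - 1) \<odot>\<^bsub>H\<^esub> \<one>\<^bsub>H\<^esub> \<oplus>\<^bsub>H\<^esub>
          (\<Sum>j\<in>{1..i}. (- 1) ^ j * (c (i - j) * c (j - 1))) \<odot>\<^bsub>H\<^esub> \<one>\<^bsub>H\<^esub>"
        unfolding c_def central_value_relation[OF 10] by (rule H.smult_l_distr) simp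
      also have "(\<Sum>j\<in>{1..i}. (- 1) ^ j * (c (i - j) * c (j - 1))) \<odot>\<^bsub>H\<^esub> \<one>\<^bsub>H\<^esub> =
          (\<Oplus>\<^bsub>H\<^esub>j\<in>{1..i}. h ((- 1) ^ j \<odot>\<^bsub>F\<^esub> (w (i - j) \<otimes>\<^bsub>F\<^esub> w (j - 1))))"
        unfolding H.scalar_sum[OF finite_atLeastAtMost, symmetric]
        by (rule H.finsum_cong')
           (simp_all add: homs images closed scalar_mult H.smult_assoc[symmetric] Pi_def)
      also have "\<dots> = h (\<Oplus>\<^bsub>F\<^esub>j\<in>{1..i}. (- 1) ^ j \<odot>\<^bsub>F\<^esub> (w (i - j) \<otimes>\<^bsub>F\<^esub> w (j - 1)))"
        by (rule alg_hom_finsum[OF F H h, symmetric]) (simp_all add: closed)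
      also have "c (i - 1) \<odot>\<^bsub>H\<^esub> \<one>\<^bsub>H\<^esub> \<oplus>\<^bsub>H\<^esub> \<dots> =
          h (w (i - 1) \<oplus>\<^bsub>F\<^esub> (\<Oplus>\<^bsub>F\<^esub>j\<in>{1..i}. (- 1) ^ j \<odot>\<^bsub>F\<^esub> (w (i - j) \<otimes>\<^bsub>F\<^esub> w (j - 1))))"
        using closed_w by (simp add: homs h_w Pi_def)
      finally show ?case .
    qed
  qed
  have h_coeff_hom: "(\<lambda>b. h (letter (Inl b))) \<in> alg_hom ?B H"
    by (rule alg_homI) (simp_all only: h_coeff brauer_algebra_closed alg_homD[OF coeff])
  have all_rel: "h u = h v" if "(u, v) \<in> coefficient_relations ?B (affine_gens n) \<union> affine_brauer_rels n N" for u v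
    using that rel[of u v] P.coefficient_relations_respected[OF h[unfolded F_def] h_coeff_hom, of u v]
    by (elim UnE)
  have "\<exists>\<phi>\<in>alg_hom (affine_brauer_algebra n N) H. \<forall>p\<in>carrier F.
      \<phi> (adjoin_ideal ?B (affine_gens n) (affine_brauer_rels n N) +>\<^bsub>F\<^esub> p) = h p"
    unfolding affine_brauer_algebra_def F_def
    by (rule P.presented_lift[OF H h[unfolded F_def]]) (rule all_rel)
  then obtain \<phi> where \<phi>: "\<phi> \<in> alg_hom (affine_brauer_algebra n N) H"
    "\<And>p. p \<in> carrier F \<Longrightarrow> \<phi> (adjoin_ideal ?B (affine_gens n) (affine_brauer_rels n N) +>\<^bsub>F\<^esub> p) = h p"
    by blast
  have \<phi>_gen: "\<phi> (affine_brauer_gen n N x) = h (letter x)" if "letter x \<in> carrier F" for x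
    using \<phi>(2)[OF that] by (simp add: affine_brauer_gen_def P.gen_eq F_def)
  show ?thesis
    unfolding H_def[symmetric] c_def[symmetric]
  proof (intro bexI[of _ \<phi>] conjI ballI allI impI)
    show "\<phi> (affine_brauer_gen n N (Inl b)) = affine_hecke_gen n (Inl (brauer_to_group n b))"
      if "b \<in> carrier ?B" for b
      using that by (simp add: \<phi>_gen closed_b h_coeff)
    show "\<phi> (ab_y n N k) = ah_v n k" if "k \<in> {1..n}" for k
      using that by (simp only: \<phi>_gen closed_y h_y)
    show "\<phi> (ab_w n N i) = c i \<odot>\<^bsub>H\<^esub> \<one>\<^bsub>H\<^esub>" if "1 \<le> i" for i
      using that h_w[of i] closed_w[of i] by (simp add: \<phi>_gen w_def)
  qed (rule \<phi>(1))
qed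


section \<open>Uniqueness and surjectivity\<close>

lemma ab_w_closed: "1 \<le> i \<Longrightarrow> ab_w n N i \<in> carrier (affine_brauer_algebra n N)"
  unfolding affine_brauer_algebra_def affine_brauer_gen_def
  by (rule presentation.gen_closed(2)[OF affine_brauer_presentation]) (simp add: affine_gens_def)

text \<open>The relation for \<open>w\<^sub>i\<close> with odd \<open>i\<close>, in \<open>A(n,N)\<close> itself rather than in the free algebra.\<close>

lemma affine_brauer_odd_w:
  fixes n :: nat and N :: complex
  defines "A \<equiv> affine_brauer_algebra n N"
  defines "w \<equiv> \<lambda>i. if i = 0 then N \<odot>\<^bsub>A\<^esub> \<one>\<^bsub>A\<^esub> else ab_w n N i"
  assumes i: "odd i"
  shows "(- 2) \<odot>\<^bsub>A\<^esub> w i = w (i - 1) \<oplus>\<^bsub>A\<^esub>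
    (\<Oplus>\<^bsub>A\<^esub>j\<in>{1..i}. (- 1) ^ j \<odot>\<^bsub>A\<^esub> (w (i - j) \<otimes>\<^bsub>A\<^esub> w (j - 1)))"
proof -
  let ?B = "brauer_algebra n N"
  interpret P: presentation ?B "affine_gens n" "affine_brauer_rels n N"
    by (rule affine_brauer_presentation)
  define F where "F = adjoin_free ?B (affine_gens n)"
  have F: "complex_algebra F" unfolding F_def by (rule P.free_complex_algebra)
  interpret F: complex_algebra F by (rule F)
  have A: "complex_algebra A" unfolding A_def by (rule affine_brauer_complex_algebra)
  define q where "q = (+>\<^bsub>F\<^esub>) (adjoin_ideal ?B (affine_gens n) (affine_brauer_rels n N))"
  have q: "q \<in> alg_hom F A"
    unfolding q_def F_def A_def affine_brauer_algebra_def by (rule P.quot_alg_hom)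
  define w' where "w' i = (if i = 0 then N \<odot>\<^bsub>F\<^esub> \<one>\<^bsub>F\<^esub> else letter (Inr (W i)))" for i
  have "W i \<in> affine_gens n" if "i \<noteq> 0" for i using that by (simp add: affine_gens_def)
  then have closed: "w' i \<in> carrier F" for i
    unfolding w'_def using P.letters_closed(2)[folded F_def] by simp
  have gen: "affine_brauer_gen n N x = q (letter x)" for x
    by (simp add: affine_brauer_gen_def P.gen_eq q_def F_def)
  have q_w: "q (w' i) = w i" for i
    by (simp add: w'_def w_def alg_homD[OF q] gen)
  have "((- 2) \<odot>\<^bsub>F\<^esub> w' i, w' (i - 1) \<oplus>\<^bsub>F\<^esub> (\<Oplus>\<^bsub>F\<^esub>j\<in>{1..i}. (- 1) ^ j \<odot>\<^bsub>F\<^esub> (w' (i - j) \<otimes>\<^bsub>F\<^esub> w' (j - 1))))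
      \<in> affine_brauer_rels n N"
    unfolding affine_brauer_rels_def Let_def F_def[symmetric] affine_brauer_relations_def w'_def[symmetric]
    by (rule UnI2) (use i in blast)
  then have "q ((- 2) \<odot>\<^bsub>F\<^esub> w' i) =
      q (w' (i - 1) \<oplus>\<^bsub>F\<^esub> (\<Oplus>\<^bsub>F\<^esub>j\<in>{1..i}. (- 1) ^ j \<odot>\<^bsub>F\<^esub> (w' (i - j) \<otimes>\<^bsub>F\<^esub> w' (j - 1))))"
    unfolding q_def F_def by (intro P.quot_rel) blast
  also have "\<dots> = w (i - 1) \<oplus>\<^bsub>A\<^esub>
      q (\<Oplus>\<^bsub>F\<^esub>j\<in>{1..i}. (- 1) ^ j \<odot>\<^bsub>F\<^esub> (w' (i - j) \<otimes>\<^bsub>F\<^esub> w' (j - 1)))"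
    using closed by (simp add: alg_homD[OF q] q_w Pi_def)
  also have "q (\<Oplus>\<^bsub>F\<^esub>j\<in>{1..i}. (- 1) ^ j \<odot>\<^bsub>F\<^esub> (w' (i - j) \<otimes>\<^bsub>F\<^esub> w' (j - 1))) =
      (\<Oplus>\<^bsub>A\<^esub>j\<in>{1..i}. q ((- 1) ^ j \<odot>\<^bsub>F\<^esub> (w' (i - j) \<otimes>\<^bsub>F\<^esub> w' (j - 1))))"
    by (rule alg_hom_finsum[OF F A q]) (simp_all add: closed)
  also have "\<dots> = (\<Oplus>\<^bsub>A\<^esub>j\<in>{1..i}. (- 1) ^ j \<odot>\<^bsub>A\<^esub> (w (i - j) \<otimes>\<^bsub>A\<^esub> w (j - 1)))"
    by (simp add: alg_homD[OF q] closed q_w)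
  finally show ?thesis by (simp add: alg_homD[OF q] closed q_w)
qed

text \<open>The relation for odd \<open>i\<close> expresses \<open>w\<^sub>i\<close> by the preceding ones, as \<open>-2\<close> is invertible.\<close>

lemma affine_brauer_hom_w_unique:
  assumes C: "complex_algebra C"
    and g: "g \<in> alg_hom (affine_brauer_algebra n N) C" and h: "h \<in> alg_hom (affine_brauer_algebra n N) C"
    and even: "\<And>i. even i \<Longrightarrow> 2 \<le> i \<Longrightarrow> g (ab_w n N i) = h (ab_w n N i)"
    and "1 \<le> i"
  shows "g (ab_w n N i) = h (ab_w n N i)"
proof -
  define A where "A = affine_brauer_algebra n N"
  have A: "complex_algebra A" unfolding A_def by (rule affine_brauer_complex_algebra)
  interpret A: complex_algebra A by (rule A)
  interpret C: complex_algebra C by (rule C)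
  note g = g[folded A_def] and h = h[folded A_def]
  define w where "w i = (if i = 0 then N \<odot>\<^bsub>A\<^esub> \<one>\<^bsub>A\<^esub> else ab_w n N i)" for i
  have closed: "w i \<in> carrier A" for i
    using ab_w_closed[of i n N] by (simp add: w_def A_def[symmetric])
  have "g (w i) = h (w i)" for i
  proof (induction i rule: less_induct)
    case (less i)
    show ?case
    proof (cases "odd i")
      case True
      have rel: "(- 2) \<odot>\<^bsub>A\<^esub> w i = w (i - 1) \<oplus>\<^bsub>A\<^esub>
          (\<Oplus>\<^bsub>A\<^esub>j\<in>{1..i}. (- 1) ^ j \<odot>\<^bsub>A\<^esub> (w (i - j) \<otimes>\<^bsub>A\<^esub> w (j - 1)))"
        using affine_brauer_odd_w[OF True, of n N] unfolding A_def w_def .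
      have image: "(- 2) \<odot>\<^bsub>C\<^esub> f (w i) = f (w (i - 1)) \<oplus>\<^bsub>C\<^esub>
          (\<Oplus>\<^bsub>C\<^esub>j\<in>{1..i}. (- 1) ^ j \<odot>\<^bsub>C\<^esub> (f (w (i - j)) \<otimes>\<^bsub>C\<^esub> f (w (j - 1))))"
        if f: "f \<in> alg_hom A C" for f
      proof -
        have "(- 2) \<odot>\<^bsub>C\<^esub> f (w i) = f (w (i - 1) \<oplus>\<^bsub>A\<^esub>
          (\<Oplus>\<^bsub>A\<^esub>j\<in>{1..i}. (- 1) ^ j \<odot>\<^bsub>A\<^esub> (w (i - j) \<otimes>\<^bsub>A\<^esub> w (j - 1))))"
          unfolding rel[symmetric] by (simp only: alg_homD[OF f] closed)
        also have "\<dots> = f (w (i - 1)) \<oplus>\<^bsub>C\<^esub>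
          f (\<Oplus>\<^bsub>A\<^esub>j\<in>{1..i}. (- 1) ^ j \<odot>\<^bsub>A\<^esub> (w (i - j) \<otimes>\<^bsub>A\<^esub> w (j - 1)))"
          by (rule alg_homD(3)[OF f closed]) (use closed in \<open>simp add: Pi_def\<close>)
        also have "f (\<Oplus>\<^bsub>A\<^esub>j\<in>{1..i}. (- 1) ^ j \<odot>\<^bsub>A\<^esub> (w (i - j) \<otimes>\<^bsub>A\<^esub> w (j - 1))) =
          (\<Oplus>\<^bsub>C\<^esub>j\<in>{1..i}. f ((- 1) ^ j \<odot>\<^bsub>A\<^esub> (w (i - j) \<otimes>\<^bsub>A\<^esub> w (j - 1))))"
          by (rule alg_hom_finsum[OF A C f]) (simp_all add: closed)
        also have "\<dots> = (\<Oplus>\<^bsub>C\<^esub>j\<in>{1..i}. (- 1) ^ j \<odot>\<^bsub>C\<^esub> (f (w (i - j)) \<otimes>\<^bsub>C\<^esub> f (w (j - 1))))"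
          by (simp only: alg_homD[OF f] closed A.m_closed)
        finally show ?thesis .
      qed
      have IH: "g (w (i - 1)) = h (w (i - 1))"
        using True by (intro less.IH) (auto elim: oddE)
      have sums: "(\<Oplus>\<^bsub>C\<^esub>j\<in>{1..i}. (- 1) ^ j \<odot>\<^bsub>C\<^esub> (g (w (i - j)) \<otimes>\<^bsub>C\<^esub> g (w (j - 1)))) =
          (\<Oplus>\<^bsub>C\<^esub>j\<in>{1..i}. (- 1) ^ j \<odot>\<^bsub>C\<^esub> (h (w (i - j)) \<otimes>\<^bsub>C\<^esub> h (w (j - 1))))"
      proof (rule C.finsum_cong')
        fix j assume "j \<in> {1..i}"
        then have "i - j < i" "j - 1 < i" by auto
        then show "(- 1) ^ j \<odot>\<^bsub>C\<^esub> (g (w (i - j)) \<otimes>\<^bsub>C\<^esub> g (w (j - 1))) =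
            (- 1) ^ j \<odot>\<^bsub>C\<^esub> (h (w (i - j)) \<otimes>\<^bsub>C\<^esub> h (w (j - 1)))"
          by (simp only: less.IH)
      qed (simp_all add: alg_homD(1)[OF h] closed)
      have "(- 2) \<odot>\<^bsub>C\<^esub> g (w i) = (- 2) \<odot>\<^bsub>C\<^esub> h (w i)"
        by (simp only: image[OF g] image[OF h] IH sums)
      then show ?thesis
        by (rule C.smult_cancel[rotated 3]) (simp_all add: alg_homD(1)[OF g] alg_homD(1)[OF h] closed)
    next
      case False
      show ?thesis
      proof (cases "i = 0")
        case True
        then show ?thesis by (simp add: w_def alg_homD[OF g] alg_homD[OF h])
      next
        case False
        with \<open>\<not> odd i\<close> have "2 \<le> i" by (auto elim!: evenE)
        with \<open>\<not> odd i\<close> even[of i] show ?thesis by (simp add: w_def)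
      qed
    qed
  qed
  from this[of i] \<open>1 \<le> i\<close> show ?thesis by (simp add: w_def)
qed

lemma affine_brauer_hom_unique:
  assumes C: "complex_algebra C"
    and g: "g \<in> alg_hom (affine_brauer_algebra n N) C" and h: "h \<in> alg_hom (affine_brauer_algebra n N) C"
    and s: "\<And>k. 1 \<le> k \<Longrightarrow> k < n \<Longrightarrow> g (ab_s n N k) = h (ab_s n N k)"
    and sb: "1 < n \<Longrightarrow> g (ab_sb n N 1) = \<zero>\<^bsub>C\<^esub>" "1 < n \<Longrightarrow> h (ab_sb n N 1) = \<zero>\<^bsub>C\<^esub>"
    and y: "\<And>k. k \<in> {1..n} \<Longrightarrow> g (ab_y n N k) = h (ab_y n N k)"
    and w: "\<And>i. even i \<Longrightarrow> 2 \<le> i \<Longrightarrow> g (ab_w n N i) = h (ab_w n N i)"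
    and x: "x \<in> carrier (affine_brauer_algebra n N)"
  shows "g x = h x"
proof -
  interpret P: presentation "brauer_algebra n N" "affine_gens n" "affine_brauer_rels n N"
    by (rule affine_brauer_presentation)
  have "g (affine_brauer_gen n N (Inl b)) = h (affine_brauer_gen n N (Inl b))"
    if "b \<in> carrier (brauer_algebra n N)" for b
    by (rule brauer_hom_unique[OF C alg_hom_comp[OF affine_brauer_coefficient_hom g]
          alg_hom_comp[OF affine_brauer_coefficient_hom h] s sb that])
  moreover have "g (affine_brauer_gen n N (Inr z)) = h (affine_brauer_gen n N (Inr z))"
    if "z \<in> affine_gens n" for z
  proof (cases z)
    case (Y k)
    with that have "k \<in> {1..n}" by (auto simp: affine_gens_def)
    with Y y show ?thesis by simp
  next
    case (W i)
    with that have "1 \<le> i" by (auto simp: affine_gens_def)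
    with W affine_brauer_hom_w_unique[OF C g h w] show ?thesis by simp
  qed
  ultimately show ?thesis
    by (rule P.presented_hom_unique[folded affine_brauer_algebra_def affine_brauer_gen_def, OF C g h _ _ x])
qed

theorem corollary4p9:
  fixes n :: nat and N :: complex and f :: "nat \<Rightarrow> complex"
  assumes "n \<ge> 1"
  shows "\<exists>\<phi> \<in> alg_hom (affine_brauer_algebra n N) (affine_hecke_algebra n).
    prescribed_on_gens n N f \<phi> \<and>
    \<phi> ` carrier (affine_brauer_algebra n N) = carrier (affine_hecke_algebra n) \<and>
    (\<forall>\<psi> \<in> alg_hom (affine_brauer_algebra n N) (affine_hecke_algebra n).
      prescribed_on_gens n N f \<psi> \<longrightarrow> (\<forall>x \<in> carrier (affine_brauer_algebra n N). \<psi> x = \<phi> x))"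
proof -
  let ?A = "affine_brauer_algebra n N" and ?H = "affine_hecke_algebra n"
  have H: "complex_algebra ?H" by (rule affine_hecke_complex_algebra)
  obtain \<phi> where \<phi>: "\<phi> \<in> alg_hom ?A ?H"
    and coeff: "\<And>b. b \<in> carrier (brauer_algebra n N) \<Longrightarrow>
      \<phi> (affine_brauer_gen n N (Inl b)) = affine_hecke_gen n (Inl (brauer_to_group n b))"
    and y: "\<And>k. k \<in> {1..n} \<Longrightarrow> \<phi> (ab_y n N k) = ah_v n k"
    and w: "\<And>i. 1 \<le> i \<Longrightarrow> \<phi> (ab_w n N i) = central_value N f i \<odot>\<^bsub>?H\<^esub> \<one>\<^bsub>?H\<^esub>"
    using affine_brauer_to_hecke_exists[of n N f] by blast
  have gen_zero: "affine_hecke_gen n (Inl 0) = \<zero>\<^bsub>?H\<^esub>"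
    using alg_hom_zero[OF group_algebra_complex_algebra H affine_hecke_coefficient_hom]
    by (simp add: group_algebra_simps)
  have prescribed: "prescribed_on_gens n N f \<phi>"
    unfolding prescribed_on_gens_def
  proof (intro conjI allI ballI impI; (elim conjE)?)
    fix k assume k: "1 \<le> k" "k < n"
    show "\<phi> (ab_s n N k) = ah_s n k"
      using coeff[OF brauer_s_closed[OF k]] brauer_to_group_s[OF k] by simp
    show "\<phi> (ab_sb n N k) = \<zero>\<^bsub>?H\<^esub>"
      using coeff[OF brauer_sb_closed[OF k]] by (simp add: brauer_to_group_sb gen_zero)
  next
    fix k assume "k \<in> {1..n}"
    then show "\<phi> (ab_y n N k) = ah_v n k" by (rule y)
  next
    fix i :: nat assume i: "even i" "2 \<le> i"
    then have "central_value N f i = f i" by (simp add: central_value.simps[of N f i])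
    with w[of i] i show "\<phi> (ab_w n N i) = f i \<odot>\<^bsub>?H\<^esub> \<one>\<^bsub>?H\<^esub>" by simp
  qed
  have A: "complex_algebra ?A" by (rule affine_brauer_complex_algebra)
  have in_image: "affine_hecke_gen n (Inl b) \<in> \<phi> ` carrier ?A"
    if b: "b \<in> carrier (group_algebra (sym_group n))" for b
  proof -
    obtain p where p: "p \<in> carrier (brauer_algebra n N)" "brauer_to_group n p = b"
      using brauer_to_group_surj[OF b] by blast
    have "affine_brauer_gen n N (Inl p) \<in> carrier ?A"
      by (rule alg_homD(1)[OF affine_brauer_coefficient_hom p(1)])
    with coeff[OF p(1)] p(2) show ?thesis by (metis imageI)
  qed
  have v_image: "ah_v n k \<in> \<phi> ` carrier ?A" if k: "k \<in> {1..n}" for k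
  proof -
    have "ab_y n N k \<in> carrier ?A"
      unfolding affine_brauer_algebra_def affine_brauer_gen_def
      by (rule presentation.gen_closed(2)[OF affine_brauer_presentation]) (use k in \<open>simp add: affine_gens_def\<close>)
    with y[OF k] show ?thesis by (metis imageI)
  qed
  have surj: "\<phi> ` carrier ?A = carrier ?H"
    using presentation.presented_surj[OF affine_hecke_presentation A, of \<phi> n] \<phi> in_image v_image
    unfolding affine_hecke_algebra_def affine_hecke_gen_def by blast
  have "\<psi> x = \<phi> x"
    if "\<psi> \<in> alg_hom ?A ?H" "prescribed_on_gens n N f \<psi>" "x \<in> carrier ?A" for \<psi> x
    using that prescribed unfolding prescribed_on_gens_def
    by (intro affine_brauer_hom_unique[OF H that(1) \<phi> _ _ _ _ _ that(3)]) auto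
  with \<phi> prescribed surj show ?thesis by blast
qed

end
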